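(* Let $d \ge 3$ be an integer and let $N > 0$. There exist a real-valued function $F \in C^\infty(\mathbb{R}\times\mathbb{T}^d)$, $F \not\equiv 0$, and a constant $C$ such that $$|\Delta F(x)| \le C\,|F(x)| \qquad\text{and}\qquad |F(x)| \le C\, e^{-N|w|^{4/3}}$$ for all $x = (w,y) \in \mathbb{R}\times\mathbb{T}^d$.
   Context: $\mathbb{T}^d = \mathbb{R}^d/(2\pi\mathbb{Z})^d$. Points of the cylinder $\mathbb{R}\times\mathbb{T}^d$ are written $x=(w,y)$ with $w\in\mathbb{R}$, $y\in\mathbb{T}^d$, and $\Delta = \partial_w^2 + \sum_{j=1}^d \partial_{y_j}^2$. *)

theory Defs
  imports "HOL-Analysis.Analysis"
begin

text \<open>The torus \<open>\<real>\<^sup>d/(2\<pi>\<int>)\<^sup>d\<close>; the dimension \<open>d\<close> is the cardinality of the index type.\<close>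

definition torus_rel :: "real ^ 'd \<Rightarrow> real ^ 'd \<Rightarrow> bool" where
  "torus_rel u v \<longleftrightarrow> (\<forall>j. \<exists>k::int. u $ j - v $ j = 2 * pi * of_int k)"

lemma equivp_torus_rel: "equivp torus_rel"
proof (rule equivpI)
  show "reflp torus_rel"
    by (auto simp: reflp_def torus_rel_def intro: exI[of _ 0])
  show "symp torus_rel"
    unfolding symp_def torus_rel_def
  proof (intro allI impI)
    fix u v :: "real ^ 'd" and j
    assume "\<forall>j. \<exists>k::int. u $ j - v $ j = 2 * pi * of_int k"
    then obtain k :: int where "u $ j - v $ j = 2 * pi * of_int k" by blast
    then have "v $ j - u $ j = 2 * pi * of_int (- k)" by simp
    then show "\<exists>k::int. v $ j - u $ j = 2 * pi * of_int k" by blast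
  qed
  show "transp torus_rel"
    unfolding transp_def torus_rel_def
  proof (intro allI impI)
    fix u v w :: "real ^ 'd" and j
    assume "\<forall>j. \<exists>k::int. u $ j - v $ j = 2 * pi * of_int k"
      and "\<forall>j. \<exists>k::int. v $ j - w $ j = 2 * pi * of_int k"
    then obtain k l :: int where
      "u $ j - v $ j = 2 * pi * of_int k" "v $ j - w $ j = 2 * pi * of_int l" by blast
    then have "u $ j - w $ j = 2 * pi * of_int (k + l)" by (simp add: algebra_simps)
    then show "\<exists>k::int. u $ j - w $ j = 2 * pi * of_int k" by blast
  qed
qed

quotient_type (overloaded) 'd torus = "real ^ ('d::finite)" / torus_rel
  morphisms rep_torus torus_of
  by (rule equivp_torus_rel)

text \<open>The pullback of a function on \<open>\<real> \<times> \<T>\<^sup>d\<close> to the universal cover \<open>\<real> \<times> \<real>\<^sup>d\<close>. The covering map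
  is a local diffeomorphism, so smoothness and the Laplacian on the cylinder are those of the pullback.\<close>

definition cyl_lift :: "(real \<times> 'd::finite torus \<Rightarrow> real) \<Rightarrow> real \<times> (real ^ 'd) \<Rightarrow> real" where
  "cyl_lift F = (\<lambda>(w, v). F (w, torus_of v))"

definition dir_deriv :: "'a::euclidean_space \<Rightarrow> ('a \<Rightarrow> real) \<Rightarrow> 'a \<Rightarrow> real" where
  "dir_deriv e f x = frechet_derivative f (at x) e"

fun Ck :: "nat \<Rightarrow> ('a::euclidean_space \<Rightarrow> real) \<Rightarrow> bool" where
  "Ck 0 f \<longleftrightarrow> continuous_on UNIV f"
| "Ck (Suc k) f \<longleftrightarrow> f differentiable_on UNIV \<and> (\<forall>e. Ck k (dir_deriv e f))"

definition cyl_smooth :: "(real \<times> 'd::finite torus \<Rightarrow> real) \<Rightarrow> bool" where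
  "cyl_smooth F \<longleftrightarrow> (\<forall>k. Ck k (cyl_lift F))"

definition laplacian :: "(real \<times> (real ^ 'd) \<Rightarrow> real) \<Rightarrow> real \<times> (real ^ 'd::finite) \<Rightarrow> real" where
  "laplacian f x = dir_deriv (1, 0) (dir_deriv (1, 0) f) x
     + (\<Sum>j\<in>UNIV. dir_deriv (0, axis j 1) (dir_deriv (0, axis j 1) f) x)"

definition cyl_laplacian :: "(real \<times> 'd::finite torus \<Rightarrow> real) \<Rightarrow> real \<times> 'd torus \<Rightarrow> real" where
  "cyl_laplacian F = (\<lambda>(w, y). laplacian (cyl_lift F) (w, rep_torus y))"

lemma dir_deriv_shift:
  assumes "\<And>x. f (x + a) = f x"
  shows "dir_deriv e f (x + a) = dir_deriv e f x"
proof -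
  have "(f has_derivative D) (at (x + a)) \<longleftrightarrow> (f has_derivative D) (at x)" for D
  proof
    assume D: "(f has_derivative D) (at (x + a))"
    have "((\<lambda>z. f (z + a)) has_derivative (\<lambda>h. D h)) (at x)"
      by (rule has_derivative_compose[of "\<lambda>z. z + a" "\<lambda>h. h"]) (auto intro!: derivative_eq_intros D)
    then show "(f has_derivative D) (at x)" by (simp add: assms)
  next
    assume D: "(f has_derivative D) (at x)"
    have "((\<lambda>z. f (z - a)) has_derivative (\<lambda>h. D h)) (at (x + a))"
      by (rule has_derivative_compose[of "\<lambda>z. z - a" "\<lambda>h. h"]) (auto intro!: derivative_eq_intros D)
    moreover have "f (z - a) = f z" for z using assms[of "z - a"] by simp
    ultimately show "(f has_derivative D) (at (x + a))" by simp
  qed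
  then show ?thesis by (simp add: dir_deriv_def frechet_derivative_def)
qed

text \<open>The Laplacian on the cylinder does not depend on the chosen representative.\<close>

lemma cyl_laplacian_torus_of: "cyl_laplacian F (w, torus_of v) = laplacian (cyl_lift F) (w, v)"
proof -
  define a where "a = (0::real, rep_torus (torus_of v) - v)"
  have rel: "torus_rel (rep_torus (torus_of v)) v"
    by (metis Quotient_torus Quotient_rep_abs equivp_torus_rel equivp_reflp)
  have "torus_of (u + (rep_torus (torus_of v) - v)) = torus_of u" for u
    using rel by (simp add: torus.abs_eq_iff torus_rel_def)
  then have "cyl_lift F (x + a) = cyl_lift F x" for x
    by (simp add: cyl_lift_def a_def split_beta)
  then have "laplacian (cyl_lift F) ((w, v) + a) = laplacian (cyl_lift F) (w, v)"
    by (simp add: laplacian_def dir_deriv_shift)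
  then show ?thesis by (simp add: cyl_laplacian_def a_def)
qed

end

theory Submission
  imports Defs "HOL-Number_Theory.Number_Theory" "HOL-Computational_Algebra.Squarefree"
begin

text \<open>
  On a three-dimensional subtorus take frequencies \<open>k\<^sub>j\<close> with \<open>|k\<^sub>j|\<^sup>2 = \<lambda>\<^sub>j = 4(j + n\<^sub>0) + 1\<close>; they exist because
  every natural number congruent to 1 modulo 4 is a sum of three squares. The solution passes from the mode
  \<open>exp(-\<surd>\<lambda>\<^sub>j w) cos(k\<^sub>j \<cdot> y)\<close> to the mode of \<open>k\<^sub>j\<^sub>+\<^sub>1\<close> during a block of length comparable to \<open>c\<surd>\<lambda>\<^sub>j\<close>. The exponent then
  grows like \<open>w\<^sup>1\<^sup>/\<^sup>3\<close>, and small \<open>c\<close> gives decay \<open>exp(-N w\<^sup>4\<^sup>/\<^sup>3)\<close> for any \<open>N\<close>.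

  Inside a block let \<open>G = p cos \<theta> + q cos \<theta>'\<close> with \<open>\<theta> = k\<^sub>j \<cdot> y\<close>, \<open>\<theta>' = k\<^sub>j\<^sub>+\<^sub>1 \<cdot> y\<close>, and let \<open>P\<close> be the conjugated Laplacian.
  To make \<open>P F\<close> divisible by \<open>F\<close> up to bounded factors, put \<open>F = G + S G\<^sup>2/\<lambda>\<close>: on the zero set of \<open>G\<close> one has
  \<open>P F = P G + 2 S |\<nabla>G|\<^sup>2/\<lambda>\<close>, which \<open>S = - P G/(2 |\<nabla>G|\<^sup>2/\<lambda>)\<close> cancels. This breaks down only where \<open>G = 0\<close> and \<open>\<nabla>G = 0\<close>,
  that is, when \<open>p = q\<close> and \<open>\<theta>, \<theta>' \<in> \<pi>\<int>\<close>. There \<open>\<theta>\<close> is replaced by a slightly stretched phase, linear near \<open>\<pi>\<int>\<close>, so that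
  the first mode locally has the larger eigenvalue; then \<open>p/q\<close> may decrease exponentially while \<open>P G\<close> is exactly a
  bounded multiple of \<open>G\<close> near the critical set.
\<close>

section \<open>Families of smooth functions with uniform bounds\<close>

text \<open>The dimension enters through arithmetic. The potential stays bounded because consecutive
  values of \<open>|k|\<^sup>2\<close> differ by a bounded amount, and sums of two squares have
  arbitrarily long gaps. Consecutive frequencies must also stay uniformly transversal, for otherwise
  the gradient form degenerates; this is the origin of the bound 1/3 on the squared cosine of their
  angle.

  The three squares come from a ternary equation s w^2 = x^2 + q y^2 with an auxiliary prime q. Only
  quadratic symbols of q have to be prescribed, so only real characters occur, and the nonvanishing
  of L(1) has an elementary proof.

  The constants: a block has length 10 sqrt(la) / h and adds 10 la / h to the exponent, where la is
  about 4 j for the j-th block. After j blocks w is about (40/3) j^(3/2) / h and the exponent about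
  20 j^2 / h, which is a constant times h^(1/3) w^(4/3). A large h therefore beats any N.\<close>

lemma dir_deriv_eqI: "(f has_derivative D) (at x) \<Longrightarrow> dir_deriv e f x = D e"
  unfolding dir_deriv_def by (metis frechet_derivative_at)

lemma has_derivative_dir_deriv:
  "f differentiable (at x) \<Longrightarrow> (f has_derivative (\<lambda>e. dir_deriv e f x)) (at x)"
  unfolding dir_deriv_def by (simp add: frechet_derivative_works)

text \<open>\<open>frechet_derivative\<close> is a choice among all derivatives at the point, and
  \<open>f\<close> and \<open>g\<close> have the same ones there, even if there are none.\<close>

lemma dir_deriv_local:
  assumes "open U" "x \<in> U" "\<And>y. y \<in> U \<Longrightarrow> f y = g y"
  shows "dir_deriv e f x = dir_deriv e g x"
proof -
  have "(f has_derivative D) (at x) \<longleftrightarrow> (g has_derivative D) (at x)" for D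
    using has_derivative_transform_within_open[OF _ assms(1,2)] assms(3) by metis
  then show ?thesis by (simp add: dir_deriv_def frechet_derivative_def)
qed

lemma dir_deriv_linear:
  assumes "f differentiable (at x)"
  shows "linear (\<lambda>e. dir_deriv e f x)"
  using has_derivative_dir_deriv[OF assms] by (rule has_derivative_linear)

lemma dir_deriv_const [simp]: "dir_deriv e (\<lambda>x. c) = (\<lambda>x. 0)"
  by (auto simp: dir_deriv_def)

lemma dir_deriv_bounded_linear: "bounded_linear a \<Longrightarrow> dir_deriv e a = (\<lambda>x. a e)"
  by (rule ext, rule dir_deriv_eqI) (rule bounded_linear_imp_has_derivative)

lemma dir_deriv_add:
  assumes "f differentiable (at x)" "g differentiable (at x)"
  shows "dir_deriv e (\<lambda>y. f y + g y) x = dir_deriv e f x + dir_deriv e g x"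
  by (rule dir_deriv_eqI) (intro derivative_intros assms[THEN has_derivative_dir_deriv])

lemma dir_deriv_mult:
  assumes "f differentiable (at x)" "g differentiable (at x)"
  shows "dir_deriv e (\<lambda>y. f y * g y) x = f x * dir_deriv e g x + dir_deriv e f x * g x"
  by (rule dir_deriv_eqI[OF has_derivative_mult, OF assms[THEN has_derivative_dir_deriv]])

lemma dir_deriv_real_comp:
  assumes "h differentiable (at (f x))" "f differentiable (at x)"
  shows "dir_deriv e (\<lambda>y. h (f y)) x = dir_deriv 1 h (f x) * dir_deriv e f x"
proof -
  have "linear (\<lambda>e. dir_deriv e h (f x))"
    by (rule dir_deriv_linear[OF assms(1)])
  then have *: "dir_deriv r h (f x) = r * dir_deriv 1 h (f x)" for r
    using linear_scale[of "\<lambda>e. dir_deriv e h (f x)" r 1] by simp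
  have "((\<lambda>y. h (f y)) has_derivative (\<lambda>e. dir_deriv (dir_deriv e f x) h (f x))) (at x)"
    using has_derivative_compose[of f "\<lambda>e. dir_deriv e f x" x UNIV h "\<lambda>e. dir_deriv e h (f x)"]
      has_derivative_dir_deriv[OF assms(2)] has_derivative_dir_deriv[OF assms(1)] by simp
  from dir_deriv_eqI[OF this] show ?thesis using *[of "dir_deriv e f x"] by simp
qed

lemma dir_deriv_real_comp':
  assumes "(h has_real_derivative D) (at (f x))" "f differentiable (at x)"
  shows "dir_deriv e (\<lambda>y. h (f y)) x = D * dir_deriv e f x"
proof -
  have "(h has_derivative (\<lambda>r. D * r)) (at (f x))"
    using assms(1) by (simp add: has_field_derivative_def)
  then have "((\<lambda>y. h (f y)) has_derivative (\<lambda>e. D * dir_deriv e f x)) (at x)"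
    using has_derivative_compose[of f "\<lambda>e. dir_deriv e f x" x UNIV h "\<lambda>r. D * r"]
      has_derivative_dir_deriv[OF assms(2)] by simp
  from dir_deriv_eqI[OF this] show ?thesis .
qed

lemma dir_deriv_affine_comp:
  fixes A :: "'a::euclidean_space \<Rightarrow> 'b::euclidean_space"
  assumes "bounded_linear A" "f differentiable (at (A x + c))"
  shows "dir_deriv e (\<lambda>y. f (A y + c)) x = dir_deriv (A e) f (A x + c)"
proof -
  have "((\<lambda>y. A y + c) has_derivative A) (at x)"
    by (auto intro!: derivative_eq_intros bounded_linear_imp_has_derivative assms)
  then have "((\<lambda>y. f (A y + c)) has_derivative (\<lambda>e. dir_deriv (A e) f (A x + c))) (at x)"
    using has_derivative_compose[of "\<lambda>y. A y + c" A x UNIV f "\<lambda>e. dir_deriv e f (A x + c)"]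
      has_derivative_dir_deriv[OF assms(2)] by simp
  from dir_deriv_eqI[OF this] show ?thesis .
qed

text \<open>The members of the family \<open>f\<close> with index in \<open>I\<close> are \<open>k\<close> times differentiable on the whole space, with derivatives
  bounded on \<open>K\<close> uniformly in the index; for \<open>K = {}\<close> this is just \<open>Ck\<close>.\<close>

fun lbd :: "'i set \<Rightarrow> 'a set \<Rightarrow> nat \<Rightarrow> ('i \<Rightarrow> 'a::euclidean_space \<Rightarrow> real) \<Rightarrow> bool" where
  "lbd I K 0 f \<longleftrightarrow> (\<forall>i\<in>I. continuous_on UNIV (f i)) \<and> (\<exists>B. \<forall>i\<in>I. \<forall>x\<in>K. \<bar>f i x\<bar> \<le> B)"
| "lbd I K (Suc k) f \<longleftrightarrow> (\<forall>i\<in>I. f i differentiable_on UNIV) \<and> (\<exists>B. \<forall>i\<in>I. \<forall>x\<in>K. \<bar>f i x\<bar> \<le> B)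
     \<and> (\<forall>e. lbd I K k (\<lambda>i. dir_deriv e (f i)))"

lemma lbd_cong: "(\<And>i. i \<in> I \<Longrightarrow> f i = g i) \<Longrightarrow> lbd I K k f = lbd I K k g"
proof (induction k arbitrary: f g)
  case (Suc k)
  have "lbd I K k (\<lambda>i. dir_deriv e (f i)) = lbd I K k (\<lambda>i. dir_deriv e (g i))" for e
    by (rule Suc.IH) (simp add: Suc.prems)
  then show ?case using Suc.prems by simp
qed simp

lemma lbd_bounded: "lbd I K k f \<Longrightarrow> \<exists>B. \<forall>i\<in>I. \<forall>x\<in>K. \<bar>f i x\<bar> \<le> B"
  by (cases k) auto

lemma lbd_differentiable: "lbd I K (Suc k) f \<Longrightarrow> i \<in> I \<Longrightarrow> f i differentiable (at x)"
  by (auto simp: differentiable_on_def)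

lemma lbd_Suc_imp: "lbd I K (Suc k) f \<Longrightarrow> lbd I K k f"
proof (induction k arbitrary: f)
  case 0
  then show ?case by (auto intro: differentiable_imp_continuous_on)
next
  case (Suc k)
  have *: "lbd I K (Suc k) (\<lambda>i. dir_deriv e (f i))" for e
    using Suc.prems by simp
  have "lbd I K k (\<lambda>i. dir_deriv e (f i))" for e
    by (rule Suc.IH[OF *])
  then show ?case using Suc.prems by simp
qed

lemma lbd_dir_deriv: "lbd I K (Suc k) f \<Longrightarrow> lbd I K k (\<lambda>i. dir_deriv e (f i))"
  by simp

lemma lbd_const:
  assumes "\<exists>B. \<forall>i\<in>I. \<bar>c i\<bar> \<le> B"
  shows "lbd I K k (\<lambda>i x. c i)"
  using assms
proof (induction k arbitrary: c)
  case (Suc k)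
  have "lbd I K k (\<lambda>i. (\<lambda>x. 0))"
    by (rule Suc.IH) (auto intro: exI[of _ 0])
  then show ?case using Suc.prems by (auto simp: differentiable_on_def)
qed auto

lemma lbd_const1: "lbd I K k (\<lambda>i x. c)"
  by (rule lbd_const) auto

lemma lbd_add:
  assumes "lbd I K k f" "lbd I K k g"
  shows "lbd I K k (\<lambda>i x. f i x + g i x)"
  using assms
proof (induction k arbitrary: f g)
  case 0
  then obtain B B' where B: "\<forall>i\<in>I. \<forall>x\<in>K. \<bar>f i x\<bar> \<le> B" "\<forall>i\<in>I. \<forall>x\<in>K. \<bar>g i x\<bar> \<le> B'"
    by auto
  have "\<forall>i\<in>I. \<forall>x\<in>K. \<bar>f i x + g i x\<bar> \<le> B + B'"
    using B by (fastforce intro: order_trans[OF abs_triangle_ineq])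
  then show ?case using 0 by (auto intro!: continuous_intros)
next
  case (Suc k)
  obtain B B' where B: "\<forall>i\<in>I. \<forall>x\<in>K. \<bar>f i x\<bar> \<le> B" "\<forall>i\<in>I. \<forall>x\<in>K. \<bar>g i x\<bar> \<le> B'"
    using Suc.prems by auto
  have "\<forall>i\<in>I. \<forall>x\<in>K. \<bar>f i x + g i x\<bar> \<le> B + B'"
    using B by (fastforce intro: order_trans[OF abs_triangle_ineq])
  moreover have "lbd I K k (\<lambda>i. dir_deriv e (\<lambda>x. f i x + g i x))" for e
  proof -
    have "lbd I K k (\<lambda>i. dir_deriv e (\<lambda>x. f i x + g i x))
        = lbd I K k (\<lambda>i x. dir_deriv e (f i) x + dir_deriv e (g i) x)"
      by (rule lbd_cong) (auto intro!: ext dir_deriv_add lbd_differentiable[OF Suc.prems(1)]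
          lbd_differentiable[OF Suc.prems(2)])
    also have "\<dots>" using Suc.prems by (intro Suc.IH) auto
    finally show ?thesis by simp
  qed
  ultimately show ?case using Suc.prems
    by (auto simp: differentiable_on_def intro!: differentiable_add)
qed

lemma lbd_mult:
  assumes "lbd I K k f" "lbd I K k g"
  shows "lbd I K k (\<lambda>i x. f i x * g i x)"
  using assms
proof (induction k arbitrary: f g)
  case 0
  then obtain B B' where B: "\<forall>i\<in>I. \<forall>x\<in>K. \<bar>f i x\<bar> \<le> B" "\<forall>i\<in>I. \<forall>x\<in>K. \<bar>g i x\<bar> \<le> B'"
    by auto
  have "\<forall>i\<in>I. \<forall>x\<in>K. \<bar>f i x * g i x\<bar> \<le> B * B'"
  proof (intro ballI)
    fix i x assume ix: "i \<in> I" "x \<in> K"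
    then have "\<bar>f i x\<bar> \<le> B" "\<bar>g i x\<bar> \<le> B'" using B by auto
    then show "\<bar>f i x * g i x\<bar> \<le> B * B'"
      unfolding abs_mult by (intro mult_mono) auto
  qed
  then show ?case using 0 by (auto intro!: continuous_intros)
next
  case (Suc k)
  obtain B B' where B: "\<forall>i\<in>I. \<forall>x\<in>K. \<bar>f i x\<bar> \<le> B" "\<forall>i\<in>I. \<forall>x\<in>K. \<bar>g i x\<bar> \<le> B'"
    using Suc.prems by auto
  have "\<forall>i\<in>I. \<forall>x\<in>K. \<bar>f i x * g i x\<bar> \<le> B * B'"
  proof (intro ballI)
    fix i x assume ix: "i \<in> I" "x \<in> K"
    then have "\<bar>f i x\<bar> \<le> B" "\<bar>g i x\<bar> \<le> B'" using B by auto
    then show "\<bar>f i x * g i x\<bar> \<le> B * B'"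
      unfolding abs_mult by (intro mult_mono) auto
  qed
  moreover have "lbd I K k (\<lambda>i. dir_deriv e (\<lambda>x. f i x * g i x))" for e
  proof -
    have "lbd I K k (\<lambda>i. dir_deriv e (\<lambda>x. f i x * g i x))
        = lbd I K k (\<lambda>i x. f i x * dir_deriv e (g i) x + dir_deriv e (f i) x * g i x)"
      by (rule lbd_cong) (auto intro!: ext dir_deriv_mult lbd_differentiable[OF Suc.prems(1)]
          lbd_differentiable[OF Suc.prems(2)])
    also have "\<dots>"
      using Suc.prems lbd_Suc_imp[OF Suc.prems(1)] lbd_Suc_imp[OF Suc.prems(2)]
      by (intro lbd_add Suc.IH) auto
    finally show ?thesis by simp
  qed
  ultimately show ?case using Suc.prems
    by (auto simp: differentiable_on_def intro!: differentiable_mult)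
qed

lemma lbd_minus: "lbd I K k f \<Longrightarrow> lbd I K k (\<lambda>i x. - f i x)"
  using lbd_mult[OF lbd_const1[of I K k "-1"]] by simp

lemma lbd_diff: "lbd I K k f \<Longrightarrow> lbd I K k g \<Longrightarrow> lbd I K k (\<lambda>i x. f i x - g i x)"
  using lbd_add[OF _ lbd_minus] by fastforce

lemma lbd_power: "lbd I K k f \<Longrightarrow> lbd I K k (\<lambda>i x. f i x ^ n)"
  by (induction n) (auto intro: lbd_const1 lbd_mult)

lemma lbd_linear:
  assumes "bounded_linear a" "\<exists>B. \<forall>x\<in>K. \<bar>a x\<bar> \<le> B"
  shows "lbd I K k (\<lambda>i. a)"
proof (cases k)
  case 0
  then show ?thesis using assms by (auto intro: linear_continuous_on)
next
  case (Suc n)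
  then show ?thesis using assms
    by (auto simp: dir_deriv_bounded_linear differentiable_on_def
        intro!: lbd_const1 bounded_linear_imp_differentiable)
qed

lemma Ck_iff_lbd: "Ck k f \<longleftrightarrow> lbd {()} {} k (\<lambda>_. f)"
  by (induction k arbitrary: f) auto

lemma lbd_imp_Ck: "lbd I K k f \<Longrightarrow> i \<in> I \<Longrightarrow> Ck k (f i)"
  by (induction k arbitrary: f) auto

lemma Ck_continuous: "Ck k f \<Longrightarrow> continuous_on UNIV f"
  by (cases k) (auto intro: differentiable_imp_continuous_on)

lemma Ck_differentiable: "Ck (Suc k) f \<Longrightarrow> f differentiable (at x)"
  by (auto simp: differentiable_on_def)

lemma Ck_Suc_imp: "Ck (Suc k) f \<Longrightarrow> Ck k f"
  unfolding Ck_iff_lbd by (rule lbd_Suc_imp)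

text \<open>On \<open>K\<close> all members take values in one interval [-B, B], and the fixed
  function \<open>h\<close> is bounded on this compact set. The chain rule turns derivatives into
  products of families of the same kind.\<close>

lemma lbd_comp:
  fixes h :: "real \<Rightarrow> real"
  assumes "Ck k h" "lbd I K k f"
  shows "lbd I K k (\<lambda>i x. h (f i x))"
  using assms
proof (induction k arbitrary: h f)
  case 0
  then obtain B where B: "\<forall>i\<in>I. \<forall>x\<in>K. \<bar>f i x\<bar> \<le> B" by auto
  have "compact (h ` {-B..B})"
    using 0(1) by (intro compact_continuous_image) (auto intro: continuous_on_subset)
  then obtain M where M: "\<And>y. y \<in> {-B..B} \<Longrightarrow> \<bar>h y\<bar> \<le> M"
    by (metis compact_imp_bounded bounded_real imageI)
  have "\<bar>h (f i x)\<bar> \<le> M" if "i \<in> I" "x \<in> K" for i x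
    by (rule M) (use B that in \<open>fastforce simp: abs_le_iff\<close>)
  moreover have "continuous_on UNIV (\<lambda>x. h (f i x))" if "i \<in> I" for i
    using 0 that by (auto intro: continuous_on_compose2[of UNIV h])
  ultimately show ?case by auto
next
  case (Suc k)
  obtain B where B: "\<forall>i\<in>I. \<forall>x\<in>K. \<bar>f i x\<bar> \<le> B" using Suc.prems by auto
  have "compact (h ` {-B..B})"
    using Ck_continuous[OF Suc.prems(1)]
    by (intro compact_continuous_image) (auto intro: continuous_on_subset)
  then obtain M where M: "\<And>y. y \<in> {-B..B} \<Longrightarrow> \<bar>h y\<bar> \<le> M"
    by (metis compact_imp_bounded bounded_real imageI)
  have "\<bar>h (f i x)\<bar> \<le> M" if "i \<in> I" "x \<in> K" for i x
    by (rule M) (use B that in \<open>fastforce simp: abs_le_iff\<close>)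
  moreover have "(\<lambda>x. h (f i x)) differentiable (at x)" if "i \<in> I" for i x
    using differentiable_chain_at[OF lbd_differentiable[OF Suc.prems(2) that]
        Ck_differentiable[OF Suc.prems(1)]] by (simp add: o_def)
  moreover have "lbd I K k (\<lambda>i. dir_deriv e (\<lambda>x. h (f i x)))" for e
  proof -
    have "lbd I K k (\<lambda>i. dir_deriv e (\<lambda>x. h (f i x)))
        = lbd I K k (\<lambda>i x. dir_deriv 1 h (f i x) * dir_deriv e (f i) x)"
    proof (rule lbd_cong, rule ext)
      fix i x assume "i \<in> I"
      then show "dir_deriv e (\<lambda>x. h (f i x)) x = dir_deriv 1 h (f i x) * dir_deriv e (f i) x"
        by (intro dir_deriv_real_comp[of h "f i" x e] Ck_differentiable[OF Suc.prems(1)]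
            lbd_differentiable[OF Suc.prems(2)])
    qed
    also have "\<dots>"
      using Suc.prems lbd_Suc_imp[OF Suc.prems(2)]
      by (intro lbd_mult Suc.IH[of "dir_deriv 1 h" f]) auto
    finally show ?thesis by simp
  qed
  ultimately show ?case by (auto simp: differentiable_on_def)
qed

text \<open>The lower bound is asked for on the whole space because \<open>lbd\<close> includes
  differentiability everywhere; its uniformity bounds the inverses.\<close>

lemma lbd_inverse:
  assumes "lbd I K k f" "\<And>i x. i \<in> I \<Longrightarrow> c \<le> f i x" "c > 0"
  shows "lbd I K k (\<lambda>i x. inverse (f i x))"
  using assms(1)
proof (induction k)
  case 0
  have "\<bar>inverse (f i x)\<bar> \<le> inverse c" if "i \<in> I" for i x
    using assms(2)[OF that, of x] assms(3) by (simp add: le_imp_inverse_le)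
  moreover have "f i x \<noteq> 0" if "i \<in> I" for i x
    using assms(2)[OF that, of x] assms(3) by simp
  ultimately show ?case using 0 by (auto intro!: continuous_on_inverse)
next
  case (Suc k)
  have le: "\<bar>inverse (f i x)\<bar> \<le> inverse c" if "i \<in> I" for i x
    using assms(2)[OF that, of x] assms(3) by (simp add: le_imp_inverse_le)
  have nz: "f i x \<noteq> 0" if "i \<in> I" for i x
    using assms(2)[OF that, of x] assms(3) by simp
  have IH: "lbd I K k (\<lambda>i x. inverse (f i x))"
    using Suc.IH[OF lbd_Suc_imp[OF Suc.prems]] .
  have "lbd I K k (\<lambda>i. dir_deriv e (\<lambda>x. inverse (f i x)))" for e
  proof -
    have "lbd I K k (\<lambda>i. dir_deriv e (\<lambda>x. inverse (f i x)))
        = lbd I K k (\<lambda>i x. - (inverse (f i x) * inverse (f i x)) * dir_deriv e (f i) x)"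
    proof (rule lbd_cong, rule ext)
      fix i x assume i: "i \<in> I"
      have "(inverse has_real_derivative - (inverse (f i x) * inverse (f i x))) (at (f i x))"
        using nz[OF i, of x] by (auto intro!: derivative_eq_intros simp: power2_eq_square)
      from dir_deriv_real_comp'[of inverse _ "f i" x e, OF this lbd_differentiable[OF Suc.prems i]]
      show "dir_deriv e (\<lambda>x. inverse (f i x)) x
          = - (inverse (f i x) * inverse (f i x)) * dir_deriv e (f i) x" .
    qed
    also have "\<dots>"
      using Suc.prems by (intro lbd_mult lbd_minus IH) auto
    finally show ?thesis by simp
  qed
  then show ?case using Suc.prems le nz
    by (auto simp: differentiable_on_def intro!: differentiable_inverse)
qed

text \<open>A linear phase is unbounded on the sets \<open>K\<close> used later, which puts these
  families beyond \<open>lbd_comp\<close>. The derivatives of sine and cosine reproduce each other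
  up to the constant \<open>a e\<close>, hence the joint induction.\<close>

lemma lbd_sin_cos:
  assumes "bounded_linear a"
  shows "lbd I K k (\<lambda>i x. sin (a x)) \<and> lbd I K k (\<lambda>i x. cos (a x))"
proof (induction k)
  case 0
  have "continuous_on UNIV a" using assms by (rule linear_continuous_on)
  then show ?case by (auto intro!: continuous_intros exI[of _ 1])
next
  case (Suc k)
  have a: "a differentiable (at x)" for x
    using assms by (rule bounded_linear_imp_differentiable)
  have "dir_deriv e (\<lambda>x. sin (a x)) = (\<lambda>x. cos (a x) * a e)" for e
    using dir_deriv_bounded_linear[OF assms, of e] dir_deriv_real_comp'[of sin _ a, OF DERIV_sin a] by auto
  moreover have "dir_deriv e (\<lambda>x. cos (a x)) = (\<lambda>x. - sin (a x) * a e)" for e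
    using dir_deriv_bounded_linear[OF assms, of e] dir_deriv_real_comp'[of cos _ a, OF DERIV_cos a] by auto
  moreover have "(\<lambda>x. sin (a x)) differentiable (at x)" "(\<lambda>x. cos (a x)) differentiable (at x)" for x
    using has_derivative_sin[OF has_derivative_dir_deriv[OF a]]
      has_derivative_cos[OF has_derivative_dir_deriv[OF a]] by (blast intro: differentiableI)+
  ultimately show ?case using Suc
    by (auto simp: differentiable_on_def intro!: exI[of _ 1] lbd_mult lbd_minus lbd_const1)
qed

lemmas lbd_sin = lbd_sin_cos[THEN conjunct1] and lbd_cos = lbd_sin_cos[THEN conjunct2]

section \<open>Closure properties of \<open>Ck\<close>\<close>

lemma Ck_const: "Ck k (\<lambda>x. c)"
  unfolding Ck_iff_lbd by (rule lbd_const1)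

lemma Ck_add: "Ck k f \<Longrightarrow> Ck k g \<Longrightarrow> Ck k (\<lambda>x. f x + g x)"
  unfolding Ck_iff_lbd by (rule lbd_add)

lemma Ck_mult: "Ck k f \<Longrightarrow> Ck k g \<Longrightarrow> Ck k (\<lambda>x. f x * g x)"
  unfolding Ck_iff_lbd by (rule lbd_mult)

lemma Ck_minus: "Ck k f \<Longrightarrow> Ck k (\<lambda>x. - f x)"
  unfolding Ck_iff_lbd by (rule lbd_minus)

lemma Ck_diff: "Ck k f \<Longrightarrow> Ck k g \<Longrightarrow> Ck k (\<lambda>x. f x - g x)"
  unfolding Ck_iff_lbd by (rule lbd_diff)

lemma Ck_linear: "bounded_linear a \<Longrightarrow> Ck k a"
  unfolding Ck_iff_lbd by (rule lbd_linear) auto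

lemma Ck_comp: "Ck k (h :: real \<Rightarrow> real) \<Longrightarrow> Ck k f \<Longrightarrow> Ck k (\<lambda>x. h (f x))"
  unfolding Ck_iff_lbd[of k f] Ck_iff_lbd[of k "\<lambda>x. h (f x)"] by (rule lbd_comp)

lemma Ck_affine:
  fixes A :: "'a::euclidean_space \<Rightarrow> 'b::euclidean_space"
  assumes "Ck k f" "bounded_linear A"
  shows "Ck k (\<lambda>x. f (A x + c))"
  using assms(1)
proof (induction k arbitrary: f)
  case 0
  have "continuous_on UNIV (\<lambda>x. A x + c)"
    by (intro continuous_intros linear_continuous_on assms)
  then show ?case using 0 by (auto intro: continuous_on_compose2)
next
  case (Suc k)
  have "(\<lambda>x. f (A x + c)) differentiable (at x)" for x
    using differentiable_chain_at[of "\<lambda>x. A x + c" x f] Ck_differentiable[OF Suc.prems]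
      bounded_linear_imp_differentiable[OF assms(2)]
    by (simp add: o_def)
  moreover have "dir_deriv e (\<lambda>x. f (A x + c)) = (\<lambda>x. dir_deriv (A e) f (A x + c))" for e
    by (rule ext) (rule dir_deriv_affine_comp[OF assms(2) Ck_differentiable[OF Suc.prems]])
  ultimately show ?case using Suc by (auto simp: differentiable_on_def)
qed

text \<open>The gluing principle. On each \<open>U\<close> the derivative of the model
  \<open>g\<close> is a model for the derivative of \<open>f\<close>, so the induction reuses the
  same neighbourhoods.\<close>

lemma Ck_local:
  assumes "\<And>x. \<exists>U g. open U \<and> x \<in> U \<and> Ck k g \<and> (\<forall>y\<in>U. f y = g y)"
  shows "Ck k f"
  using assms
proof (induction k arbitrary: f)
  case 0
  have "isCont f x" for x
  proof -
    obtain U g where U: "open U" "x \<in> U" "continuous_on UNIV g" "\<forall>y\<in>U. f y = g y"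
      using 0[of x] by auto
    then have "isCont g x" by (simp add: continuous_on_eq_continuous_at)
    then show ?thesis
      using U by (subst isCont_cong[of f g]) (auto simp: eventually_nhds)
  qed
  then show ?case by (simp add: continuous_at_imp_continuous_on)
next
  case (Suc k)
  have "f differentiable (at x)" for x
  proof -
    obtain U g where U: "open U" "x \<in> U" "Ck (Suc k) g" "\<forall>y\<in>U. f y = g y"
      using Suc.prems[of x] by auto
    then have "(g has_derivative (\<lambda>e. dir_deriv e g x)) (at x)"
      by (intro has_derivative_dir_deriv Ck_differentiable)
    then have "(f has_derivative (\<lambda>e. dir_deriv e g x)) (at x)"
      by (rule has_derivative_transform_within_open[OF _ U(1,2)]) (use U(4) in auto)
    then show ?thesis by (blast intro: differentiableI)
  qed
  moreover have "Ck k (dir_deriv e f)" for e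
  proof (rule Suc.IH)
    fix x
    obtain U g where U: "open U" "x \<in> U" "Ck (Suc k) g" "\<forall>y\<in>U. f y = g y"
      using Suc.prems[of x] by auto
    then show "\<exists>U g. open U \<and> x \<in> U \<and> Ck k g \<and> (\<forall>y\<in>U. dir_deriv e f y = g y)"
      by (intro exI[of _ U] exI[of _ "dir_deriv e g"]) (auto intro!: dir_deriv_local[of U])
  qed
  ultimately show ?case by (auto simp: differentiable_on_def)
qed

lemma Ck_real_SucI:
  fixes f :: "real \<Rightarrow> real"
  assumes "\<And>x. (f has_real_derivative f' x) (at x)" "Ck k f'"
  shows "Ck (Suc k) f"
proof -
  have "dir_deriv e f = (\<lambda>x. f' x * e)" for e
    by (rule ext, rule dir_deriv_eqI) (use assms(1) in \<open>simp add: has_field_derivative_def\<close>)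
  moreover have "f differentiable (at x)" for x
    using assms(1) by (meson field_differentiable_def field_differentiable_imp_differentiable)
  ultimately show ?thesis using assms(2)
    by (auto simp: differentiable_on_def intro!: Ck_mult Ck_const)
qed

lemma Ck_exp: "Ck k (exp :: real \<Rightarrow> real)"
proof (induction k)
  case (Suc k)
  show ?case by (rule Ck_real_SucI[OF DERIV_exp Suc])
qed (simp add: continuous_on_exp)

lemma Ck_inverse:
  assumes "Ck k f" "\<And>x. f x > 0"
  shows "Ck k (\<lambda>x. inverse (f x))"
  using assms(1)
proof (induction k)
  case 0
  then show ?case using assms(2) by (auto intro!: continuous_on_inverse simp: less_imp_neq[symmetric])
next
  case (Suc k)
  have nz: "f x \<noteq> 0" for x using assms(2)[of x] by simp
  have "dir_deriv e (\<lambda>x. inverse (f x)) = (\<lambda>x. - (inverse (f x) * inverse (f x)) * dir_deriv e f x)" for e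
  proof (rule ext)
    fix x
    have "(inverse has_real_derivative - (inverse (f x) * inverse (f x))) (at (f x))"
      using nz[of x] by (auto intro!: derivative_eq_intros simp: power2_eq_square)
    from dir_deriv_real_comp'[of inverse _ f x e, OF this Ck_differentiable[OF Suc.prems]]
    show "dir_deriv e (\<lambda>x. inverse (f x)) x
        = - (inverse (f x) * inverse (f x)) * dir_deriv e f x" .
  qed
  moreover have "Ck k (\<lambda>x. inverse (f x))" using Suc.IH[OF Ck_Suc_imp[OF Suc.prems]] .
  ultimately show ?case using Suc.prems nz
    by (auto simp: differentiable_on_def intro!: differentiable_inverse Ck_mult Ck_minus)
qed

lemma Ck_arctan: "Ck k arctan"
proof (cases k)
  case 0
  then show ?thesis by (simp add: continuous_on_arctan)
next
  case (Suc n)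
  have "Ck n (\<lambda>x::real. inverse (1 + x * x))"
    by (intro Ck_inverse Ck_add Ck_const Ck_mult Ck_linear bounded_linear_ident)
      (simp add: add_pos_nonneg)
  then show ?thesis unfolding Suc
    by (intro Ck_real_SucI) (auto intro!: DERIV_arctan[THEN DERIV_cong] simp: power2_eq_square)
qed

section \<open>A smooth step\<close>

text \<open>The factor \<open>inverse x ^ n\<close> makes the family closed under differentiation,
  see \<open>flat_deriv\<close>, so that all orders of smoothness follow from one induction. The
  case n = 0 is the classical flat function.\<close>

definition flat :: "nat \<Rightarrow> real \<Rightarrow> real" where
  "flat n x = (if x > 0 then inverse x ^ n * exp (- inverse x) else 0)"

text \<open>One term of the exponential series is at most its sum. This serves both the flat
  functions and the lower bound for the factorial in \<open>mangoldt_sum_ge\<close>.\<close>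

lemma power_le_fact_exp:
  fixes y :: real
  assumes "y \<ge> 0"
  shows "y ^ m \<le> fact m * exp y"
proof -
  have "(\<Sum>k\<in>{m}. y ^ k /\<^sub>R fact k) \<le> (\<Sum>k. y ^ k /\<^sub>R fact k)"
    by (rule sum_le_suminf[OF summable_exp_generic]) (use assms in auto)
  then have "y ^ m / fact m \<le> exp y" by (simp add: exp_def divide_inverse mult.commute)
  then show ?thesis by (simp add: field_simps)
qed

text \<open>The exponential absorbs two more powers of \<open>inverse x\<close>. Quadratic order at
  0 is what makes the difference quotient there tend to 0.\<close>

lemma flat_le: "\<bar>flat n x\<bar> \<le> fact (n + 2) * x\<^sup>2"
proof (cases "x > 0")
  case True
  have "inverse x ^ (n + 2) * exp (- inverse x) \<le> fact (n + 2)"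
    using power_le_fact_exp[of "inverse x" "n + 2"] True by (simp add: exp_minus field_simps)
  then have "x\<^sup>2 * (inverse x ^ (n + 2) * exp (- inverse x)) \<le> x\<^sup>2 * fact (n + 2)"
    by (rule mult_left_mono) simp
  moreover have "x\<^sup>2 * (inverse x ^ (n + 2) * exp (- inverse x)) = flat n x"
  proof -
    have "x\<^sup>2 * (inverse x)\<^sup>2 = 1" using True by (simp flip: power_mult_distrib)
    then have "(x\<^sup>2 * (inverse x)\<^sup>2) * (inverse x ^ n * exp (- inverse x)) = flat n x"
      using True by (simp only: flat_def if_True mult_1)
    then show ?thesis by (simp only: power_add mult_ac)
  qed
  ultimately have "flat n x \<le> fact (n + 2) * x\<^sup>2" by (simp only: mult.commute)
  moreover have "flat n x \<ge> 0" by (simp add: flat_def)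
  ultimately show ?thesis by simp
qed (simp add: flat_def)

lemma flat_deriv: "(flat n has_real_derivative (flat (n + 2) x - real n * flat (n + 1) x)) (at x)"
proof -
  consider "x > 0" | "x < 0" | "x = 0" by linarith
  then show ?thesis
  proof cases
    case 1
    have i: "(inverse has_real_derivative - (inverse x * inverse x)) (at x)"
      using 1 by (auto intro!: derivative_eq_intros simp: power2_eq_square)
    have p: "((\<lambda>x. inverse x ^ n) has_real_derivative - (real n * inverse x ^ (n + 1))) (at x)"
      using DERIV_power[OF i, of n] by (cases n) (auto simp: mult_ac)
    have *: "((\<lambda>x. inverse x ^ n * exp (- inverse x)) has_real_derivative
        (flat (n + 2) x - real n * flat (n + 1) x)) (at x)"
      by (rule DERIV_cong[OF DERIV_mult[OF p DERIV_fun_exp[OF DERIV_minus[OF i]]]])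
        (use 1 in \<open>simp add: flat_def algebra_simps\<close>)
    show ?thesis
      by (rule has_field_derivative_transform_within_open[OF *, of "{0<..}"])
        (use 1 in \<open>auto simp: flat_def\<close>)
  next
    case 2
    have *: "((\<lambda>x::real. 0::real) has_real_derivative (flat (n + 2) x - real n * flat (n + 1) x)) (at x)"
      using 2 by (auto simp: flat_def)
    show ?thesis
      by (rule has_field_derivative_transform_within_open[OF *, of "{..<0}"])
        (use 2 in \<open>auto simp: flat_def\<close>)
  next
    case 3
    have "((\<lambda>h. flat n h / h) \<longlongrightarrow> 0) (at 0)"
    proof (rule Lim_null_comparison)
      have "norm (flat n h / h) \<le> fact (n + 2) * \<bar>h\<bar>" for h :: real
      proof (cases "h = 0")
        case False
        have "\<bar>flat n h\<bar> \<le> fact (n + 2) * \<bar>h\<bar> * \<bar>h\<bar>"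
          using flat_le[of n h] by (simp only: mult.assoc abs_mult_self_eq power2_eq_square)
        then show ?thesis using False by (simp only: real_norm_def abs_divide) (simp add: divide_le_eq del: fact_Suc)
      qed simp
      then show "\<forall>\<^sub>F h in at 0. norm (flat n h / h) \<le> fact (n + 2) * \<bar>h\<bar>" by simp
      show "((\<lambda>h::real. fact (n + 2) * \<bar>h\<bar>) \<longlongrightarrow> 0) (at 0)"
        by (rule tendsto_mult_right_zero, rule tendsto_rabs_zero, rule tendsto_ident_at)
    qed
    then show ?thesis using 3 by (simp add: DERIV_def flat_def)
  qed
qed

lemma Ck_flat: "Ck k (flat n)"
proof (induction k arbitrary: n)
  case 0
  show ?case
    using flat_deriv by (auto intro!: continuous_at_imp_continuous_on DERIV_isCont)
next
  case (Suc k)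
  show ?case
    by (rule Ck_real_SucI[OF flat_deriv]) (intro Ck_diff Ck_mult Ck_const Suc)
qed

definition smoothstep :: "real \<Rightarrow> real" where
  "smoothstep x = flat 0 x * inverse (flat 0 x + flat 0 (1 - x))"

lemma flat_pos: "x > 0 \<Longrightarrow> flat n x > 0"
  by (simp add: flat_def)

lemma flat_nonneg: "flat n x \<ge> 0"
  by (simp add: flat_def)

lemma flat_zero: "x \<le> 0 \<Longrightarrow> flat n x = 0"
  by (simp add: flat_def)

lemma flat_sum_pos: "flat 0 x + flat 0 (1 - x) > 0"
  using flat_pos[of x 0] flat_pos[of "1 - x" 0] flat_nonneg[of 0 x] flat_nonneg[of 0 "1 - x"]
  by (cases "x > 0") auto

lemma Ck_smoothstep: "Ck k smoothstep"
proof -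
  have "Ck k (\<lambda>x. flat 0 (- x + 1))"
    by (rule Ck_affine[OF Ck_flat]) (rule bounded_linear_minus[OF bounded_linear_ident])
  then have "Ck k (\<lambda>x. flat 0 (1 - x))" by simp
  then have "Ck k (\<lambda>x. flat 0 x * inverse (flat 0 x + flat 0 (1 - x)))"
    by (intro Ck_mult Ck_inverse Ck_add Ck_flat flat_sum_pos)
  then show ?thesis by (simp add: smoothstep_def[abs_def])
qed

lemma smoothstep_0: "x \<le> 0 \<Longrightarrow> smoothstep x = 0"
  by (simp add: smoothstep_def flat_zero)

lemma smoothstep_1: "x \<ge> 1 \<Longrightarrow> smoothstep x = 1"
  using flat_pos[of x 0] by (simp add: smoothstep_def flat_zero)

lemma smoothstep_nonneg: "smoothstep x \<ge> 0"
  using flat_sum_pos[of x] flat_nonneg[of 0 x] by (simp add: smoothstep_def)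

lemma smoothstep_le_1: "smoothstep x \<le> 1"
  using flat_sum_pos[of x] flat_nonneg[of 0 "1 - x"]
  by (simp add: smoothstep_def divide_inverse[symmetric])

section \<open>Ternary forms\<close>

lemma nearest_int:
  fixes x t :: int
  assumes "t > 0"
  shows "\<exists>a. 4 * (x - t * a)\<^sup>2 \<le> t\<^sup>2"
proof -
  define a where "a = (2 * x + t) div (2 * t)"
  have "2 * x + t = (2 * t) * a + (2 * x + t) mod (2 * t)" by (simp add: a_def)
  moreover have "0 \<le> (2 * x + t) mod (2 * t)" "(2 * x + t) mod (2 * t) < 2 * t"
    using assms by auto
  ultimately have "- t \<le> 2 * (x - t * a)" "2 * (x - t * a) \<le> t"
    by (auto simp: algebra_simps)
  then have "\<bar>2 * (x - t * a)\<bar> \<le> \<bar>t\<bar>" by auto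
  then have "(2 * (x - t * a))\<^sup>2 \<le> t\<^sup>2" using abs_le_square_iff by blast
  also have "(2 * (x - t * a))\<^sup>2 = 4 * (x - t * a)\<^sup>2" by (simp only: power_mult_distrib) simp
  finally show ?thesis by blast
qed

text \<open>Davenport--Cassels: the line through a rational point of the sphere and a nearest
  lattice point meets the sphere again in a point of smaller denominator.\<close>

lemma three_rational_squares_imp_three_squares:
  fixes n t x y z :: int
  assumes "t > 0" "n * t\<^sup>2 = x\<^sup>2 + y\<^sup>2 + z\<^sup>2"
  shows "\<exists>a b c :: int. n = a\<^sup>2 + b\<^sup>2 + c\<^sup>2"
  using assms
proof (induction "nat t" arbitrary: t x y z rule: less_induct)
  case less
  obtain a b c where abc: "4 * (x - t * a)\<^sup>2 \<le> t\<^sup>2" "4 * (y - t * b)\<^sup>2 \<le> t\<^sup>2" "4 * (z - t * c)\<^sup>2 \<le> t\<^sup>2"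
    using nearest_int[OF less.prems(1)] by metis
  define r where "r = (x - t * a)\<^sup>2 + (y - t * b)\<^sup>2 + (z - t * c)\<^sup>2"
  have r0: "r \<ge> 0" by (simp add: r_def)
  show ?case
  proof (cases "r = 0")
    case True
    then have "(x - t * a)\<^sup>2 = 0 \<and> (y - t * b)\<^sup>2 = 0 \<and> (z - t * c)\<^sup>2 = 0"
      unfolding r_def using zero_le_power2[of "x - t * a"] zero_le_power2[of "y - t * b"]
        zero_le_power2[of "z - t * c"] by linarith
    then have "x = t * a" "y = t * b" "z = t * c" by auto
    then have "n * t\<^sup>2 = (a\<^sup>2 + b\<^sup>2 + c\<^sup>2) * t\<^sup>2"
      using less.prems(2) by (simp add: power_mult_distrib algebra_simps)
    then have "n = a\<^sup>2 + b\<^sup>2 + c\<^sup>2" using less.prems(1) by simp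
    then show ?thesis by blast
  next
    case False
    \<comment> \<open>With P = (x, y, z) / t and Q = (a, b, c), the line Q + s (P - Q) meets the
      sphere at s = 1 and at \<open>s = A * t / t'\<close>. The second point has coordinates
      \<open>(A * x + B * a) / t'\<close> and so on, and \<open>t' = r / t\<close> is smaller than t
      because r is at most 3/4 of t^2.\<close>
    define A B where "A = a\<^sup>2 + b\<^sup>2 + c\<^sup>2 - n" and "B = 2 * (n * t - (a * x + b * y + c * z))"
    define t' where "t' = A * t + B"
    have "t * t' = r"
    proof -
      have "t * t' = t\<^sup>2 * (a\<^sup>2 + b\<^sup>2 + c\<^sup>2) + n * t\<^sup>2 - 2 * t * (a * x + b * y + c * z)"
        by (simp add: t'_def A_def B_def power2_eq_square algebra_simps)
      then show ?thesis
        unfolding less.prems(2) r_def by (simp add: power2_eq_square algebra_simps)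
    qed
    moreover have "r < t * t"
      using abc less.prems(1) zero_less_power[of t 2] unfolding r_def power2_eq_square by linarith
    ultimately have "t * 0 < t * t'" "t * t' < t * t" using False r0 by simp_all
    then have t': "t' > 0" "t' < t"
      using less.prems(1) mult_less_cancel_left_pos by blast+
    have "n * t'\<^sup>2 = (A * x + B * a)\<^sup>2 + (A * y + B * b)\<^sup>2 + (A * z + B * c)\<^sup>2"
    proof -
      have "(A * x + B * a)\<^sup>2 + (A * y + B * b)\<^sup>2 + (A * z + B * c)\<^sup>2
          = A\<^sup>2 * (x\<^sup>2 + y\<^sup>2 + z\<^sup>2) + A * B * (2 * (a * x + b * y + c * z)) + B\<^sup>2 * (a\<^sup>2 + b\<^sup>2 + c\<^sup>2)"
        by (simp add: power2_eq_square algebra_simps)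
      also have "\<dots> = A\<^sup>2 * (n * t\<^sup>2) + A * B * (2 * n * t - B) + B\<^sup>2 * (A + n)"
        unfolding less.prems(2)[symmetric] by (simp add: A_def B_def)
      also have "\<dots> = n * t'\<^sup>2" by (simp add: t'_def power2_eq_square algebra_simps)
      finally show ?thesis by simp
    qed
    then show ?thesis using less.hyps[of t'] t' by auto
  qed
qed

text \<open>Strict on the left, so that differences of elements of {0..m} have squares below k; weak
  on the right, so that this range still has at least sqrt k elements.\<close>

lemma ex_strict_sqrt:
  fixes k :: nat
  assumes "k \<ge> 1"
  shows "\<exists>m. m\<^sup>2 < k \<and> k \<le> (m + 1)\<^sup>2"
  using assms
proof (induction k rule: dec_induct)
  case base
  show ?case by (rule exI[of _ 0]) simp
next
  case (step k)
  then obtain m where m: "m\<^sup>2 < k" "k \<le> (m + 1)\<^sup>2" by blast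
  show ?case
  proof (cases "Suc k \<le> (m + 1)\<^sup>2")
    case True
    then show ?thesis using m by (intro exI[of _ m]) auto
  next
    case False
    then have "k = (m + 1)\<^sup>2" using m by simp
    then show ?thesis by (intro exI[of _ "m + 1"]) (simp add: power2_eq_square)
  qed
qed

text \<open>Pigeonhole as in Thue's lemma. A box with more than \<open>n * q\<close> points (z, s,
  t) is mapped to pairs of residues modulo n and q. A collision gives a small nonzero vector for
  which \<open>V = z\<^sup>2 + q s\<^sup>2 - n t\<^sup>2\<close> is divisible by
  \<open>n * q\<close>, and the size of V leaves only the values 0 and \<open>n * q\<close>.\<close>

lemma legendre_ternary:
  fixes n q :: nat and \<alpha> \<beta> :: int
  assumes n: "n > 0" "\<And>m. m\<^sup>2 \<noteq> n" and q: "q > 0" and cop: "coprime n q"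
    and \<alpha>: "[\<alpha>\<^sup>2 = - int q] (mod int n)" and \<beta>: "[\<beta>\<^sup>2 = int n] (mod int q)"
  shows "\<exists>x y w :: int. w > 0 \<and> int n * w\<^sup>2 = x\<^sup>2 + int q * y\<^sup>2"
proof -
  obtain N1 where N1: "N1\<^sup>2 < n * q" "n * q \<le> (N1 + 1)\<^sup>2"
    using ex_strict_sqrt[of "n * q"] n q by auto
  obtain N2 where N2: "N2\<^sup>2 < n" "n \<le> (N2 + 1)\<^sup>2" using ex_strict_sqrt[of n] n by auto
  \<comment> \<open>Strict because n is not a square; this makes the box larger than the set of
    residue pairs.\<close>
  have N2': "n < (N2 + 1)\<^sup>2" using N2 n(2)[of "N2 + 1"] by auto
  obtain N3 where N3: "N3\<^sup>2 < q" "q \<le> (N3 + 1)\<^sup>2" using ex_strict_sqrt[of q] q by auto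
  define A where "A = {0..int N1} \<times> {0..int N2} \<times> {0..int N3}"
  define f where "f = (\<lambda>(z, s, t). ((z - \<alpha> * s) mod int n, (z - \<beta> * t) mod int q))"
  have "(n * q) * (n * q) < (N1 + 1)\<^sup>2 * ((N2 + 1)\<^sup>2 * (N3 + 1)\<^sup>2)"
  proof -
    have "n * q < (N2 + 1)\<^sup>2 * (N3 + 1)\<^sup>2"
      using N2' N3(2) q by (meson less_le_trans mult_le_mono2 mult_less_mono1)
    then show ?thesis using N1 n q by (meson less_le_trans mult_le_mono1 mult_less_mono2 nat_0_less_mult_iff)
  qed
  then have "(n * q)\<^sup>2 < ((N1 + 1) * ((N2 + 1) * (N3 + 1)))\<^sup>2"
    by (simp only: power_mult_distrib) (simp only: power2_eq_square mult_ac)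
  then have big: "n * q < (N1 + 1) * ((N2 + 1) * (N3 + 1))"
    using power2_less_imp_less by blast
  have cardA: "card A = (N1 + 1) * ((N2 + 1) * (N3 + 1))"
    by (simp add: A_def card_cartesian_product nat_add_distrib)
  have "f ` A \<subseteq> {0..<int n} \<times> {0..<int q}"
    using n q by (auto simp: f_def)
  then have "card (f ` A) \<le> card ({0..<int n} \<times> {0..<int q})"
    by (intro card_mono) auto
  then have "card (f ` A) < card A"
    using big cardA by (simp add: card_cartesian_product)
  then have "\<not> inj_on f A" by (rule pigeonhole)
  then obtain u v where uv: "u \<in> A" "v \<in> A" "u \<noteq> v" "f u = f v" unfolding inj_on_def by blast
  obtain z1 s1 t1 where u: "u = (z1, s1, t1)" by (metis surj_pair)
  obtain z2 s2 t2 where v: "v = (z2, s2, t2)" by (metis surj_pair)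
  define z s t where "z = z1 - z2" and "s = s1 - s2" and "t = t1 - t2"
  have nz: "z \<noteq> 0 \<or> s \<noteq> 0 \<or> t \<noteq> 0" using uv(3) by (auto simp: u v z_def s_def t_def)
  have "\<bar>z\<bar> \<le> \<bar>int N1\<bar>" "\<bar>s\<bar> \<le> \<bar>int N2\<bar>" "\<bar>t\<bar> \<le> \<bar>int N3\<bar>"
    using uv(1,2) by (auto simp: u v A_def z_def s_def t_def)
  then have "z\<^sup>2 \<le> (int N1)\<^sup>2" "s\<^sup>2 \<le> (int N2)\<^sup>2" "t\<^sup>2 \<le> (int N3)\<^sup>2"
    using abs_le_square_iff by blast+
  moreover have "(int N1)\<^sup>2 < int n * int q" "(int N2)\<^sup>2 < int n" "(int N3)\<^sup>2 < int q"
    using N1(1) N2(1) N3(1) by (metis of_nat_less_iff of_nat_mult of_nat_power)+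
  ultimately have sm: "z\<^sup>2 < int n * int q" "s\<^sup>2 < int n" "t\<^sup>2 < int q" by linarith+
  have "[z1 - \<alpha> * s1 = z2 - \<alpha> * s2] (mod int n)" "[z1 - \<beta> * t1 = z2 - \<beta> * t2] (mod int q)"
    using uv(4) by (auto simp: u v f_def cong_def)
  then have d: "int n dvd z - \<alpha> * s" "int q dvd z - \<beta> * t"
    unfolding cong_iff_dvd_diff z_def s_def t_def by (simp_all add: algebra_simps)
  define V where "V = z\<^sup>2 + int q * s\<^sup>2 - int n * t\<^sup>2"
  have "int n dvd V"
  proof -
    have "V = (z - \<alpha> * s) * (z + \<alpha> * s) + (\<alpha>\<^sup>2 - (- int q)) * s\<^sup>2 - int n * t\<^sup>2"
      by (simp add: V_def power2_eq_square algebra_simps)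
    then show ?thesis using d(1) \<alpha> unfolding cong_iff_dvd_diff by (auto intro!: dvd_add dvd_diff dvd_mult2)
  qed
  moreover have "int q dvd V"
  proof -
    have "V = (z - \<beta> * t) * (z + \<beta> * t) + (\<beta>\<^sup>2 - int n) * t\<^sup>2 + int q * s\<^sup>2"
      by (simp add: V_def power2_eq_square algebra_simps)
    then show ?thesis using d(2) \<beta> unfolding cong_iff_dvd_diff by (auto intro!: dvd_add dvd_diff dvd_mult2)
  qed
  ultimately have "int n * int q dvd V"
    using cop by (intro divides_mult) auto
  then obtain k where k: "V = int n * int q * k" by (elim dvdE)
  have nq: "int n * int q > 0" using n q by simp
  have "int n * t\<^sup>2 < int n * int q" "int q * s\<^sup>2 < int n * int q"
    using sm n q by (simp_all add: mult.commute)
  moreover have "0 \<le> z\<^sup>2" "0 \<le> int q * s\<^sup>2" "0 \<le> int n * t\<^sup>2" by simp_all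
  \<comment> \<open>The three terms of V have signs +, +, - and each is below n q, so V lies
    strictly between - n q and 2 n q.\<close>
  ultimately have "int n * int q * (- 1) < int n * int q * k" "int n * int q * k < int n * int q * 2"
    unfolding k[symmetric] V_def using sm(1) by linarith+
  then have "- 1 < k" "k < 2" using nq mult_less_cancel_left_pos by blast+
  then consider "k = 0" | "k = 1" by linarith
  then show ?thesis
  proof cases
    case 1
    then have eq: "int n * t\<^sup>2 = z\<^sup>2 + int q * s\<^sup>2" using k by (simp add: V_def)
    have "t \<noteq> 0"
    proof
      assume "t = 0"
      then have "z\<^sup>2 + int q * s\<^sup>2 = 0" using eq by simp
      moreover have "0 \<le> z\<^sup>2" "0 \<le> int q * s\<^sup>2" by simp_all
      ultimately have "z\<^sup>2 = 0" "int q * s\<^sup>2 = 0" by linarith+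
      then show False using nz \<open>t = 0\<close> q by simp
    qed
    then show ?thesis using eq by (intro exI[of _ z] exI[of _ s] exI[of _ "\<bar>t\<bar>"]) auto
  next
    case 2
    then have eq: "z\<^sup>2 + int q * s\<^sup>2 = int n * (t\<^sup>2 + int q)"
      using k by (simp add: V_def algebra_simps)
    \<comment> \<open>Multiplication by t^2 + q makes the other side a product of two values of the
      form x^2 + q y^2, which is again such a value.\<close>
    have "int n * (t\<^sup>2 + int q)\<^sup>2 = (z\<^sup>2 + int q * s\<^sup>2) * (t\<^sup>2 + int q)"
      unfolding eq by (simp add: power2_eq_square)
    also have "\<dots> = (z * t - int q * s)\<^sup>2 + int q * (z + s * t)\<^sup>2"
      by (simp add: power2_eq_square algebra_simps)
    finally show ?thesis
      using q by (intro exI[of _ "z * t - int q * s"] exI[of _ "z + s * t"] exI[of _ "t\<^sup>2 + int q"])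
        (auto intro: add_nonneg_pos)
  qed
qed

text \<open>The Chinese remainder theorem; squarefreeness keeps the prime that is split off coprime
  to the rest.\<close>

lemma sqrt_mod_squarefree:
  fixes n :: nat and a :: int
  assumes "squarefree n" "\<And>p. prime p \<Longrightarrow> p dvd n \<Longrightarrow> QuadRes (int p) a"
  shows "QuadRes (int n) a"
  using assms
proof (induction n rule: prime_divisors_induct)
  case (factor p m)
  have pm: "coprime p m"
  proof (rule prime_imp_coprime)
    show "prime p" by fact
    show "\<not> p dvd m"
    proof
      assume "p dvd m"
      then have "p\<^sup>2 dvd p * m" by (simp add: power2_eq_square)
      then have "p dvd 1" using factor.prems(1) squarefreeD by blast
      then show False using factor.hyps by simp
    qed
  qed
  have "squarefree m" using factor.prems(1) squarefree_mono[of m "p * m"] by simp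
  then obtain x where x: "[x\<^sup>2 = a] (mod int m)"
    using factor.IH factor.prems(2) by (auto simp: QuadRes_def)
  obtain y where y: "[y\<^sup>2 = a] (mod int p)"
    using factor.prems(2)[of p] factor.hyps by (auto simp: QuadRes_def)
  have cp: "coprime (int p) (int m)" using pm by simp
  obtain w where w: "[w = y] (mod int p)" "[w = x] (mod int m)"
    using binary_chinese_remainder_int[OF cp] by blast
  have "[w\<^sup>2 = a] (mod int p)" "[w\<^sup>2 = a] (mod int m)"
    using cong_pow[OF w(1), of 2] cong_pow[OF w(2), of 2] x y by (blast intro: cong_trans)+
  then have "[w\<^sup>2 = a] (mod int p * int m)" using cp by (rule coprime_cong_mult)
  then show ?case by (auto simp: QuadRes_def)
qed (auto simp: QuadRes_def)

section \<open>Real characters and the von Mangoldt function\<close>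

lemma summation_by_parts:
  fixes f g :: "nat \<Rightarrow> real"
  shows "(\<Sum>i = a..<a + k. f i * g i) = (\<Sum>i<a + k. f i) * g (a + k) - (\<Sum>i<a. f i) * g a
    + (\<Sum>i = a..<a + k. (\<Sum>j<Suc i. f j) * (g i - g (Suc i)))"
  by (induction k) (simp_all add: algebra_simps)

text \<open>The two boundary terms and the telescoping differences add up to
  \<open>2 * A * g a\<close>, whatever the length of the range. This gives the tail bounds for all
  character sums below.\<close>

lemma abel_bound:
  fixes f g :: "nat \<Rightarrow> real"
  assumes S: "\<And>k. \<bar>\<Sum>i<k. f i\<bar> \<le> A"
    and g0: "\<And>i. a \<le> i \<Longrightarrow> g i \<ge> 0" and dec: "\<And>i. a \<le> i \<Longrightarrow> g (Suc i) \<le> g i"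
  shows "\<bar>\<Sum>i = a..<a + k. f i * g i\<bar> \<le> 2 * A * g a"
proof -
  have A0: "A \<ge> 0" using S[of 0] by simp
  have tele: "(\<Sum>i = a..<a + k. g i - g (Suc i)) = g a - g (a + k)" by (induction k) auto
  have "\<bar>\<Sum>i = a..<a + k. (\<Sum>j<Suc i. f j) * (g i - g (Suc i))\<bar>
      \<le> (\<Sum>i = a..<a + k. \<bar>(\<Sum>j<Suc i. f j) * (g i - g (Suc i))\<bar>)" by (rule sum_abs)
  also have "\<dots> \<le> (\<Sum>i = a..<a + k. A * (g i - g (Suc i)))"
    unfolding abs_mult using S dec A0 by (intro sum_mono mult_mono) (auto simp del: sum.lessThan_Suc)
  also have "\<dots> = A * (g a - g (a + k))" by (simp add: sum_distrib_left[symmetric] tele)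
  finally have 1: "\<bar>\<Sum>i = a..<a + k. (\<Sum>j<Suc i. f j) * (g i - g (Suc i))\<bar> \<le> A * (g a - g (a + k))" .
  have 2: "\<bar>(\<Sum>i<a + k. f i) * g (a + k)\<bar> \<le> A * g (a + k)"
    unfolding abs_mult using S[of "a + k"] g0[of "a + k"] A0 by (intro mult_mono) auto
  have 3: "\<bar>(\<Sum>i<a. f i) * g a\<bar> \<le> A * g a"
    unfolding abs_mult using S[of a] g0[of a] A0 by (intro mult_mono) auto
  show ?thesis
  proof -
    have tri: "\<bar>X - Y + Z\<bar> \<le> \<bar>X\<bar> + \<bar>Y\<bar> + \<bar>Z\<bar>" for X Y Z :: real by linarith
    have "A * g (a + k) + A * g a + A * (g a - g (a + k)) = 2 * A * g a" by (simp add: algebra_simps)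
    then show ?thesis
      using order_trans[OF tri add_mono[OF add_mono[OF 2 3] 1]]
      by (simp only: summation_by_parts[of f g a k])
  qed
qed

text \<open>Pairs (d, m) with d m \<le> x are listed by their product or by d; every Dirichlet
  convolution below is summed in this way.\<close>

lemma sum_divisor_swap:
  fixes F :: "nat \<Rightarrow> nat \<Rightarrow> real"
  shows "(\<Sum>n = 1..x. \<Sum>d | d dvd n. F d (n div d)) = (\<Sum>d = 1..x. \<Sum>m = 1..x div d. F d m)"
proof -
  have "(\<Sum>n = 1..x. \<Sum>d | d dvd n. F d (n div d)) = (\<Sum>(n, d)\<in>(SIGMA n:{1..x}. {d. d dvd n}). F d (n div d))"
    by (rule sum.Sigma) (auto intro: finite_divisors_nat)
  also have "\<dots> = (\<Sum>(d, m)\<in>(SIGMA d:{1..x}. {1..x div d}). F d m)"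
  proof (rule sum.reindex_bij_witness[of _ "\<lambda>(d, m). (d * m, d)" "\<lambda>(n, d). (d, n div d)"])
    fix p assume "p \<in> (SIGMA d:{1..x}. {1..x div d})"
    then obtain d m where p: "p = (d, m)" "1 \<le> d" "d \<le> x" "1 \<le> m" "m \<le> x div d" by auto
    have "d * m \<le> d * (x div d)" using p by simp
    also have "\<dots> \<le> x" by simp
    finally have "d * m \<le> x" .
    then show "(case p of (d, m) \<Rightarrow> (d * m, d)) \<in> (SIGMA n:{1..x}. {d. d dvd n})" using p by auto
    show "(case case p of (d, m) \<Rightarrow> (d * m, d) of (n, d) \<Rightarrow> (d, n div d)) = p" using p by auto
  next
    fix p assume "p \<in> (SIGMA n:{1..x}. {d. d dvd n})"
    then obtain n d where p: "p = (n, d)" "1 \<le> n" "n \<le> x" "d dvd n" by auto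
    have "d \<ge> 1" "d \<le> n" using p by (auto intro: Nat.gr0I dvd_imp_le simp: Suc_le_eq)
    moreover have "n div d \<le> x div d" using p by (intro div_le_mono)
    moreover have "1 \<le> n div d" using p \<open>d \<ge> 1\<close> \<open>d \<le> n\<close> by (simp add: Suc_le_eq div_greater_zero_iff)
    ultimately show "(case p of (n, d) \<Rightarrow> (d, n div d)) \<in> (SIGMA d:{1..x}. {1..x div d})"
      using p by auto
    show "(case case p of (n, d) \<Rightarrow> (d, n div d) of (d, m) \<Rightarrow> (d * m, d)) = p" using p by auto
    show "(case case p of (n, d) \<Rightarrow> (d, n div d) of (d, m) \<Rightarrow> F d m) = (case p of (n, d) \<Rightarrow> F d (n div d))"
      using p by simp
  qed
  also have "\<dots> = (\<Sum>d = 1..x. \<Sum>m = 1..x div d. F d m)"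
    by (rule sum.Sigma[symmetric]) auto
  finally show ?thesis .
qed

abbreviation vM :: "nat \<Rightarrow> real" where
  "vM \<equiv> mangoldt"

lemma ln_fact_mangoldt: "ln (fact x) = (\<Sum>d = 1..x. vM d * real (x div d))"
proof -
  have "ln (fact x) = (\<Sum>n = 1..x. ln (real n))"
    by (induction x) (simp_all add: ln_mult add.commute)
  also have "\<dots> = (\<Sum>n = 1..x. \<Sum>d | d dvd n. vM d)"
    by (intro sum.cong refl) (simp add: mangoldt_sum)
  also have "\<dots> = (\<Sum>d = 1..x. \<Sum>m = 1..x div d. vM d)" by (rule sum_divisor_swap)
  finally show ?thesis by (simp add: mult.commute)
qed

text \<open>Chebyshev's argument. In the logarithm of the central binomial coefficient
  \<open>vM d\<close> has the coefficient \<open>2 * n div d - 2 * (n div d)\<close>, which is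
  nonnegative and equals 1 for n < d \<le> 2 n, while the binomial is at most 4^n.\<close>

lemma mangoldt_central: "(\<Sum>d = n + 1..2 * n. vM d) \<le> 2 * real n"
proof -
  have ext: "(\<Sum>d = 1..n. vM d * real (n div d)) = (\<Sum>d = 1..2 * n. vM d * real (n div d))"
    by (rule sum.mono_neutral_left) auto
  have "ln (real (2 * n choose n)) = ln (fact (2 * n)) - 2 * ln (fact n)"
    by (simp add: binomial_fact ln_div ln_mult)
  also have "\<dots> = (\<Sum>d = 1..2 * n. vM d * (real (2 * n div d) - 2 * real (n div d)))"
    unfolding ln_fact_mangoldt ext by (simp add: sum_distrib_left sum_subtractf algebra_simps)
  also have "\<dots> \<ge> (\<Sum>d = n + 1..2 * n. vM d)"
  proof -
    have "2 * (n div d) \<le> 2 * n div d" for d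
    proof (cases "d = 0")
      case False
      have "2 * (n div d) * d \<le> 2 * n" by (simp add: mult.assoc)
      then show ?thesis using False by (simp add: less_eq_div_iff_mult_less_eq)
    qed simp
    then have nn: "0 \<le> real (2 * n div d) - 2 * real (n div d)" for d
      by (metis diff_ge_0_iff_ge of_nat_le_iff of_nat_mult of_nat_numeral)
    have one: "real (2 * n div d) - 2 * real (n div d) = 1" if "d \<in> {n + 1..2 * n}" for d
    proof -
      have "n div d = 0" "2 * n div d = 1" using that by (auto intro: div_nat_eqI)
      then show ?thesis by simp
    qed
    have "(\<Sum>d = n + 1..2 * n. vM d) = (\<Sum>d = n + 1..2 * n. vM d * (real (2 * n div d) - 2 * real (n div d)))"
      by (intro sum.cong refl) (simp only: one mult_1_right)
    also have "\<dots> \<le> (\<Sum>d = 1..2 * n. vM d * (real (2 * n div d) - 2 * real (n div d)))"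
      by (intro sum_mono2) (auto intro!: mult_nonneg_nonneg nn mangoldt_nonneg)
    finally show ?thesis .
  qed
  finally have 1: "(\<Sum>d = n + 1..2 * n. vM d) \<le> ln (real (2 * n choose n))" .
  have "real (2 * n choose n) \<le> 2 ^ (2 * n)"
    using binomial_le_pow2[of "2 * n" n] by (metis of_nat_le_iff of_nat_numeral of_nat_power)
  then have "ln (real (2 * n choose n)) \<le> ln (2 ^ (2 * n))" by simp
  also have "\<dots> = 2 * real n * ln 2" by (simp add: ln_realpow)
  also have "\<dots> \<le> 2 * real n * 1" using ln_le_minus_one[of 2] by (intro mult_left_mono) auto
  finally show ?thesis using 1 by simp
qed

text \<open>Halving: with \<open>n = x div 2\<close> the range up to n, the range from n + 1 to 2 n
  and a possible last term contribute 6 n + 2 n + 2 n, and 10 n \<le> 6 x.\<close>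

lemma chebyshev_bound: "(\<Sum>d = 1..x. vM d) \<le> 6 * real x"
proof (induction x rule: less_induct)
  case (less x)
  show ?case
  proof (cases "x \<le> 1")
    case True
    then have "x = 0 \<or> x = 1" by linarith
    then show ?thesis by auto
  next
    case False
    define n where "n = x div 2"
    have n: "n < x" "n \<ge> 1" "2 * n \<le> x" "x \<le> 2 * n + 1" using False by (auto simp: n_def)
    have "(\<Sum>d = 1..x. vM d) \<le> (\<Sum>d = 1..2 * n + 1. vM d)"
      using n by (intro sum_mono2) (auto simp: mangoldt_nonneg)
    also have "\<dots> = (\<Sum>d = 1..n. vM d) + (\<Sum>d = n + 1..2 * n. vM d) + vM (2 * n + 1)"
    proof -
      have "{1..2 * n} = {1..n} \<union> {n + 1..2 * n}" by auto
      then have "(\<Sum>d = 1..2 * n. vM d) = (\<Sum>d = 1..n. vM d) + (\<Sum>d = n + 1..2 * n. vM d)"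
        by (simp add: sum.union_disjoint)
      then show ?thesis by simp
    qed
    also have "\<dots> \<le> 6 * real n + 2 * real n + 2 * real n"
    proof (intro add_mono)
      show "(\<Sum>d = 1..n. vM d) \<le> 6 * real n" using less n by blast
      show "(\<Sum>d = n + 1..2 * n. vM d) \<le> 2 * real n" by (rule mangoldt_central)
      have "vM (2 * n + 1) \<le> ln (real (2 * n + 1))" by (rule mangoldt_le) simp
      also have "\<dots> \<le> real (2 * n + 1) - 1" by (rule ln_le_minus_one) simp
      finally show "vM (2 * n + 1) \<le> 2 * real n" by simp
    qed
    also have "\<dots> \<le> 6 * real (2 * n)" by simp
    also have "\<dots> \<le> 6 * real x" using n by simp
    finally show ?thesis .
  qed
qed

text \<open>Taking logarithms in \<open>x ^ x \<le> exp x * fact x\<close> and replacing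
  \<open>x div d\<close> by x / d in the expansion of the factorial. The divergence of this sum is
  what produces primes in \<open>prime_with_characters\<close>.\<close>

lemma mangoldt_sum_ge:
  assumes "x \<ge> 1"
  shows "(\<Sum>d = 1..x. vM d / real d) \<ge> ln (real x) - 1"
proof -
  have "real x ^ x \<le> exp (real x) * fact x"
    using power_le_fact_exp[of "real x" x] by (simp add: mult.commute)
  then have "ln (real x ^ x) \<le> ln (exp (real x) * fact x)" using assms by (subst ln_le_cancel_iff) auto
  then have "real x * ln (real x) \<le> real x + ln (fact x)"
    using assms by (simp add: ln_realpow ln_mult)
  also have "ln (fact x) \<le> (\<Sum>d = 1..x. real x * (vM d / real d))"
    unfolding ln_fact_mangoldt
  proof (intro sum_mono)
    fix d assume "d \<in> {1..x}"
    have "vM d * real (x div d) \<le> vM d * (real x / real d)"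
      by (intro mult_left_mono mangoldt_nonneg of_nat_div_le_of_nat)
    then show "vM d * real (x div d) \<le> real x * (vM d / real d)" by (simp add: mult.commute)
  qed
  finally have "real x * ln (real x) \<le> real x * (1 + (\<Sum>d = 1..x. vM d / real d))"
    by (simp add: sum_distrib_left distrib_left)
  then show ?thesis using assms by simp
qed

text \<open>The arithmetic-geometric mean inequality for the terms with indices i and m - 1 -
  i.\<close>

lemma geometric_sum_ge:
  fixes u :: real
  assumes "u > 0"
  shows "real m * u ^ (m - 1) \<le> (\<Sum>i<m. u ^ (2 * i))"
proof -
  have "(\<Sum>i<m. u ^ (2 * (m - Suc i))) = (\<Sum>i<m. u ^ (2 * i))"
    by (rule sum.nat_diff_reindex)
  then have "2 * (\<Sum>i<m. u ^ (2 * i)) = (\<Sum>i<m. u ^ (2 * i) + u ^ (2 * (m - Suc i)))"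
    by (simp add: sum.distrib)
  also have "\<dots> \<ge> (\<Sum>i<m. 2 * u ^ (m - 1))"
  proof (intro sum_mono)
    fix i assume "i \<in> {..<m}"
    then have e: "u ^ (m - 1) = u ^ i * u ^ (m - Suc i)" by (simp flip: power_add)
    have "0 \<le> (u ^ i - u ^ (m - Suc i))\<^sup>2" by simp
    then show "2 * u ^ (m - 1) \<le> u ^ (2 * i) + u ^ (2 * (m - Suc i))"
      unfolding e power_even_eq by (simp add: power2_diff)
  qed
  finally show ?thesis by simp
qed

text \<open>Monsky's weights: a character sum against them is bounded by partial summation, whereas if \<open>L(1) = 0\<close>
  it equals, up to sign, the Lambert series of the character, which is unbounded as \<open>t \<rightarrow> 1\<close>.\<close>

definition monsky :: "real \<Rightarrow> nat \<Rightarrow> real" where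
  "monsky t m = 1 / (real m * (1 - t)) - t ^ m / (1 - t ^ m)"

text \<open>The difference of the two weights is a positive multiple of 1 / (m (m + 1)) - t^m / (A
  B). By \<open>geometric_sum_ge\<close> with u = sqrt t, the product A B is at least m (m + 1) t^(m
  - 1/2).\<close>

lemma monsky_decreasing:
  assumes t: "0 < t" "t < 1" and m: "m \<ge> 1"
  shows "monsky t (Suc m) \<le> monsky t m"
proof -
  define u where "u = sqrt t"
  have u: "u > 0" "u\<^sup>2 = t" "u < 1" using t by (simp_all add: u_def)
  define A B where "A = (\<Sum>i<m. t ^ i)" and "B = (\<Sum>i<Suc m. t ^ i)"
  have gs: "1 - t ^ k = (1 - t) * (\<Sum>i<k. t ^ i)" for k
    using t one_diff_power_eq[of t k] by simp
  have A: "A \<ge> real m * u ^ (m - 1)" and B: "B \<ge> real (Suc m) * u ^ m"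
    using geometric_sum_ge[OF u(1), of m] geometric_sum_ge[OF u(1), of "Suc m"]
    unfolding A_def B_def by (simp_all add: power_mult u(2) del: sum.lessThan_Suc of_nat_Suc)
  have "real m * real (Suc m) * t ^ m \<le> (real m * u ^ (m - 1)) * (real (Suc m) * u ^ m)"
  proof -
    have "t ^ m = u ^ (m + m)" unfolding u(2)[symmetric] by (simp add: power_mult[symmetric] mult_2)
    also have "\<dots> \<le> u ^ ((m - 1) + m)" using u by (intro power_decreasing) auto
    finally have "t ^ m \<le> u ^ (m - 1) * u ^ m" by (simp add: power_add)
    then have "(real m * real (Suc m)) * t ^ m \<le> (real m * real (Suc m)) * (u ^ (m - 1) * u ^ m)"
      by (intro mult_left_mono) auto
    then show ?thesis by (simp add: mult_ac)
  qed
  also have "\<dots> \<le> A * B" using A B u m by (intro mult_mono) (auto intro: order_trans[rotated])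
  finally have AB: "real m * real (Suc m) * t ^ m \<le> A * B" .
  have pos: "A > 0" "B > 0"
    using A B u m by (auto intro: less_le_trans[rotated])
  have "monsky t m - monsky t (Suc m)
      = (1 / (real m * (1 - t)) - 1 / (real (Suc m) * (1 - t))) - (t ^ m / (1 - t ^ m) - t ^ Suc m / (1 - t ^ Suc m))"
    by (simp add: monsky_def)
  also have "1 / (real m * (1 - t)) - 1 / (real (Suc m) * (1 - t)) = 1 / ((1 - t) * (real m * real (Suc m)))"
    using m t by (simp add: divide_simps)
  also have "t ^ m / (1 - t ^ m) - t ^ Suc m / (1 - t ^ Suc m) = t ^ m / ((1 - t) * (A * B))"
  proof -
    have nz: "1 - t ^ m \<noteq> 0" "1 - t ^ Suc m \<noteq> 0"
      unfolding gs A_def[symmetric] B_def[symmetric] using pos t by auto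
    have "t ^ m / (1 - t ^ m) - t ^ Suc m / (1 - t ^ Suc m) = (t ^ m * (1 - t)) / ((1 - t ^ m) * (1 - t ^ Suc m))"
      using nz by (simp add: diff_frac_eq) (simp add: algebra_simps)
    also have "\<dots> = t ^ m / ((1 - t) * (A * B))"
    proof -
      have *: "t ^ m * c / (c * A * (c * B)) = t ^ m / (c * (A * B))" if "c \<noteq> 0" for c
        using that pos by (simp add: field_simps)
      show ?thesis
        unfolding gs A_def[symmetric] B_def[symmetric] by (rule *) (use t in simp)
    qed
    finally show ?thesis .
  qed
  also have "1 / ((1 - t) * (real m * real (Suc m))) - t ^ m / ((1 - t) * (A * B))
      = (1 / (1 - t)) * (1 / (real m * real (Suc m)) - t ^ m / (A * B))"
    using t by (simp add: right_diff_distrib)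
  also have "\<dots> \<ge> 0"
  proof (intro mult_nonneg_nonneg)
    have "t ^ m / (A * B) \<le> 1 / (real m * real (Suc m))"
      using AB pos m by (simp add: divide_le_eq le_divide_eq mult_ac)
    then show "0 \<le> 1 / (real m * real (Suc m)) - t ^ m / (A * B)" by simp
  qed (use t in auto)
  finally show ?thesis by simp
qed

lemma monsky_nonneg:
  assumes t: "0 < t" "t < 1" and m: "m \<ge> 1"
  shows "monsky t m \<ge> 0"
proof -
  have "(\<Sum>i<m. t ^ m) \<le> (\<Sum>i<m. t ^ i)"
    using t by (intro sum_mono power_decreasing) auto
  then have s: "real m * t ^ m \<le> (\<Sum>i<m. t ^ i)" by simp
  have gs: "1 - t ^ m = (1 - t) * (\<Sum>i<m. t ^ i)"
    using t one_diff_power_eq[of t m] by simp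
  have "real m * (1 - t) * t ^ m \<le> 1 - t ^ m"
    unfolding gs using mult_left_mono[OF s, of "1 - t"] t by (simp add: mult_ac)
  moreover have "t ^ m < 1" using t m by (simp add: power_less_one_iff)
  ultimately show ?thesis
    using t m unfolding monsky_def by (simp add: divide_le_eq le_divide_eq mult_ac)
qed

section \<open>Real characters and the nonvanishing of L(1)\<close>

lemma power_sum_sign:
  fixes s :: real
  assumes "s \<in> {-1, 0, 1}"
  shows "0 \<le> (\<Sum>i\<le>e. s ^ i)" and "even e \<Longrightarrow> 1 \<le> (\<Sum>i\<le>e. s ^ i)"
proof -
  have "(\<Sum>i\<le>e. (-1) ^ i) = (if even e then 1 else 0 :: real)" by (induction e) auto
  moreover have "(\<Sum>i\<le>e. 0 ^ i) = (1 :: real)" by (induction e) auto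
  moreover have "(\<Sum>i\<le>e. 1 ^ i) = (real e + 1)" by (induction e) auto
  ultimately show "0 \<le> (\<Sum>i\<le>e. s ^ i)" "even e \<Longrightarrow> 1 \<le> (\<Sum>i\<le>e. s ^ i)"
    using assms by auto
qed

text \<open>\<open>zero_sum\<close> encodes nonprincipality: together with periodicity it bounds the
  partial sums by \<open>M\<close>, which is all that partial summation asks for.\<close>

locale real_character =
  fixes f :: "nat \<Rightarrow> real" and M :: nat
  assumes M: "M > 0" and periodic: "f (m + M) = f m" and mult: "f (a * b) = f a * f b"
    and one: "f 1 = 1" and vals: "f a \<in> {-1, 0, 1}" and zero_sum: "(\<Sum>m<M. f m) = 0"
begin

lemma abs_le_1: "\<bar>f a\<bar> \<le> 1"
  using vals[of a] by auto

lemma power: "f (a ^ k) = f a ^ k"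
  using one by (induction k) (auto simp: mult)

lemma partial_sum_bound: "\<bar>\<Sum>i<k. f i\<bar> \<le> real M"
proof (induction k rule: less_induct)
  case (less k)
  show ?case
  proof (cases "k < M")
    case True
    have "\<bar>\<Sum>i<k. f i\<bar> \<le> (\<Sum>i<k. 1)"
      using abs_le_1 by (intro order_trans[OF sum_abs sum_mono]) auto
    then show ?thesis using True by simp
  next
    case False
    then obtain a where a: "k = a + M" by (metis add.commute le_Suc_ex not_less)
    have "(\<Sum>i<a + M. f i) = (\<Sum>i<a. f i)" for a
      by (induction a) (simp_all add: zero_sum periodic)
    then show ?thesis using less[of a] a M by simp
  qed
qed

text \<open>The convolution of \<open>f\<close> with the constant 1; its Dirichlet series is zeta
  times the L-series of \<open>f\<close>. It is nonnegative and at least 1 at squares, the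
  positivity behind \<open>L_nonzero\<close>.\<close>

definition twisted_count :: "nat \<Rightarrow> real" where
  "twisted_count n = (\<Sum>d | d dvd n. f d)"

lemma twisted_count_primepow_mult:
  assumes p: "prime p" and pm: "\<not> p dvd m" and m: "m > 0"
  shows "twisted_count (p ^ e * m) = (\<Sum>i\<le>e. f p ^ i) * twisted_count m"
proof -
  have "{d. d dvd p ^ e * m} = (\<lambda>(i, d). p ^ i * d) ` ({..e} \<times> {d. d dvd m})"
  proof (intro equalityI subsetI)
    fix d assume "d \<in> {d. d dvd p ^ e * m}"
    then obtain b c where "d = b * c" "b dvd p ^ e" "c dvd m" using division_decomp by blast
    then show "d \<in> (\<lambda>(i, d). p ^ i * d) ` ({..e} \<times> {d. d dvd m})"
      using divides_primepow_nat[OF p] by auto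
  qed (auto intro!: mult_dvd_mono le_imp_power_dvd)
  moreover have "inj_on (\<lambda>(i, d). p ^ i * d) ({..e} \<times> {d. d dvd m})"
  proof (rule inj_onI, clarsimp)
    fix i d j c assume *: "d dvd m" "c dvd m" "p ^ i * d = p ^ j * c"
    have pd: "\<not> p dvd d" "\<not> p dvd c" using * pm dvd_trans by blast+
    have dc: "d > 0" "c > 0" using * m by (auto intro: Nat.gr0I)
    have "multiplicity p (p ^ i * d) = i" "multiplicity p (p ^ j * c) = j"
      using p pd dc by (simp_all add: prime_elem_multiplicity_mult_distrib not_dvd_imp_multiplicity_0)
    then have "i = j" using * by simp
    then show "i = j \<and> d = c" using * p by simp
  qed
  ultimately have "twisted_count (p ^ e * m) = (\<Sum>(i, d)\<in>{..e} \<times> {d. d dvd m}. f (p ^ i * d))"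
    unfolding twisted_count_def by (simp add: sum.reindex case_prod_unfold)
  also have "\<dots> = (\<Sum>i\<le>e. \<Sum>d | d dvd m. f (p ^ i * d))"
    by (simp add: sum.cartesian_product)
  also have "\<dots> = (\<Sum>i\<le>e. f p ^ i) * twisted_count m"
    unfolding twisted_count_def mult power by (simp add: sum_product)
  finally show ?thesis .
qed

lemma twisted_count_nonneg: "n > 0 \<Longrightarrow> twisted_count n \<ge> 0"
proof (induction n rule: less_induct)
  case (less n)
  show ?case
  proof (cases "n = 1")
    case True
    then show ?thesis using one by (simp add: twisted_count_def)
  next
    case False
    then obtain p where p: "prime p" "p dvd n" using prime_factor_nat by blast
    obtain m where m: "n = p ^ multiplicity p n * m" "\<not> p dvd m"
      using multiplicity_decompose'[of n p] p less.prems by (metis not_prime_unit neq0_conv)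
    have m0: "m > 0" using m less.prems by (auto intro: Nat.gr0I)
    have "multiplicity p n > 0" using p less.prems by (simp add: prime_multiplicity_gt_zero_iff)
    then have "1 < p ^ multiplicity p n" using prime_gt_1_nat[OF p(1)] by (intro one_less_power)
    then have "m < p ^ multiplicity p n * m" using m0 by simp
    then have "m < n" using m(1) by metis
    then have "0 \<le> (\<Sum>i\<le>multiplicity p n. f p ^ i) * twisted_count m"
      using less.IH m0 power_sum_sign(1)[OF vals] by simp
    then show ?thesis using twisted_count_primepow_mult[OF p(1) m(2) m0] m(1) by metis
  qed
qed

lemma twisted_count_square: "k > 0 \<Longrightarrow> twisted_count (k\<^sup>2) \<ge> 1"
proof (induction k rule: less_induct)
  case (less k)
  show ?case
  proof (cases "k = 1")
    case True
    then show ?thesis using one by (simp add: twisted_count_def)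
  next
    case False
    then obtain p where p: "prime p" "p dvd k" using prime_factor_nat by blast
    define e where "e = multiplicity p k"
    obtain m where m: "k = p ^ e * m" "\<not> p dvd m"
      using multiplicity_decompose'[of k p] p less.prems unfolding e_def by (metis not_prime_unit neq0_conv)
    have m0: "m > 0" using m less.prems by (auto intro: Nat.gr0I)
    have "e > 0" using p less.prems by (simp add: prime_multiplicity_gt_zero_iff e_def)
    then have "1 < p ^ e" using prime_gt_1_nat[OF p(1)] by (intro one_less_power)
    then have "m < k" using m m0 by simp
    then have "1 * 1 \<le> (\<Sum>i\<le>2 * e. f p ^ i) * twisted_count (m\<^sup>2)"
      using less.IH m0 power_sum_sign[OF vals, where e = "2 * e"] by (intro mult_mono) auto
    moreover have "\<not> p dvd m\<^sup>2" using m(2) p(1) prime_dvd_power by blast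
    moreover have "k\<^sup>2 = p ^ (2 * e) * m\<^sup>2"
      by (subst m(1)) (simp only: power_mult_distrib power_mult[symmetric] mult.commute[of e])
    ultimately show ?thesis using twisted_count_primepow_mult[OF p(1), of "m\<^sup>2" "2 * e"] m0 by simp
  qed
qed

definition T :: "nat \<Rightarrow> real" where
  "T k = (\<Sum>m = 1..k. f m / real m)"

lemma abel_sum:
  assumes "\<And>i. a \<le> i \<Longrightarrow> g i \<ge> 0" "\<And>i. a \<le> i \<Longrightarrow> g (Suc i) \<le> g i"
  shows "\<bar>\<Sum>m = a..K. f m * g m\<bar> \<le> 2 * real M * g a"
proof (cases "a \<le> Suc K")
  case True
  then obtain k where k: "Suc K = a + k" by (metis le_Suc_ex)
  have "{a..K} = {a..<a + k}" using k by auto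
  then show ?thesis using abel_bound[of f "real M" a g k, OF partial_sum_bound assms] by simp
next
  case False
  then have "{a..K} = {}" by auto
  then show ?thesis using assms(1)[of a] by simp
qed

lemma T_diff: 
  assumes "k \<le> l"
  shows "\<bar>T l - T k\<bar> \<le> 2 * real M / real (Suc k)"
proof -
  have "{1..l} = {1..k} \<union> {Suc k..l}" using assms by auto
  then have "T l = T k + (\<Sum>m = Suc k..l. f m / real m)"
    unfolding T_def by (simp add: sum.union_disjoint)
  moreover have "\<bar>\<Sum>m = Suc k..l. f m * (1 / real m)\<bar> \<le> 2 * real M * (1 / real (Suc k))"
    by (rule abel_sum) (auto intro!: divide_left_mono)
  ultimately show ?thesis by simp
qed

lemma T_convergent: "convergent T"
proof (rule Cauchy_convergent, rule CauchyI)
  fix e :: real assume e: "e > 0"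
  obtain N where N: "2 * real M / e < real N" using reals_Archimedean2 by blast
  have small: "2 * real M / real (Suc k) < e" if "k \<ge> N" for k
  proof -
    have "2 * real M / e < real (Suc k)" using N that by simp
    then show ?thesis using e by (simp add: divide_less_eq mult.commute)
  qed
  show "\<exists>N. \<forall>m\<ge>N. \<forall>n\<ge>N. norm (T m - T n) < e"
  proof (intro exI allI impI)
    fix m n assume "N \<le> m" "N \<le> n"
    then show "norm (T m - T n) < e"
      using T_diff[of m n] T_diff[of n m] small[of m] small[of n]
      by (cases "m \<le> n") (auto simp: abs_minus_commute)
  qed
qed

text \<open>The value at 1 of the L-series of \<open>f\<close>.\<close>

definition L :: real where
  "L = lim T"

lemma T_tendsto: "T \<longlonglongrightarrow> L"
  using T_convergent by (simp add: L_def convergent_LIMSEQ_iff)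

text \<open>The rate matters: for \<open>k = x div d\<close> it is at most 2 M d / x, which makes
  the error in \<open>mangoldt_character_bound\<close> a Chebyshev sum.\<close>

lemma T_tail: "\<bar>L - T k\<bar> \<le> 2 * real M / real (Suc k)"
proof (rule LIMSEQ_le_const2)
  show "(\<lambda>l. \<bar>T l - T k\<bar>) \<longlonglongrightarrow> \<bar>L - T k\<bar>"
    by (intro tendsto_intros T_tendsto)
  show "\<exists>N. \<forall>n\<ge>N. \<bar>T n - T k\<bar> \<le> 2 * real M / real (Suc k)"
    using T_diff by blast
qed

text \<open>Each \<open>t ^ m / (1 - t ^ m)\<close> is expanded in a geometric series cut at
  \<open>K div m\<close>, so that exactly the products m j \<le> K occur; grouping them by n = m j
  yields \<open>twisted_count\<close>. Every remainder is at most
  \<open>t ^ K / (1 - t)\<close>.\<close>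

lemma lambert_bound:
  assumes t: "0 < t" "t < 1"
  shows "(\<Sum>n = 1..K. twisted_count n * t ^ n) \<le> 2 * real M + \<bar>T K\<bar> / (1 - t) + real K * t ^ K / (1 - t)"
proof -
  have tm: "t ^ m < 1" "t ^ m \<le> t" if "m \<ge> 1" for m
    using t that power_decreasing[of 1 m t] by auto
  have geo: "y / (1 - y) = (\<Sum>j = 1..J. y ^ j) + y ^ Suc J / (1 - y)" if "y \<noteq> 1" for y :: real and J
    using that by (induction J) (auto simp: field_simps)
  have split: "t ^ m / (1 - t ^ m) = (\<Sum>j = 1..K div m. t ^ (m * j)) + t ^ (m * Suc (K div m)) / (1 - t ^ m)"
    if "m \<ge> 1" for m
    unfolding power_mult by (rule geo) (use tm[OF that] in simp)
  define E where "E = (\<Sum>m = 1..K. f m * (t ^ (m * Suc (K div m)) / (1 - t ^ m)))"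
  \<comment> \<open>The first weight does not depend on t, so the bound from partial summation is
    uniform as t tends to 1.\<close>
  have "monsky t 1 = 1" using t by (simp add: monsky_def diff_divide_distrib[symmetric])
  then have "\<bar>\<Sum>m = 1..K. f m * monsky t m\<bar> \<le> 2 * real M"
    using abel_sum[of 1 "monsky t" K] monsky_nonneg[OF t] monsky_decreasing[OF t] by simp
  moreover have "(\<Sum>m = 1..K. f m * monsky t m) = T K / (1 - t) - (\<Sum>m = 1..K. f m * (t ^ m / (1 - t ^ m)))"
    unfolding monsky_def T_def by (simp add: right_diff_distrib sum_subtractf sum_divide_distrib)
  moreover have "(\<Sum>m = 1..K. f m * (t ^ m / (1 - t ^ m))) = (\<Sum>n = 1..K. twisted_count n * t ^ n) + E"
  proof -
    have "(\<Sum>m = 1..K. f m * (t ^ m / (1 - t ^ m)))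
        = (\<Sum>m = 1..K. (\<Sum>j = 1..K div m. f m * t ^ (m * j)) + f m * (t ^ (m * Suc (K div m)) / (1 - t ^ m)))"
    proof (intro sum.cong refl)
      fix m assume "m \<in> {1..K}"
      then have m: "m \<ge> 1" by simp
      show "f m * (t ^ m / (1 - t ^ m)) = (\<Sum>j = 1..K div m. f m * t ^ (m * j)) + f m * (t ^ (m * Suc (K div m)) / (1 - t ^ m))"
        unfolding split[OF m] distrib_left sum_distrib_left ..
    qed
    also have "\<dots> = (\<Sum>m = 1..K. \<Sum>j = 1..K div m. f m * t ^ (m * j)) + E"
      by (simp only: sum.distrib E_def)
    also have "(\<Sum>m = 1..K. \<Sum>j = 1..K div m. f m * t ^ (m * j)) = (\<Sum>n = 1..K. \<Sum>d | d dvd n. f d * t ^ (d * (n div d)))"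
      by (rule sum_divisor_swap[symmetric])
    also have "\<dots> = (\<Sum>n = 1..K. twisted_count n * t ^ n)"
      unfolding twisted_count_def sum_distrib_right by (intro sum.cong refl) simp
    finally show ?thesis .
  qed
  moreover have "\<bar>E\<bar> \<le> (\<Sum>m = 1..K. t ^ K / (1 - t))"
    unfolding E_def
  proof (intro order_trans[OF sum_abs sum_mono])
    fix m assume "m \<in> {1..K}"
    then have m: "m \<ge> 1" by simp
    have "K \<le> m * Suc (K div m)" using m by (metis dividend_less_times_div less_imp_le mult_Suc_right One_nat_def Suc_le_eq)
    then have "t ^ (m * Suc (K div m)) \<le> t ^ K" using t by (intro power_decreasing) auto
    then have "t ^ (m * Suc (K div m)) / (1 - t ^ m) \<le> t ^ K / (1 - t)"
      using t tm[OF m] by (intro frac_le) auto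
    then have "\<bar>f m\<bar> * \<bar>t ^ (m * Suc (K div m)) / (1 - t ^ m)\<bar> \<le> 1 * (t ^ K / (1 - t))"
      using abs_le_1[of m] t tm[OF m] by (intro mult_mono) auto
    then show "\<bar>f m * (t ^ (m * Suc (K div m)) / (1 - t ^ m))\<bar> \<le> t ^ K / (1 - t)"
      by (simp only: abs_mult mult_1)
  qed
  moreover have "T K / (1 - t) \<le> \<bar>T K\<bar> / (1 - t)" using t by (intro divide_right_mono) auto
  ultimately show ?thesis by (simp add: abs_le_iff)
qed

text \<open>If L vanished, letting K grow in \<open>lambert_bound\<close> would bound the sum of
  \<open>t ^ (k\<^sup>2)\<close> by 2 M for every t < 1. At t = 1 already 2 M + 1 squares contradict
  this.\<close>

lemma L_nonzero: "L \<noteq> 0"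
proof
  assume L0: "L = 0"
  define Q where "Q = 2 * M + 1"
  have bound: "(\<Sum>k = 1..Q. t ^ (k\<^sup>2)) \<le> 2 * real M" if t: "0 < t" "t < 1" for t :: real
  proof (rule LIMSEQ_le_const)
    have "(\<lambda>K. real K * t ^ K) \<longlonglongrightarrow> 0" using powser_times_n_limit_0[of t] t by simp
    then have "(\<lambda>K. 2 * real M + \<bar>T K\<bar> / (1 - t) + real K * t ^ K / (1 - t)) \<longlonglongrightarrow> 2 * real M + \<bar>L\<bar> / (1 - t) + 0 / (1 - t)"
      using t by (intro tendsto_intros T_tendsto) auto
    then show "(\<lambda>K. 2 * real M + \<bar>T K\<bar> / (1 - t) + real K * t ^ K / (1 - t)) \<longlonglongrightarrow> 2 * real M"
      by (simp add: L0)
    show "\<exists>N. \<forall>K\<ge>N. (\<Sum>k = 1..Q. t ^ (k\<^sup>2)) \<le> 2 * real M + \<bar>T K\<bar> / (1 - t) + real K * t ^ K / (1 - t)"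
    proof (intro exI allI impI)
      fix K assume K: "Q\<^sup>2 \<le> K"
      have inj: "inj_on (\<lambda>k::nat. k\<^sup>2) {1..Q}" by (auto simp: inj_on_def)
      have "(\<Sum>k = 1..Q. t ^ (k\<^sup>2)) \<le> (\<Sum>k = 1..Q. twisted_count (k\<^sup>2) * t ^ (k\<^sup>2))"
        using mult_right_mono[OF twisted_count_square, of _ "t ^ (_\<^sup>2)"] t by (intro sum_mono) auto
      also have "\<dots> = (\<Sum>n\<in>(\<lambda>k. k\<^sup>2) ` {1..Q}. twisted_count n * t ^ n)" by (subst sum.reindex[OF inj]) (simp add: o_def)
      also have "\<dots> \<le> (\<Sum>n = 1..K. twisted_count n * t ^ n)"
      proof (rule sum_mono2)
        show "(\<lambda>k. k\<^sup>2) ` {1..Q} \<subseteq> {1..K}"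
        proof
          fix n assume "n \<in> (\<lambda>k. k\<^sup>2) ` {1..Q}"
          then obtain k where k: "n = k\<^sup>2" "1 \<le> k" "k \<le> Q" by auto
          have "k\<^sup>2 \<le> Q\<^sup>2" using k by (intro power_mono) auto
          then have "k\<^sup>2 \<le> K" using K by (rule order_trans)
          then show "n \<in> {1..K}" using k by simp
        qed
      qed (use twisted_count_nonneg t in auto)
      also have "\<dots> \<le> 2 * real M + \<bar>T K\<bar> / (1 - t) + real K * t ^ K / (1 - t)" by (rule lambert_bound[OF t])
      finally show "(\<Sum>k = 1..Q. t ^ (k\<^sup>2)) \<le> 2 * real M + \<bar>T K\<bar> / (1 - t) + real K * t ^ K / (1 - t)" .
    qed
  qed
  have "((\<lambda>t::real. \<Sum>k = 1..Q. t ^ (k\<^sup>2)) \<longlongrightarrow> (\<Sum>k = 1..Q. 1 ^ (k\<^sup>2))) (at_left 1)"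
    by (intro tendsto_intros)
  moreover have "eventually (\<lambda>t::real. (\<Sum>k = 1..Q. t ^ (k\<^sup>2)) \<le> 2 * real M) (at_left 1)"
    unfolding eventually_at_left_field by (rule exI[of _ 0]) (use bound in auto)
  ultimately have "(\<Sum>k = 1..Q. (1::real) ^ (k\<^sup>2)) \<le> 2 * real M"
    by (rule tendsto_upperbound) simp
  then show False by (simp add: Q_def)
qed

lemma log_sum_bound: "\<exists>B. \<forall>x. \<bar>\<Sum>n = 1..x. f n * (ln (real n) / real n)\<bar> \<le> B"
proof -
  define g where "g = (\<lambda>n::nat. ln (real n) / real n)"
  \<comment> \<open>The quotient ln n / n decreases only beyond e, hence the start at 3 and the
    separate treatment of n = 1, 2.\<close>
  have g: "g (Suc i) \<le> g i" "g i \<ge> 0" if "i \<ge> 3" for i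
  proof -
    have "3 \<le> real i" using that by simp
    then have "exp 1 \<le> real i" using exp_le by (rule order_trans[rotated])
    then show "g (Suc i) \<le> g i" unfolding g_def by (intro ln_x_over_x_mono) auto
    show "g i \<ge> 0" using that by (simp add: g_def)
  qed
  have "\<bar>\<Sum>n = 1..x. f n * g n\<bar> \<le> (\<Sum>n = 1..2. \<bar>g n\<bar>) + 2 * real M * g 3" for x
  proof -
    have 1: "\<bar>\<Sum>n\<in>{1..x} \<inter> {1..2}. f n * g n\<bar> \<le> (\<Sum>n = 1..2. \<bar>g n\<bar>)"
    proof -
      have "\<bar>\<Sum>n\<in>{1..x} \<inter> {1..2}. f n * g n\<bar> \<le> (\<Sum>n\<in>{1..x} \<inter> {1..2}. \<bar>g n\<bar>)"
        unfolding abs_mult[symmetric] using mult_right_mono[OF abs_le_1, of "\<bar>g _\<bar>"]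
        by (intro order_trans[OF sum_abs sum_mono]) (simp add: abs_mult)
      also have "\<dots> \<le> (\<Sum>n = 1..2. \<bar>g n\<bar>)" by (intro sum_mono2) auto
      finally show ?thesis .
    qed
    have "{1..x} = ({1..x} \<inter> {1..2}) \<union> {3..x}" by auto
    moreover have "({1..x} \<inter> {1..2}) \<inter> {3..x} = {}" by auto
    ultimately have "(\<Sum>n = 1..x. f n * g n) = (\<Sum>n\<in>{1..x} \<inter> {1..2}. f n * g n) + (\<Sum>n = 3..x. f n * g n)"
      by (metis (no_types, lifting) finite_Int finite_atLeastAtMost sum.union_disjoint)
    then show ?thesis using 1 abel_sum[of 3 g x] g by (simp add: abs_le_iff)
  qed
  then show ?thesis unfolding g_def by blast
qed

text \<open>The pointwise product f ln is the convolution of f vM with f. Summed with weight 1 / n,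
  it makes the sum of \<open>a d * T (x div d)\<close> bounded; replacing T by its limit costs an
  error controlled by \<open>T_tail\<close> and Chebyshev's bound, and the nonzero factor L is
  divided out.\<close>

theorem mangoldt_character_bound: "\<exists>B. \<forall>x. \<bar>\<Sum>d = 1..x. vM d * f d / real d\<bar> \<le> B"
proof -
  obtain B where B: "\<And>x. \<bar>\<Sum>n = 1..x. f n * (ln (real n) / real n)\<bar> \<le> B" using log_sum_bound by blast
  have "\<bar>\<Sum>d = 1..x. vM d * f d / real d\<bar> \<le> (B + 12 * real M) / \<bar>L\<bar>" for x
  proof -
    define a where "a = (\<lambda>d. vM d * f d / real d)"
    have "(\<Sum>n = 1..x. f n * (ln (real n) / real n)) = (\<Sum>n = 1..x. \<Sum>d | d dvd n. a d * (f (n div d) / real (n div d)))"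
    proof (intro sum.cong refl)
      fix n assume "n \<in> {1..x}"
      then have n: "n \<noteq> 0" by simp
      have "f n * (ln (real n) / real n) = (\<Sum>d | d dvd n. vM d * (f n / real n))"
        unfolding sum_distrib_right[symmetric] using mangoldt_sum[OF n, where ?'a = real] by simp
      also have "\<dots> = (\<Sum>d | d dvd n. a d * (f (n div d) / real (n div d)))"
      proof (intro sum.cong refl)
        fix d assume "d \<in> {d. d dvd n}"
        then obtain m where m: "n = d * m" by auto
        then have "d > 0" "m > 0" using n by auto
        then show "vM d * (f n / real n) = a d * (f (n div d) / real (n div d))"
          unfolding m a_def by (simp add: mult)
      qed
      finally show "f n * (ln (real n) / real n) = (\<Sum>d | d dvd n. a d * (f (n div d) / real (n div d)))" .
    qed
    also have "\<dots> = (\<Sum>d = 1..x. \<Sum>m = 1..x div d. a d * (f m / real m))" by (rule sum_divisor_swap)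
    also have "\<dots> = (\<Sum>d = 1..x. a d * T (x div d))" by (simp add: T_def sum_distrib_left)
    finally have W: "\<bar>\<Sum>d = 1..x. a d * T (x div d)\<bar> \<le> B" using B[of x] by simp
    have "\<bar>\<Sum>d = 1..x. a d * (L - T (x div d))\<bar> \<le> (\<Sum>d = 1..x. vM d * (2 * real M / real x))"
    proof (intro order_trans[OF sum_abs sum_mono])
      fix d assume d: "d \<in> {1..x}"
      have "x \<le> d * Suc (x div d)" using d by (metis atLeastAtMost_iff dividend_less_times_div less_imp_le mult_Suc_right One_nat_def Suc_le_eq)
      then have xd: "real x \<le> real d * real (Suc (x div d))" by (metis of_nat_le_iff of_nat_mult)
      have "\<bar>a d\<bar> \<le> vM d * 1 / real d"
        unfolding a_def using abs_le_1[of d] mangoldt_nonneg[of d]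
        by (simp add: abs_mult divide_right_mono mult_left_le)
      then have "\<bar>a d * (L - T (x div d))\<bar> \<le> (vM d * 1 / real d) * (2 * real M / real (Suc (x div d)))"
        unfolding abs_mult using T_tail mangoldt_nonneg[of d] by (intro mult_mono) auto
      also have "\<dots> = vM d * (2 * real M / (real d * real (Suc (x div d))))" by simp
      also have "\<dots> \<le> vM d * (2 * real M / real x)"
        using xd d by (intro mult_left_mono divide_left_mono mangoldt_nonneg) (auto simp del: of_nat_Suc)
      finally show "\<bar>a d * (L - T (x div d))\<bar> \<le> vM d * (2 * real M / real x)" .
    qed
    also have "\<dots> = (\<Sum>d = 1..x. vM d) * (2 * real M / real x)" by (rule sum_distrib_right[symmetric])
    also have "\<dots> \<le> 6 * real x * (2 * real M / real x)"
      by (intro mult_right_mono chebyshev_bound) auto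
    also have "\<dots> \<le> 12 * real M" by simp
    finally have V: "\<bar>\<Sum>d = 1..x. a d * (L - T (x div d))\<bar> \<le> 12 * real M" .
    have "L * (\<Sum>d = 1..x. a d) = (\<Sum>d = 1..x. a d * T (x div d)) + (\<Sum>d = 1..x. a d * (L - T (x div d)))"
      by (simp add: sum_distrib_left right_diff_distrib mult.commute flip: sum.distrib)
    then have "\<bar>L\<bar> * \<bar>\<Sum>d = 1..x. a d\<bar> \<le> B + 12 * real M"
      unfolding abs_mult[symmetric] using W V by linarith
    then show ?thesis using L_nonzero by (simp add: a_def le_divide_eq mult.commute)
  qed
  then show ?thesis by blast
qed

end

section \<open>Primes with prescribed quadratic characters; sums of three squares\<close>

definition chi4 :: "nat \<Rightarrow> int" where
  "chi4 a = (if even a then 0 else if a mod 4 = 1 then 1 else - 1)"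

lemma mod4_cases: "(a::nat) mod 4 = 0 \<or> a mod 4 = 1 \<or> a mod 4 = 2 \<or> a mod 4 = 3"
  by linarith

lemma chi4_mod: "chi4 a = (if a mod 4 = 1 then 1 else if a mod 4 = 3 then - 1 else 0)"
proof -
  have "even a \<longleftrightarrow> even (a mod 4)" by presburger
  then show ?thesis using mod4_cases[of a] by (auto simp: chi4_def)
qed

lemma chi4_mult: "chi4 (a * b) = chi4 a * chi4 b"
proof -
  have "chi4 (a * b) = chi4 ((a mod 4) * (b mod 4))"
    by (simp add: chi4_mod mod_mult_eq)
  also have "\<dots> = chi4 (a mod 4) * chi4 (b mod 4)"
    using mod4_cases[of a] mod4_cases[of b] by (elim disjE) (simp_all add: chi4_mod)
  also have "\<dots> = chi4 a * chi4 b" by (simp add: chi4_mod)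
  finally show ?thesis .
qed

lemma Legendre_vals: "Legendre a p \<in> {-1, 0, 1}"
  by (simp add: Legendre_def)

lemma Legendre_cong: "[a = b] (mod p) \<Longrightarrow> Legendre a p = Legendre b p"
  by (simp add: Legendre_def QuadRes_def cong_def)

lemma Legendre_one: "prime p \<Longrightarrow> Legendre 1 (int p) = 1"
  using prime_gt_1_nat[of p] unfolding Legendre_def QuadRes_def
  by (auto simp: cong_def intro: exI[of _ 1])

text \<open>Two such values differ by at most 2 < p. This lifts Euler's criterion from congruences
  to equalities.\<close>

lemma cong_signs_eq:
  fixes x y p :: int
  assumes "[x = y] (mod p)" "p > 2" "x \<in> {-1, 0, 1}" "y \<in> {-1, 0, 1}"
  shows "x = y"
proof -
  have "p dvd x - y" using assms(1) by (simp add: cong_iff_dvd_diff)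
  moreover have "\<bar>x - y\<bar> < p" using assms by auto
  ultimately show ?thesis using zdvd_not_zless[of "\<bar>x - y\<bar>" p] by (cases "x = y") auto
qed

lemma Legendre_mult:
  assumes "prime p" "p > 2"
  shows "Legendre (a * b) (int p) = Legendre a (int p) * Legendre b (int p)"
proof (rule cong_signs_eq)
  have "[Legendre a (int p) * Legendre b (int p) = a ^ ((p - 1) div 2) * b ^ ((p - 1) div 2)] (mod int p)"
    by (intro cong_mult euler_criterion assms)
  then have "[Legendre a (int p) * Legendre b (int p) = (a * b) ^ ((p - 1) div 2)] (mod int p)"
    by (simp add: power_mult_distrib)
  then show "[Legendre (a * b) (int p) = Legendre a (int p) * Legendre b (int p)] (mod int p)"
    using euler_criterion[OF assms, of "a * b"] by (blast intro: cong_trans cong_sym)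
qed (use assms Legendre_vals[of "a * b" "int p"] Legendre_vals[of a "int p"] Legendre_vals[of b "int p"] in auto)

lemma odd_prime_mod4:
  assumes "prime (p::nat)" "p > 2"
  shows "p mod 4 = 1 \<or> p mod 4 = 3"
proof -
  have "odd p" using assms by (metis prime_odd_nat)
  then show ?thesis by presburger
qed

lemma Legendre_minus_one:
  assumes p: "prime p" "p > 2"
  shows "Legendre (- 1) (int p) = chi4 p"
proof (rule cong_signs_eq)
  have "(- 1 :: int) ^ ((p - 1) div 2) = chi4 p"
  proof (cases "p mod 4 = 1")
    case True
    then have "even ((p - 1) div 2)" by presburger
    then show ?thesis using True by (simp add: chi4_mod)
  next
    case False
    then have "p mod 4 = 3" using odd_prime_mod4[OF p] by simp
    moreover from this have "odd ((p - 1) div 2)" by presburger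
    ultimately show ?thesis by (simp add: chi4_mod)
  qed
  then show "[Legendre (- 1) (int p) = chi4 p] (mod int p)" using euler_criterion[OF p, of "- 1"] by simp
qed (use p Legendre_vals[of _ "int p"] in \<open>auto simp: chi4_mod\<close>)

text \<open>Otherwise squaring would be onto and hence injective on the classes 1..p-1, but 1 and p
  - 1 have the same square.\<close>

lemma nonresidue_exists:
  assumes p: "prime p" "p > 2"
  shows "\<exists>a::nat. Legendre (int a) (int p) = - 1"
proof (rule ccontr)
  assume no: "\<not> ?thesis"
  define sq where "sq = (\<lambda>x::nat. x\<^sup>2 mod p)"
  have "{1..<p} \<subseteq> sq ` {1..<p}"
  proof
    fix a assume a: "a \<in> {1..<p}"
    then have "\<not> [int a = 0] (mod int p)"
      by (auto simp: cong_def)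
    then have "QuadRes (int p) (int a)"
      using no by (auto simp: Legendre_def split: if_splits)
    then obtain y where y: "[y\<^sup>2 = int a] (mod int p)" by (auto simp: QuadRes_def)
    define x where "x = nat (y mod int p)"
    have x: "int x = y mod int p" using p by (simp add: x_def)
    have "[(int x)\<^sup>2 = int a] (mod int p)"
      unfolding x using y by (metis cong_def power_mod)
    then have "[x\<^sup>2 = a] (mod p)" by (metis cong_int_iff of_nat_power)
    then have "sq x = a" using a by (simp add: sq_def cong_def)
    moreover have "x < p" using x p by (metis of_nat_less_iff of_nat_0_less_iff pos_mod_bound prime_gt_0_nat)
    moreover have "x \<noteq> 0"
    proof
      assume "x = 0"
      then have "sq x = 0" by (simp add: sq_def)
      then show False using \<open>sq x = a\<close> a by simp
    qed
    ultimately show "a \<in> sq ` {1..<p}" by auto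
  qed
  then have "inj_on sq {1..<p}" by (intro eq_card_imp_inj_on antisym card_image_le card_mono) auto
  moreover have "sq 1 = sq (p - 1)"
  proof -
    have "(p - 1)\<^sup>2 = 1 + p * (p - 2)" using p by (auto simp: power2_eq_square algebra_simps diff_mult_distrib2 le_Suc_ex dest!: less_imp_Suc_add)
    then have "(p - 1)\<^sup>2 mod p = 1 mod p" by (simp only: mod_mult_self2)
    then show ?thesis by (simp add: sq_def)
  qed
  ultimately have "1 = p - 1" using p by (auto simp: inj_on_def)
  then show False using p by simp
qed

text \<open>The index 2 stands for the character modulo 4.\<close>

definition chi :: "nat \<Rightarrow> nat \<Rightarrow> int" where
  "chi j a = (if j = 2 then chi4 a else Legendre (int a) (int j))"

locale odd_modulus =
  fixes n :: nat
  assumes odd_n: "odd n"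
begin

definition J :: "nat set" where
  "J = insert 2 (prime_factors n)"

lemma finite_J: "finite J"
  by (simp add: J_def)

lemma J_cases: "j \<in> J \<Longrightarrow> j = 2 \<or> (prime j \<and> j > 2 \<and> j dvd n)"
proof -
  assume "j \<in> J"
  then consider "j = 2" | "prime j" "j dvd n" by (auto simp: J_def in_prime_factors_iff)
  then show ?thesis
  proof cases
    case 2
    have "j \<noteq> 2" using 2 odd_n by auto
    then show ?thesis using 2 prime_ge_2_nat[of j] by simp
  qed simp
qed

lemma J_prime: "j \<in> J \<Longrightarrow> prime j"
  using J_cases[of j] two_is_prime_nat by auto

lemma chi_mult: "j \<in> J \<Longrightarrow> chi j (a * b) = chi j a * chi j b"
  using J_cases[of j] by (auto simp: chi_def chi4_mult Legendre_mult)

lemma chi_one: "j \<in> J \<Longrightarrow> chi j 1 = 1"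
  using J_cases[of j] Legendre_one[of j] by (auto simp: chi_def chi4_def)

lemma chi_vals: "chi j a \<in> {-1, 0, 1}"
  using Legendre_vals[of "int a" "int j"] by (auto simp: chi_def chi4_def)

lemma chi_zero: "j \<in> J \<Longrightarrow> chi j a = 0 \<longleftrightarrow> j dvd a"
proof -
  assume "j \<in> J"
  then show ?thesis
    using J_cases[of j] by (auto simp: chi_def chi4_def Legendre_def cong_0_iff)
qed

lemma chi_periodic: "j \<in> J \<Longrightarrow> chi j (a + 4 * n) = chi j a"
proof -
  assume "j \<in> J"
  then consider "j = 2" | "j > 2" "j dvd n" using J_cases by blast
  then show ?thesis
  proof cases
    case 1
    then show ?thesis by (simp add: chi_def chi4_mod)
  next
    case 2
    have "[int (a + 4 * n) = int a] (mod int j)"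
      using 2 by (simp add: cong_iff_dvd_diff)
    then show ?thesis using 2 by (simp add: chi_def Legendre_cong)
  qed
qed

lemma chi_power: "j \<in> J \<Longrightarrow> chi j (a ^ k) = chi j a ^ k"
  by (induction k) (use chi_one in \<open>auto simp: chi_mult\<close>)

text \<open>Chinese remaindering over the moduli \<open>m j\<close>, with 4 at the index 2. Such an
  \<open>a\<close> witnesses that no nonempty product of the characters is principal.\<close>

lemma separating_residue:
  assumes "j0 \<in> J"
  shows "\<exists>a. coprime a (4 * n) \<and> chi j0 a = - 1 \<and> (\<forall>j\<in>J - {j0}. chi j a = 1)"
proof -
  define m where "m = (\<lambda>j::nat. if j = 2 then 4 else j)"
  obtain b where b: "chi j0 b = - 1"
  proof (cases "j0 = 2")
    case True
    then have "chi j0 3 = - 1" by (simp add: chi_def chi4_mod)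
    then show ?thesis using that by blast
  next
    case False
    then have "prime j0" "j0 > 2" using J_cases[OF assms] by auto
    then show ?thesis using nonresidue_exists False that by (auto simp: chi_def)
  qed
  have cong: "chi j x = chi j y" if "[x = y] (mod (m j))" "j \<in> J" for x y j
  proof (cases "j = 2")
    case True
    then show ?thesis using that by (simp add: chi_def chi4_mod m_def cong_def)
  next
    case False
    then show ?thesis using that by (simp add: chi_def m_def Legendre_cong cong_int_iff)
  qed
  have "\<forall>i\<in>J. \<forall>j\<in>J. i \<noteq> j \<longrightarrow> coprime (m i) (m j)"
  proof (intro ballI impI)
    fix i j assume ij: "i \<in> J" "j \<in> J" "i \<noteq> j"
    then have "coprime i j" using J_prime by (simp add: primes_coprime)
    moreover have c4: "coprime 4 k \<longleftrightarrow> coprime 2 k" for k :: nat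
      using coprime_power_left_iff[of 2 2 k] by simp
    ultimately consider "i = 2" "j \<noteq> 2" "coprime 4 j" | "i \<noteq> 2" "j = 2" "coprime 4 i"
      | "i \<noteq> 2" "j \<noteq> 2" "coprime i j"
      using ij(3) coprime_commute[of i 2] by (cases "i = 2"; cases "j = 2") auto
    then show "coprime (m i) (m j)"
      by cases (auto simp: m_def coprime_commute)
  qed
  from chinese_remainder_nat[OF finite_J this, of "\<lambda>j. if j = j0 then b else 1"] obtain a where
    a: "\<And>j. j \<in> J \<Longrightarrow> [a = (if j = j0 then b else 1)] (mod (m j))" by blast
  have 1: "chi j0 a = - 1" using cong[OF a[OF assms] assms] b by simp
  have 2: "chi j a = 1" if "j \<in> J - {j0}" for j
    using cong[OF a[of j]] that chi_one[of j] by simp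
  have nd: "\<not> j dvd a" if "j \<in> J" for j
    using 1 2[of j] chi_zero[OF that, of a] that by (cases "j = j0") auto
  have "coprime a (4 * n)"
  proof (rule ccontr)
    assume "\<not> coprime a (4 * n)"
    then have "gcd a (4 * n) \<noteq> 1" unfolding coprime_iff_gcd_eq_1 .
    then obtain p where pg: "prime p" "p dvd gcd a (4 * n)" using prime_factor_nat by blast
    have p: "prime p" "p dvd a" "p dvd 4 * n"
      using pg(1) dvd_trans[OF pg(2) gcd_dvd1] dvd_trans[OF pg(2) gcd_dvd2] by blast+
    then have "p dvd 2\<^sup>2 \<or> p dvd n" using prime_dvd_mult_iff[of p "2\<^sup>2" n] by simp
    then have "p \<in> J"
    proof
      assume "p dvd 2\<^sup>2"
      then have "p dvd 2" using p(1) prime_dvd_power by blast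
      then have "p = 2" using p(1) by (simp add: primes_dvd_imp_eq)
      then show ?thesis by (simp add: J_def)
    next
      assume "p dvd n"
      then show ?thesis using p(1) odd_n by (auto simp: J_def in_prime_factors_iff)
    qed
    then show False using nd p(2) by blast
  qed
  then show ?thesis using 1 2 by blast
qed

definition prod_chi :: "nat set \<Rightarrow> nat \<Rightarrow> real" where
  "prod_chi S a = (\<Prod>j\<in>S. of_int (chi j a))"

text \<open>The sum over a period vanishes because multiplication by a separating residue permutes
  the classes modulo \<open>4 * n\<close> and changes the sign of every term.\<close>

lemma prod_chi_character:
  assumes S: "S \<subseteq> J" "S \<noteq> {}"
  shows "real_character (prod_chi S) (4 * n)"
proof
  have fin: "finite S" using S finite_J finite_subset by blast
  show "4 * n > 0" using odd_n by (auto intro: Nat.gr0I)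
  show per: "prod_chi S (m + 4 * n) = prod_chi S m" for m
    unfolding prod_chi_def using S chi_periodic by (intro prod.cong) auto
  show mul: "prod_chi S (a * b) = prod_chi S a * prod_chi S b" for a b
    unfolding prod_chi_def prod.distrib[symmetric] using S by (intro prod.cong) (auto simp: chi_mult)
  show "prod_chi S 1 = 1" unfolding prod_chi_def using S chi_one by (intro prod.neutral) auto
  show "prod_chi S a \<in> {-1, 0, 1}" for a
    unfolding prod_chi_def using fin
  proof (induction S rule: finite_induct)
    case (insert j S)
    then show ?case using chi_vals[of j a] by auto
  qed simp
  show "(\<Sum>m<4 * n. prod_chi S m) = 0"
  proof -
    obtain j0 where j0: "j0 \<in> S" using S by blast
    obtain a where a: "coprime a (4 * n)" "chi j0 a = - 1" "\<forall>j\<in>J - {j0}. chi j a = 1"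
      using separating_residue[of j0] j0 S by blast
    have "prod_chi S a = of_int (chi j0 a) * (\<Prod>j\<in>S - {j0}. of_int (chi j a))"
      unfolding prod_chi_def using fin j0 by (rule prod.remove)
    also have "(\<Prod>j\<in>S - {j0}. of_int (chi j a)) = (1 :: real)"
      using a(3) S by (intro prod.neutral) auto
    finally have m1: "prod_chi S a = - 1" using a(2) by simp
    have red: "prod_chi S (x mod (4 * n)) = prod_chi S x" for x
    proof -
      have "prod_chi S (y + k * (4 * n)) = prod_chi S y" for y k
        by (induction k) (use per in \<open>simp_all add: add.assoc[symmetric] add.commute[of "4 * n"]\<close>)
      then show ?thesis by (metis mod_div_mult_eq)
    qed
    define h where "h = (\<lambda>m. (a * m) mod (4 * n))"
    have inj: "inj_on h {..<4 * n}"
    proof (rule inj_onI)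
      fix x y assume xy: "x \<in> {..<4 * n}" "y \<in> {..<4 * n}" "h x = h y"
      then have "[a * x = a * y] (mod (4 * n))" by (simp add: h_def cong_def)
      then have "[x = y] (mod (4 * n))" using a(1) cong_mult_lcancel_nat by blast
      then show "x = y" using xy by (simp add: cong_def)
    qed
    have "h ` {..<4 * n} = {..<4 * n}"
      using inj odd_n by (intro endo_inj_surj) (auto simp: h_def intro!: mod_less_divisor Nat.gr0I)
    then have "(\<Sum>m<4 * n. prod_chi S m) = (\<Sum>m<4 * n. prod_chi S (h m))"
      using sum.reindex[OF inj, of "prod_chi S"] by (simp add: o_def)
    also have "\<dots> = - (\<Sum>m<4 * n. prod_chi S m)"
      unfolding h_def red mul m1 by (simp add: sum_negf)
    finally show ?thesis by simp
  qed
qed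

lemma prime_power_log_sum:
  assumes p: "prime p"
  shows "(\<Sum>k = 1..x. vM (p ^ k) / real (p ^ k)) \<le> ln (real p)"
proof -
  have p2: "real p \<ge> 2" using prime_ge_2_nat[OF p] by simp
  have "(\<Sum>k = 1..x. vM (p ^ k) / real (p ^ k)) \<le> (\<Sum>k = 1..x. ln (real p) * (1 / 2) ^ k)"
  proof (intro sum_mono)
    fix k assume k: "k \<in> {1..x}"
    have "1 / real p ^ k \<le> 1 / 2 ^ k"
      using p2 by (intro divide_left_mono power_mono) auto
    then have "ln (real p) * (1 / real p ^ k) \<le> ln (real p) * (1 / 2 ^ k)"
      using p2 by (intro mult_left_mono) auto
    then show "vM (p ^ k) / real (p ^ k) \<le> ln (real p) * (1 / 2) ^ k"
      using k p by (simp add: power_one_over)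
  qed
  also have "\<dots> = ln (real p) * (1 - (1 / 2) ^ x)"
  proof -
    have "(\<Sum>k = 1..x. (1 / 2 :: real) ^ k) = 1 - (1 / 2) ^ x" by (induction x) auto
    then show ?thesis by (simp add: sum_distrib_left[symmetric])
  qed
  also have "\<dots> \<le> ln (real p) * 1" using p2 by (intro mult_left_mono) auto
  finally show ?thesis by simp
qed

text \<open>If no prime had the prescribed symbols, the nonnegative weight W would vanish at all
  prime powers except those of primes in \<open>J\<close>, and the sum of
  \<open>vM d * W d / d\<close> would be bounded. Expanding W into characters shows that this sum
  differs from the divergent sum of \<open>vM d / d\<close> by a bounded amount.\<close>

theorem prime_with_characters:
  assumes c: "\<And>j. j \<in> J \<Longrightarrow> c j \<in> {-1, 1 :: int}" and neg: "j0 \<in> J" "c j0 = - 1"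
  shows "\<exists>q. prime q \<and> (\<forall>j\<in>J. chi j q = c j)"
proof (rule ccontr)
  assume no: "\<not> ?thesis"
  define W where "W = (\<lambda>d. \<Prod>j\<in>J. 1 + real_of_int (c j * chi j d))"
  have factor: "0 \<le> 1 + real_of_int (c j * chi j d)" "1 + real_of_int (c j * chi j d) \<le> 2" if "j \<in> J" for j d
    using c[OF that] chi_vals[of j d] by auto
  have W0: "0 \<le> W d" for d unfolding W_def using factor by (intro prod_nonneg) auto
  have W2: "W d \<le> 2 ^ card J" for d
  proof -
    have "W d \<le> (\<Prod>j\<in>J. 2)" unfolding W_def using factor by (intro prod_mono) auto
    then show ?thesis by simp
  qed
  have support: "\<exists>p k. d = p ^ k \<and> p \<in> J \<and> k \<ge> 1" if d: "vM d * W d \<noteq> 0" for d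
  proof -
    have "primepow d" using d by (auto simp: mangoldt_def split: if_splits)
    then obtain p k where pk: "prime p" "k > 0" "d = p ^ k" by (auto simp: primepow_def)
    have "p \<in> J"
    proof (rule ccontr)
      assume pJ: "p \<notin> J"
      have nz: "chi j p \<noteq> 0" if "j \<in> J" for j
        using chi_zero[OF that, of p] pJ that J_prime[OF that] pk(1) primes_dvd_imp_eq by blast
      have sg: "chi j p = 1 \<or> chi j p = - 1" if "j \<in> J" for j
        using nz[OF that] chi_vals[of j p] by auto
      have eq: "chi j p ^ k = c j" if "j \<in> J" for j
      proof -
        have "W d \<noteq> 0" using d by auto
        then have "1 + real_of_int (c j * chi j d) \<noteq> 0"
          unfolding W_def using that finite_J by (auto simp: prod_zero_iff)
        then have "c j * chi j d \<noteq> - 1" by (metis add.right_inverse of_int_1 of_int_minus)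
        moreover have "chi j d = chi j p ^ k" using that by (simp add: pk(3) chi_power)
        moreover have "chi j p ^ k = 1 \<or> chi j p ^ k = - 1"
          using sg[OF that] by (cases "even k") auto
        ultimately show ?thesis using c[OF that] by auto
      qed
      \<comment> \<open>This is the purpose of a prescribed -1: an even power of p has all its
        symbols equal to 1 and tells nothing about p, whereas an odd power has the same symbols as
        p.\<close>
      have "odd k" using eq[OF neg(1)] neg(2) sg[OF neg(1)] by (cases "even k") auto
      then have "chi j p = c j" if "j \<in> J" for j using eq[OF that] sg[OF that] by auto
      then show False using no pk(1) by blast
    qed
    then show ?thesis using pk by (intro exI[of _ p] exI[of _ k]) auto
  qed
  have upper: "(\<Sum>d = 1..x. vM d / real d * W d) \<le> 2 ^ card J * (\<Sum>p\<in>J. ln (real p))" for x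
  proof -
    define g where "g = (\<lambda>d. vM d / real d * W d)"
    have g0: "g d \<ge> 0" for d using W0 mangoldt_nonneg by (simp add: g_def)
    define D where "D = {d \<in> {1..x}. g d \<noteq> 0}"
    have sub: "D \<subseteq> (\<lambda>(p, k). p ^ k) ` (J \<times> {1..x})"
    proof
      fix d assume d: "d \<in> D"
      then have "vM d * W d \<noteq> 0" by (auto simp: D_def g_def)
      then obtain p k where pk: "d = p ^ k" "p \<in> J" "k \<ge> 1" using support by blast
      have "k < p ^ k" using J_prime[OF pk(2)] prime_gt_1_nat by (simp add: power_gt_expt)
      then have "k \<le> x" using d pk(1) by (auto simp: D_def)
      then show "d \<in> (\<lambda>(p, k). p ^ k) ` (J \<times> {1..x})" using pk by auto
    qed
    have "(\<Sum>d = 1..x. g d) = sum g D"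
      unfolding D_def by (intro sum.mono_neutral_right) auto
    also have "\<dots> \<le> sum g ((\<lambda>(p, k). p ^ k) ` (J \<times> {1..x}))"
      using sub g0 finite_J by (intro sum_mono2) auto
    also have "\<dots> \<le> sum (g \<circ> (\<lambda>(p, k). p ^ k)) (J \<times> {1..x})"
      using g0 finite_J by (intro sum_image_le) auto
    also have "\<dots> = (\<Sum>p\<in>J. \<Sum>k = 1..x. g (p ^ k))"
      by (simp add: sum.cartesian_product case_prod_unfold)
    also have "\<dots> \<le> (\<Sum>p\<in>J. 2 ^ card J * ln (real p))"
    proof (intro sum_mono)
      fix p assume p: "p \<in> J"
      have "(\<Sum>k = 1..x. g (p ^ k)) \<le> (\<Sum>k = 1..x. vM (p ^ k) / real (p ^ k) * 2 ^ card J)"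
        unfolding g_def using W2 by (intro sum_mono mult_left_mono) (auto simp: mangoldt_nonneg)
      also have "\<dots> = (\<Sum>k = 1..x. vM (p ^ k) / real (p ^ k)) * 2 ^ card J"
        by (rule sum_distrib_right[symmetric])
      also have "\<dots> \<le> ln (real p) * 2 ^ card J"
        using prime_power_log_sum[OF J_prime[OF p]] by (intro mult_right_mono) auto
      finally show "(\<Sum>k = 1..x. g (p ^ k)) \<le> 2 ^ card J * ln (real p)" by (simp add: mult.commute)
    qed
    finally show ?thesis by (simp add: g_def sum_distrib_left)
  qed
  have "\<exists>B. \<forall>x. \<bar>\<Sum>d = 1..x. vM d * prod_chi S d / real d\<bar> \<le> B" if "S \<in> Pow J - {{}}" for S
    using real_character.mangoldt_character_bound[OF prod_chi_character] that by auto
  then obtain B where B: "\<And>S x. S \<in> Pow J - {{}} \<Longrightarrow> \<bar>\<Sum>d = 1..x. vM d * prod_chi S d / real d\<bar> \<le> B S"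
    by metis
  define cc where "cc = (\<lambda>S. \<Prod>j\<in>S. real_of_int (c j))"
  have cc: "\<bar>cc S\<bar> \<le> 1" if "S \<subseteq> J" for S
  proof -
    have "\<bar>cc S\<bar> = (\<Prod>j\<in>S. \<bar>real_of_int (c j)\<bar>)" by (simp add: cc_def abs_prod)
    also have "\<dots> \<le> (\<Prod>j\<in>S. 1)" using c that by (intro prod_mono) fastforce
    finally show ?thesis by simp
  qed
  have Wexp: "W d = (\<Sum>S\<in>Pow J. cc S * prod_chi S d)" for d
  proof -
    have "W d = (\<Prod>j\<in>J. real_of_int (c j * chi j d) + 1)" by (simp add: W_def add.commute)
    also have "\<dots> = (\<Sum>S\<in>Pow J. (\<Prod>j\<in>S. real_of_int (c j * chi j d)) * (\<Prod>j\<in>J - S. 1))"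
      by (rule prod_add[OF finite_J])
    finally show ?thesis by (simp add: cc_def prod_chi_def prod.distrib)
  qed
  have lower: "(\<Sum>d = 1..x. vM d / real d * W d) \<ge> (\<Sum>d = 1..x. vM d / real d) - (\<Sum>S\<in>Pow J - {{}}. B S)" for x
  proof -
    have "(\<Sum>d = 1..x. vM d / real d * W d) = (\<Sum>S\<in>Pow J. cc S * (\<Sum>d = 1..x. vM d * prod_chi S d / real d))"
      unfolding Wexp sum_distrib_left by (subst sum.swap) (simp add: mult_ac)
    \<comment> \<open>The empty subset carries the divergent part; all other subsets give
      nonprincipal characters.\<close>
    also have "\<dots> = cc {} * (\<Sum>d = 1..x. vM d * prod_chi {} d / real d)
        + (\<Sum>S\<in>Pow J - {{}}. cc S * (\<Sum>d = 1..x. vM d * prod_chi S d / real d))"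
      using finite_J by (intro sum.remove) auto
    finally have eq: "(\<Sum>d = 1..x. vM d / real d * W d) = (\<Sum>d = 1..x. vM d / real d)
        + (\<Sum>S\<in>Pow J - {{}}. cc S * (\<Sum>d = 1..x. vM d * prod_chi S d / real d))"
      by (simp add: cc_def prod_chi_def)
    have "\<bar>\<Sum>S\<in>Pow J - {{}}. cc S * (\<Sum>d = 1..x. vM d * prod_chi S d / real d)\<bar> \<le> (\<Sum>S\<in>Pow J - {{}}. B S)"
    proof (intro order_trans[OF sum_abs sum_mono])
      fix S assume S: "S \<in> Pow J - {{}}"
      have "\<bar>cc S\<bar> * \<bar>\<Sum>d = 1..x. vM d * prod_chi S d / real d\<bar> \<le> 1 * B S"
        using cc[of S] S B[OF S, of x] by (intro mult_mono) auto
      then show "\<bar>cc S * (\<Sum>d = 1..x. vM d * prod_chi S d / real d)\<bar> \<le> B S" by (simp add: abs_mult)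
    qed
    then show ?thesis unfolding eq by linarith
  qed
  define K where "K = 2 ^ card J * (\<Sum>p\<in>J. ln (real p)) + (\<Sum>S\<in>Pow J - {{}}. B S) + 1"
  have "ln (real x) \<le> K" if "x \<ge> 1" for x
    using mangoldt_sum_ge[OF that] lower[of x] upper[of x] by (simp add: K_def)
  moreover obtain x where x: "exp (K + 1) < real x" using reals_Archimedean2 by blast
  moreover have "x \<ge> 1" using x exp_gt_zero[of "K + 1"] by (cases x) auto
  moreover have "K + 1 < ln (real x)"
    using x \<open>x \<ge> 1\<close> by (metis exp_gt_zero ln_exp ln_less_cancel_iff order_less_trans)
  ultimately show False by fastforce
qed

end

section \<open>Sums of three squares for integers congruent to 1 modulo 4\<close>

lemma Legendre_eq_chi4:
  assumes q: "prime q" "q > 2" and s: "s > 0" "odd s"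
    and p: "\<And>p. prime p \<Longrightarrow> p dvd s \<Longrightarrow> Legendre (int p) (int q) = chi4 p"
  shows "Legendre (int s) (int q) = chi4 s"
  using s p
proof (induction s rule: prime_divisors_induct)
  case (unit x)
  then show ?case using Legendre_one[OF q(1)] by (simp add: chi4_def)
next
  case (factor p m)
  have "Legendre (int m) (int q) = chi4 m"
    using factor.prems by (intro factor.IH) (auto intro: Nat.gr0I)
  moreover have "Legendre (int p) (int q) = chi4 p"
    using factor.prems(3)[of p] factor.hyps by simp
  ultimately show ?case by (simp add: Legendre_mult[OF q] chi4_mult)
qed simp

text \<open>After an odd square is split off, s is squarefree and 1 modulo 4. If all its primes are
  1 modulo 4, then -1 is a square modulo s and s is a sum of two rational squares. Otherwise there
  is a prime q, 1 modulo 4, whose Legendre symbol at each p dividing s is \<open>chi4 p\<close>.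
  Then -q is a square modulo s, reciprocity makes s a square modulo q, and s w^2 = x^2 + q y^2 is
  solvable, where q itself is a sum of two rational squares.\<close>

theorem three_squares_mod4:
  fixes n :: nat
  assumes n: "n mod 4 = 1"
  shows "\<exists>a b c :: int. int n = a\<^sup>2 + b\<^sup>2 + c\<^sup>2"
proof -
  define s t where "s = squarefree_part n" and "t = square_part n"
  have st: "n = s * t\<^sup>2" unfolding s_def t_def by (rule squarefree_decompose)
  have sf: "squarefree s" by (simp add: s_def)
  have "odd n" using n by presburger
  then have odd: "odd s" "odd t" using st by auto
  have s0: "s > 0" using odd by (auto intro: Nat.gr0I)
  have s4: "s mod 4 = 1"
  proof -
    obtain k where k: "t = 2 * k + 1" using odd(2) oddE by blast
    have "t\<^sup>2 = 4 * (k\<^sup>2 + k) + 1" by (simp add: k power2_eq_square algebra_simps)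
    then have "n = s + 4 * (s * (k\<^sup>2 + k))" using st by (simp add: algebra_simps)
    then have "n mod 4 = s mod 4" by simp
    then show ?thesis using n by simp
  qed
  have "\<exists>a b c :: int. int s = a\<^sup>2 + b\<^sup>2 + c\<^sup>2"
  proof (cases "s = 1")
    case True
    then show ?thesis by (intro exI[of _ 1] exI[of _ 0]) simp
  next
    case s1: False
    have nonsq: "m\<^sup>2 \<noteq> s" for m
    proof
      assume "m\<^sup>2 = s"
      then have "m dvd 1" using sf by (metis squarefreeD dvd_refl)
      then show False using \<open>m\<^sup>2 = s\<close> s1 by simp
    qed
    have odd_prime: "p > 2" if "prime p" "p dvd s" for p
    proof -
      have "p \<noteq> 2" using that odd(1) by auto
      then show ?thesis using prime_ge_2_nat[OF that(1)] by simp
    qed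
    show ?thesis
    proof (cases "\<forall>p. prime p \<longrightarrow> p dvd s \<longrightarrow> p mod 4 = 1")
      case True
      have "QuadRes (int s) (- 1)"
      proof (rule sqrt_mod_squarefree[OF sf])
        fix p assume p: "prime p" "p dvd s"
        then have "Legendre (- 1) (int p) = 1"
          using True Legendre_minus_one[OF p(1) odd_prime[OF p]] by (simp add: chi4_mod)
        then show "QuadRes (int p) (- 1)" by (simp add: Legendre_def split: if_splits)
      qed
      then obtain \<alpha> where "[\<alpha>\<^sup>2 = - int 1] (mod int s)" by (auto simp: QuadRes_def)
      \<comment> \<open>For the form x^2 + y^2 the second modulus is 1, so 0 serves as
        \<open>\<beta>\<close>.\<close>
      then obtain x y w where w: "w > 0" "int s * w\<^sup>2 = x\<^sup>2 + int 1 * y\<^sup>2"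
        using legendre_ternary[OF s0 nonsq, of 1 \<alpha> 0] by auto
      then show ?thesis using three_rational_squares_imp_three_squares[of w "int s" x y 0] by simp
    next
      case False
      interpret odd_modulus s by unfold_locales (rule odd(1))
      obtain p0 where p0: "prime p0" "p0 dvd s" "p0 mod 4 \<noteq> 1" using False by blast
      then have p03: "p0 mod 4 = 3" using odd_prime_mod4[OF p0(1) odd_prime[OF p0(1,2)]] by simp
      have inJ: "p \<in> J" if "prime p" "p dvd s" for p
        using that s0 by (simp add: J_def in_prime_factors_iff)
      \<comment> \<open>The value 1 at index 2 makes q congruent to 1 modulo 4, and
        \<open>chi4 j\<close> at j makes -q a residue. The prime \<open>p0\<close> supplies the
        value -1 that \<open>prime_with_characters\<close> demands, hence the case
        distinction.\<close>
      define c where "c = (\<lambda>j. if j = 2 then 1 else chi4 j)"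
      have "\<exists>q. prime q \<and> (\<forall>j\<in>J. chi j q = c j)"
      proof (rule prime_with_characters)
        show "c j \<in> {-1, 1}" if "j \<in> J" for j
          using J_cases[OF that] odd_prime_mod4[of j] by (auto simp: c_def chi4_mod)
        show "p0 \<in> J" using inJ p0 by simp
        show "c p0 = - 1" using p03 odd_prime[OF p0(1,2)] by (simp add: c_def chi4_mod)
      qed
      then obtain q where q: "prime q" "\<And>j. j \<in> J \<Longrightarrow> chi j q = c j" by blast
      have "chi 2 q = 1" using q(2)[of 2] by (simp add: J_def c_def)
      then have q4: "q mod 4 = 1" by (simp add: chi_def chi4_mod split: if_splits)
      have q2: "q > 2"
      proof -
        have "q \<noteq> 2" using q4 by auto
        then show ?thesis using prime_ge_2_nat[OF q(1)] by simp
      qed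
      have Lq: "Legendre (int q) (int p) = chi4 p" if "prime p" "p dvd s" for p
        using q(2)[OF inJ[OF that]] odd_prime[OF that] by (simp add: chi_def c_def)
      have nz: "chi4 p \<noteq> 0" if "prime p" "p dvd s" for p
        using odd_prime_mod4[OF that(1) odd_prime[OF that]] by (auto simp: chi4_mod)
      have pq: "p \<noteq> q" if "prime p" "p dvd s" for p
        using Lq[OF that] nz[OF that] by (auto simp: Legendre_def cong_def split: if_splits)
      have "QuadRes (int s) (- int q)"
      proof (rule sqrt_mod_squarefree[OF sf])
        fix p assume p: "prime p" "p dvd s"
        have "Legendre (- 1 * int q) (int p) = chi4 p * chi4 p"
          unfolding Legendre_mult[OF p(1) odd_prime[OF p]] Lq[OF p]
            Legendre_minus_one[OF p(1) odd_prime[OF p]] ..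
        also have "\<dots> = 1" using nz[OF p] by (simp add: chi4_def split: if_splits)
        finally show "QuadRes (int p) (- int q)" by (simp add: Legendre_def split: if_splits)
      qed
      then obtain \<alpha> where \<alpha>: "[\<alpha>\<^sup>2 = - int q] (mod int s)" by (auto simp: QuadRes_def)
      have "Legendre (int s) (int q) = chi4 s"
      proof (rule Legendre_eq_chi4[OF q(1) q2 s0 odd(1)])
        fix p assume p: "prime p" "p dvd s"
        have "Legendre (int p) (int q) * Legendre (int q) (int p) = (- 1) ^ ((p - 1) div 2 * ((q - 1) div 2))"
          by (rule Quadratic_Reciprocity[OF p(1) odd_prime[OF p] q(1) q2 pq[OF p]])
        moreover have "even ((q - 1) div 2)" using q4 by presburger
        ultimately have "Legendre (int p) (int q) * chi4 p = 1" using Lq[OF p] by simp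
        then show "Legendre (int p) (int q) = chi4 p"
          by (auto simp: chi4_def split: if_splits)
      qed
      also have "chi4 s = 1" using s4 by (simp add: chi4_mod)
      finally obtain \<beta> where \<beta>: "[\<beta>\<^sup>2 = int s] (mod int q)"
        by (auto simp: Legendre_def QuadRes_def split: if_splits)
      have cop: "coprime s q"
      proof -
        have "\<not> q dvd s" using pq q(1) by blast
        then have "coprime q s" using q(1) by (intro prime_imp_coprime)
        then show ?thesis by (simp add: coprime_commute)
      qed
      obtain x y w where w: "w > 0" "int s * w\<^sup>2 = x\<^sup>2 + int q * y\<^sup>2"
        using legendre_ternary[OF s0 nonsq prime_gt_0_nat[OF q(1)] cop \<alpha> \<beta>] by blast
      have "Legendre (- 1) (int q) = 1" using Legendre_minus_one[OF q(1) q2] q4 by (simp add: chi4_mod)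
      then obtain \<gamma> where \<gamma>: "[\<gamma>\<^sup>2 = - int 1] (mod int q)"
        by (auto simp: Legendre_def QuadRes_def split: if_splits)
      have qsq: "m\<^sup>2 \<noteq> q" for m
      proof
        assume m: "m\<^sup>2 = q"
        then have "m dvd q" by (auto simp: power2_eq_square)
        then have "m = 1 \<or> m = q" using q(1) by (simp add: prime_nat_iff)
        then show False using m q2 by (auto simp: power2_eq_square)
      qed
      obtain a b v where v: "v > 0" "int q * v\<^sup>2 = a\<^sup>2 + int 1 * b\<^sup>2"
        using legendre_ternary[OF prime_gt_0_nat[OF q(1)] qsq, of 1 \<gamma> 0] \<gamma> by auto
      have "int s * (w * v)\<^sup>2 = (x * v)\<^sup>2 + (int q * v\<^sup>2) * y\<^sup>2"
      proof -
        have "int s * (w * v)\<^sup>2 = (int s * w\<^sup>2) * v\<^sup>2" by (simp add: power_mult_distrib)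
        then show ?thesis unfolding w(2) by (simp add: power_mult_distrib algebra_simps)
      qed
      also have "\<dots> = (x * v)\<^sup>2 + (a * y)\<^sup>2 + (b * y)\<^sup>2"
        unfolding v(2) by (simp add: power_mult_distrib algebra_simps)
      finally show ?thesis
        using three_rational_squares_imp_three_squares[of "w * v" "int s"] w(1) v(1) by simp
    qed
  qed
  then obtain a b c :: int where "int s = a\<^sup>2 + b\<^sup>2 + c\<^sup>2" by blast
  then have "int n = (a * int t)\<^sup>2 + (b * int t)\<^sup>2 + (c * int t)\<^sup>2"
    by (simp add: st power_mult_distrib algebra_simps)
  then show ?thesis by blast
qed

section \<open>The conjugated Laplacian in the phase variables\<close>

abbreviation "pd1 \<equiv> dir_deriv (1::real, 0::real, 0::real)"
abbreviation "pd2 \<equiv> dir_deriv (0::real, 1::real, 0::real)"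
abbreviation "pd3 \<equiv> dir_deriv (0::real, 0::real, 1::real)"

lemma dir_deriv_line:
  fixes f :: "'a::euclidean_space \<Rightarrow> real"
  assumes "f differentiable (at v)" "((\<lambda>s. f (v + s *\<^sub>R e)) has_real_derivative d) (at 0)"
  shows "dir_deriv e f v = d"
proof -
  have "((\<lambda>s. v + s *\<^sub>R e) has_derivative (\<lambda>s. s *\<^sub>R e)) (at 0)"
    by (auto intro!: derivative_eq_intros)
  moreover have "(f has_derivative (\<lambda>e. dir_deriv e f v)) (at (v + 0 *\<^sub>R e))"
    using has_derivative_dir_deriv[OF assms(1)] by simp
  ultimately have "((\<lambda>s. f (v + s *\<^sub>R e)) has_derivative (\<lambda>s. dir_deriv (s *\<^sub>R e) f v)) (at 0)"
    using has_derivative_compose[of "\<lambda>s. v + s *\<^sub>R e" "\<lambda>s. s *\<^sub>R e" 0 UNIV f "\<lambda>e. dir_deriv e f v"]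
    by simp
  moreover have "((\<lambda>s. f (v + s *\<^sub>R e)) has_derivative (\<lambda>s. d * s)) (at 0)"
    using assms(2) by (simp add: has_field_derivative_def)
  ultimately have "(\<lambda>s. dir_deriv (s *\<^sub>R e) f v) = (\<lambda>s. d * s)"
    by (rule has_derivative_unique)
  from fun_cong[OF this, of 1] show ?thesis by simp
qed

lemma partial1I:
  assumes "f differentiable (at (t, x, z))" "((\<lambda>s. f (s, x, z)) has_real_derivative d) (at t)"
  shows "pd1 f (t, x, z) = d"
proof (rule dir_deriv_line[OF assms(1)])
  have "((\<lambda>s. f (s + t, x, z)) has_real_derivative d) (at 0)"
    using assms(2) DERIV_shift[of "\<lambda>s. f (s, x, z)" d 0 t] by simp
  then show "((\<lambda>s. f ((t, x, z) + s *\<^sub>R (1, 0, 0))) has_real_derivative d) (at 0)"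
    by (simp add: add.commute)
qed

lemma partial2I:
  assumes "f differentiable (at (t, x, z))" "((\<lambda>s. f (t, s, z)) has_real_derivative d) (at x)"
  shows "pd2 f (t, x, z) = d"
proof (rule dir_deriv_line[OF assms(1)])
  have "((\<lambda>s. f (t, s + x, z)) has_real_derivative d) (at 0)"
    using assms(2) DERIV_shift[of "\<lambda>s. f (t, s, z)" d 0 x] by simp
  then show "((\<lambda>s. f ((t, x, z) + s *\<^sub>R (0, 1, 0))) has_real_derivative d) (at 0)"
    by (simp add: add.commute)
qed

lemma partial3I:
  assumes "f differentiable (at (t, x, z))" "((\<lambda>s. f (t, x, s)) has_real_derivative d) (at z)"
  shows "pd3 f (t, x, z) = d"
proof (rule dir_deriv_line[OF assms(1)])
  have "((\<lambda>s. f (t, x, s + z)) has_real_derivative d) (at 0)"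
    using assms(2) DERIV_shift[of "\<lambda>s. f (t, x, s)" d 0 z] by simp
  then show "((\<lambda>s. f ((t, x, z) + s *\<^sub>R (0, 0, 1))) has_real_derivative d) (at 0)"
    by (simp add: add.commute)
qed

text \<open>With \<open>t\<close> the rescaled axial variable and \<open>x = k \<cdot> y\<close>, \<open>z = k' \<cdot> y\<close>, where \<open>la = |k|\<^sup>2\<close>, \<open>la + 4 = |k'|\<^sup>2\<close>, \<open>ka = k \<cdot> k'\<close>,
  the Laplacian conjugated by \<open>exp(-\<surd>la w)\<close> is \<open>la + block_op\<close> for axial scale \<open>\<surd>la/h\<close>; \<open>block_form\<close> is the
  corresponding gradient form.\<close>

definition block_op :: "real \<Rightarrow> real \<Rightarrow> real \<Rightarrow> (real \<times> real \<times> real \<Rightarrow> real) \<Rightarrow> real \<times> real \<times> real \<Rightarrow> real" where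
  "block_op h la ka f v = h\<^sup>2 / la * pd1 (pd1 f) v - 2 * h * pd1 f v + la * pd2 (pd2 f) v
     + ka * (pd2 (pd3 f) v + pd3 (pd2 f) v) + (la + 4) * pd3 (pd3 f) v"

definition block_form ::
  "real \<Rightarrow> real \<Rightarrow> real \<Rightarrow> (real \<times> real \<times> real \<Rightarrow> real) \<Rightarrow> (real \<times> real \<times> real \<Rightarrow> real) \<Rightarrow> real \<times> real \<times> real \<Rightarrow> real" where
  "block_form h la ka f g v = h\<^sup>2 / la * (pd1 f v * pd1 g v) + la * (pd2 f v * pd2 g v)
     + ka * (pd2 f v * pd3 g v + pd3 f v * pd2 g v) + (la + 4) * (pd3 f v * pd3 g v)"

lemma dir_deriv_mult_fun:
  assumes "Ck (Suc k) f" "Ck (Suc k) g"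
  shows "dir_deriv e (\<lambda>v. f v * g v) = (\<lambda>v. f v * dir_deriv e g v + dir_deriv e f v * g v)"
  by (rule ext) (rule dir_deriv_mult[OF assms[THEN Ck_differentiable]])

lemma dir_deriv_add_fun:
  assumes "Ck (Suc k) f" "Ck (Suc k) g"
  shows "dir_deriv e (\<lambda>v. f v + g v) = (\<lambda>v. dir_deriv e f v + dir_deriv e g v)"
  by (rule ext) (rule dir_deriv_add[OF assms[THEN Ck_differentiable]])

lemma dir_deriv2_mult:
  assumes "Ck (Suc (Suc 0)) f" "Ck (Suc (Suc 0)) g"
  shows "dir_deriv d (dir_deriv e (\<lambda>v. f v * g v)) v = f v * dir_deriv d (dir_deriv e g) v
     + dir_deriv d f v * dir_deriv e g v + dir_deriv e f v * dir_deriv d g v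
     + dir_deriv d (dir_deriv e f) v * g v"
proof -
  have D: "Ck (Suc 0) (dir_deriv e f)" "Ck (Suc 0) (dir_deriv e g)" "Ck (Suc 0) f" "Ck (Suc 0) g"
    using assms Ck.simps(2)[of "Suc 0"] Ck_Suc_imp by blast+
  show ?thesis
    unfolding dir_deriv_mult_fun[OF assms]
      dir_deriv_add_fun[OF Ck_mult[OF D(3,2)] Ck_mult[OF D(1,4)]]
      dir_deriv_mult_fun[OF D(3,2)] dir_deriv_mult_fun[OF D(1,4)] by simp
qed

lemma dir_deriv2_add:
  assumes "Ck (Suc (Suc 0)) f" "Ck (Suc (Suc 0)) g"
  shows "dir_deriv d (dir_deriv e (\<lambda>v. f v + g v)) v = dir_deriv d (dir_deriv e f) v + dir_deriv d (dir_deriv e g) v"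
proof -
  have D: "Ck (Suc 0) (dir_deriv e f)" "Ck (Suc 0) (dir_deriv e g)"
    using assms by (auto simp del: Ck.simps simp: Ck.simps(2)[of "Suc 0"])
  show ?thesis
    unfolding dir_deriv_add_fun[OF assms] dir_deriv_add_fun[OF D] ..
qed

lemma block_op_mult:
  assumes "Ck (Suc (Suc 0)) f" "Ck (Suc (Suc 0)) g"
  shows "block_op h la ka (\<lambda>v. f v * g v) v
    = f v * block_op h la ka g v + g v * block_op h la ka f v + 2 * block_form h la ka f g v"
  unfolding block_op_def block_form_def dir_deriv2_mult[OF assms]
  unfolding dir_deriv_mult_fun[OF assms] by (simp add: algebra_simps)

lemma block_op_add:
  assumes "Ck (Suc (Suc 0)) f" "Ck (Suc (Suc 0)) g"
  shows "block_op h la ka (\<lambda>v. f v + g v) v = block_op h la ka f v + block_op h la ka g v"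
  unfolding block_op_def dir_deriv2_add[OF assms]
  unfolding dir_deriv_add_fun[OF assms]
  by (simp add: algebra_simps)

lemma block_op_const [simp]: "block_op h la ka (\<lambda>v. c) v = 0"
  by (simp add: block_op_def)

lemma block_form_const [simp]: "block_form h la ka (\<lambda>v. c) f v = 0"
  by (simp add: block_form_def)

lemma block_op_scale:
  assumes "Ck (Suc (Suc 0)) f"
  shows "block_op h la ka (\<lambda>v. c * f v) v = c * block_op h la ka f v"
  using block_op_mult[OF Ck_const assms, of h la ka c v] by simp

lemma block_form_square:
  assumes "Ck (Suc (Suc 0)) f" "Ck (Suc (Suc 0)) g"
  shows "block_form h la ka f (\<lambda>v. g v * g v) v = 2 * g v * block_form h la ka f g v"
  unfolding block_form_def dir_deriv_mult_fun[OF assms(2,2)] by (simp add: algebra_simps)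

text \<open>After a third of la (a^2 + b^2) is removed, completing the square leaves a nonnegative
  form, by the bound on the angle. This ellipticity is uniform in la and keeps \<open>denom\<close>
  positive away from the critical set.\<close>

lemma block_form_ge:
  assumes "la > 0" "ka\<^sup>2 \<le> la * (la + 4) / 3"
  shows "block_form h la ka f f v / la \<ge> ((pd2 f v)\<^sup>2 + (pd3 f v)\<^sup>2) / 3"
proof -
  define a b where "a = pd2 f v" and "b = pd3 f v"
  have "0 \<le> (2 * la * a + 3 * ka * b)\<^sup>2" by simp
  then have "- 12 * la * ka * a * b \<le> 4 * la\<^sup>2 * a\<^sup>2 + 9 * ka\<^sup>2 * b\<^sup>2"
    by (simp add: power2_eq_square algebra_simps)
  also have "9 * ka\<^sup>2 * b\<^sup>2 \<le> 9 * (la * (la + 4) / 3) * b\<^sup>2"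
    by (intro mult_right_mono mult_left_mono assms) auto
  finally have "la * (- 12 * ka * a * b) \<le> la * (4 * la * a\<^sup>2 + 3 * (la + 4) * b\<^sup>2)"
    by (simp add: power2_eq_square algebra_simps add_divide_distrib)
  then have "- 12 * ka * a * b \<le> 4 * la * a\<^sup>2 + 3 * (la + 4) * b\<^sup>2"
    using mult_left_le_imp_le assms(1) by blast
  then have A: "- 12 * (ka * a * b) \<le> 4 * (la * a\<^sup>2) + 3 * (la * b\<^sup>2) + 12 * b\<^sup>2"
    by (simp add: algebra_simps)
  define T where "T = h\<^sup>2 / la * (pd1 f v * pd1 f v)"
  have B: "block_form h la ka f f v = T + la * a\<^sup>2 + 2 * (ka * a * b) + (la * b\<^sup>2 + 4 * b\<^sup>2)"
    unfolding block_form_def a_def[symmetric] b_def[symmetric] T_def[symmetric]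
    by (simp add: power2_eq_square algebra_simps)
  have C: "0 \<le> la * a\<^sup>2" "0 \<le> la * b\<^sup>2" "0 \<le> b\<^sup>2" "0 \<le> T" using assms(1) by (auto simp: T_def)
  have "la * (a\<^sup>2 + b\<^sup>2) = la * a\<^sup>2 + la * b\<^sup>2" by (rule distrib_left)
  then have "la * (a\<^sup>2 + b\<^sup>2) / 3 \<le> block_form h la ka f f v"
    using A B C by linarith
  then show ?thesis using assms(1) by (simp add: a_def b_def field_simps)
qed

section \<open>Passing from one frequency to the next\<close>

text \<open>One block in the rescaled axial variable. The phases are unrestricted, as they enter
  only through periodic functions.\<close>

definition slab :: "(real \<times> real \<times> real) set" where
  "slab = {v. \<bar>fst v\<bar> \<le> 5}"

lemma lbd_fst: "lbd I slab k (\<lambda>i. fst)"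
  by (rule lbd_linear) (auto simp: slab_def bounded_linear_fst)

definition ramp :: "real \<Rightarrow> real" where
  "ramp t = t * (1 - smoothstep ((t\<^sup>2 - 4) / 5))"

text \<open>With p = \<open>profile t\<close> and q = \<open>profile (- t)\<close>: p = 1 for t
  \<le> -3 and q = 0 for t \<le> -2, symmetrically on the right, and p / q = exp(-2 t) for |t| \<le>
  1. The two can be equal only for |t| < 1, where \<open>defect_mid\<close> applies.\<close>

definition profile :: "real \<Rightarrow> real" where
  "profile t = exp (- ramp t) * (1 - smoothstep (t - 1))"

text \<open>Turns the stretched phase on while the second coefficient is still zero, leaving an
  unstretched \<open>cos x\<close> for t \<le> -3. It stays on to the right, where the first
  coefficient dies out.\<close>

definition switch :: "real \<Rightarrow> real" where
  "switch t = smoothstep (t + 3)"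

text \<open>Confines the correction to |t| \<le> 4, so that a block begins and ends with a pure
  mode. Where the window is not 1 the defect is already a multiple of the mode, see
  \<open>window_defect\<close>.\<close>

definition window :: "real \<Rightarrow> real" where
  "window t = 1 - smoothstep ((t\<^sup>2 - 9) / 7)"

text \<open>A bump at the multiples of pi, supported where \<open>phase\<close> has slope 1.\<close>

definition peak :: "real \<Rightarrow> real" where
  "peak x = 1 - smoothstep (8 * (sin x)\<^sup>2 - 1)"

text \<open>A smooth function that agrees with \<open>x - \<pi>j\<close> near every \<open>\<pi>j\<close>: the \<open>smoothstep\<close> term vanishes there, and away
  from these points it keeps the denominator positive.\<close>

definition phase :: "real \<Rightarrow> real" where
  "phase x = arctan (sin x * cos x * inverse ((cos x)\<^sup>2 + smoothstep (4 * (sin x)\<^sup>2 - 1)))"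

section \<open>Properties of the cutoffs and profiles\<close>

lemma Ck_ident: "Ck k (\<lambda>x::real. x)"
  by (rule Ck_linear[OF bounded_linear_ident])

lemma Ck_smoothstep_comp: "Ck k f \<Longrightarrow> Ck k (\<lambda>x. smoothstep (f x))"
  by (rule Ck_comp[OF Ck_smoothstep])

lemma Ck_power: "Ck k f \<Longrightarrow> Ck k (\<lambda>x. f x ^ n)"
  by (induction n) (auto intro: Ck_mult Ck_const)

lemma Ck_divide_const: "Ck k f \<Longrightarrow> Ck k (\<lambda>x. f x / c)"
  using Ck_mult[OF _ Ck_const[of k "inverse c"], of f] by (simp add: divide_inverse)

lemmas Ck_intros = Ck_add Ck_diff Ck_mult Ck_minus Ck_const Ck_power Ck_divide_const

lemma Ck_ramp: "Ck k ramp"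
  unfolding ramp_def[abs_def] by (intro Ck_intros Ck_smoothstep_comp Ck_ident)

lemma Ck_profile: "Ck k profile"
  unfolding profile_def[abs_def]
  by (intro Ck_intros Ck_smoothstep_comp Ck_comp[OF Ck_exp] Ck_ramp Ck_ident)

lemma Ck_switch: "Ck k switch"
  unfolding switch_def[abs_def] by (intro Ck_intros Ck_smoothstep_comp Ck_ident)

lemma Ck_window: "Ck k window"
  unfolding window_def[abs_def] by (intro Ck_intros Ck_smoothstep_comp Ck_ident)

lemma phase_denom_ge: "1 / 2 \<le> (cos x)\<^sup>2 + smoothstep (4 * (sin x)\<^sup>2 - 1)"
proof (cases "(sin x)\<^sup>2 \<le> 1 / 2")
  case True
  then have "(cos x)\<^sup>2 \<ge> 1 / 2" using sin_cos_squared_add[of x] by linarith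
  then show ?thesis using smoothstep_nonneg[of "4 * (sin x)\<^sup>2 - 1"] by linarith
next
  case False
  then have "smoothstep (4 * (sin x)\<^sup>2 - 1) = 1" by (intro smoothstep_1) linarith
  then show ?thesis by simp
qed

lemma lbd_phase:
  assumes "bounded_linear a"
  shows "lbd I K k (\<lambda>i v. phase (a v))"
proof -
  have "lbd I K k (\<lambda>i v. (cos (a v))\<^sup>2 + smoothstep (4 * (sin (a v))\<^sup>2 - 1))"
    by (intro lbd_add lbd_power lbd_cos[OF assms] lbd_comp[OF Ck_smoothstep] lbd_diff lbd_mult
        lbd_sin[OF assms] lbd_const1)
  from lbd_inverse[OF this, of "1/2"] phase_denom_ge
  have "lbd I K k (\<lambda>i v. inverse ((cos (a v))\<^sup>2 + smoothstep (4 * (sin (a v))\<^sup>2 - 1)))" by simp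
  then show ?thesis unfolding phase_def
    by (intro lbd_comp[OF Ck_arctan] lbd_mult lbd_sin[OF assms] lbd_cos[OF assms])
qed

lemma lbd_peak:
  assumes "bounded_linear a"
  shows "lbd I K k (\<lambda>i v. peak (a v))"
  unfolding peak_def
  by (intro lbd_diff lbd_comp[OF Ck_smoothstep] lbd_mult lbd_power lbd_sin[OF assms] lbd_const1)

lemma phase_bound: "\<bar>phase x\<bar> \<le> 2"
  unfolding phase_def using arctan_lbound arctan_ubound pi_less_4 by (smt (verit) field_sum_of_halves)

lemma phase_DERIV:
  assumes "(sin x)\<^sup>2 < 1 / 4"
  shows "(phase has_real_derivative 1) (at x)"
proof -
  have *: "phase y = arctan (tan y)" if "(sin y)\<^sup>2 < 1 / 4" for y
  proof -
    have "smoothstep (4 * (sin y)\<^sup>2 - 1) = 0" using that by (intro smoothstep_0) linarith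
    then show ?thesis by (cases "cos y = 0") (simp_all add: phase_def tan_def power2_eq_square field_simps)
  qed
  have nz: "cos x \<noteq> 0"
  proof
    assume "cos x = 0"
    then have "(sin x)\<^sup>2 = 1" using sin_cos_squared_add[of x] by simp
    then show False using assms by simp
  qed
  have op: "open {y::real. (sin y)\<^sup>2 < 1 / 4}"
    by (intro open_Collect_less continuous_intros)
  have "1 + (tan x)\<^sup>2 \<noteq> 0" by (metis add.commute less_irrefl sum_power2_gt_zero_iff one_power2 zero_neq_one)
  moreover have "inverse ((cos x)\<^sup>2) = 1 + (tan x)\<^sup>2"
    using nz by (simp add: tan_sec power_inverse)
  ultimately have "((\<lambda>y. arctan (tan y)) has_real_derivative 1) (at x)"
    by (intro DERIV_chain2[OF DERIV_arctan DERIV_tan[OF nz], THEN DERIV_cong]) simp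
  then show ?thesis
    by (rule has_field_derivative_transform_within_open[OF _ op]) (use assms * in auto)
qed

lemma peak_nz: "peak x \<noteq> 0 \<Longrightarrow> (sin x)\<^sup>2 < 1 / 4"
  using smoothstep_1[of "8 * (sin x)\<^sup>2 - 1"] by (fastforce simp: peak_def)

lemma peak_1: "(sin x)\<^sup>2 \<le> 1 / 8 \<Longrightarrow> peak x = 1"
  by (simp add: peak_def smoothstep_0)

lemma peak_range: "0 \<le> peak x" "peak x \<le> 1"
  using smoothstep_le_1 smoothstep_nonneg by (auto simp: peak_def)

lemma ramp_minus: "ramp (- t) = - ramp t"
  by (simp add: ramp_def)

lemma ramp_nonneg: "t \<ge> 0 \<Longrightarrow> ramp t \<ge> 0"
  using smoothstep_le_1[of "(t\<^sup>2 - 4) / 5"] by (simp add: ramp_def)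

lemma ramp_mid: "\<bar>t\<bar> \<le> 2 \<Longrightarrow> ramp t = t"
proof -
  assume "\<bar>t\<bar> \<le> 2"
  then have "t\<^sup>2 \<le> 2\<^sup>2" using abs_le_square_iff[of t 2] by simp
  then show ?thesis by (simp add: ramp_def smoothstep_0)
qed

lemma ramp_far: "\<bar>t\<bar> \<ge> 3 \<Longrightarrow> ramp t = 0"
proof -
  assume "\<bar>t\<bar> \<ge> 3"
  then have "t\<^sup>2 \<ge> 3\<^sup>2" using abs_le_square_iff[of 3 t] by simp
  then show ?thesis by (simp add: ramp_def smoothstep_1)
qed

lemma profile_mid: "\<bar>t\<bar> \<le> 1 \<Longrightarrow> profile t = exp (- t)"
  by (simp add: profile_def ramp_mid smoothstep_0)

lemma profile_left: "t \<le> -3 \<Longrightarrow> profile t = 1"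
  by (simp add: profile_def ramp_far smoothstep_0)

lemma profile_right: "t \<ge> 2 \<Longrightarrow> profile t = 0"
  by (simp add: profile_def smoothstep_1)

lemma profile_nonneg: "profile t \<ge> 0"
  using smoothstep_le_1 by (simp add: profile_def)

lemma profile_ge_1: "t \<le> 0 \<Longrightarrow> profile t \<ge> 1"
  using ramp_nonneg[of "- t"] by (simp add: profile_def ramp_minus smoothstep_0)

lemma profile_le_half:
  assumes "t \<ge> 1"
  shows "profile t \<le> 1 / 2"
proof (cases "t \<le> 2")
  case True
  have "2 \<le> exp (1::real)" using exp_ge_add_one_self[of 1] by simp
  also have "\<dots> \<le> exp t" using assms by simp
  finally have e: "exp (- t) \<le> 1 / 2" by (simp add: exp_minus field_simps)
  have "profile t \<le> exp (- t) * 1"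
    unfolding profile_def using True assms smoothstep_nonneg[of "t - 1"]
    by (intro mult_mono) (auto simp: ramp_mid smoothstep_le_1)
  then show ?thesis using e by simp
qed (simp add: profile_right)

lemma window_mid: "\<bar>t\<bar> \<le> 3 \<Longrightarrow> window t = 1"
proof -
  assume "\<bar>t\<bar> \<le> 3"
  then have "t\<^sup>2 \<le> 3\<^sup>2" using abs_le_square_iff[of t 3] by simp
  then show ?thesis by (simp add: window_def smoothstep_0)
qed

lemma window_far: "\<bar>t\<bar> \<ge> 4 \<Longrightarrow> window t = 0"
proof -
  assume "\<bar>t\<bar> \<ge> 4"
  then have "t\<^sup>2 \<ge> 4\<^sup>2" using abs_le_square_iff[of 4 t] by simp
  then show ?thesis by (simp add: window_def smoothstep_1)
qed

lemma window_range: "0 \<le> window t" "window t \<le> 1"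
  using smoothstep_le_1 smoothstep_nonneg by (auto simp: window_def)

lemma switch_left: "t \<le> -3 \<Longrightarrow> switch t = 0"
  by (simp add: switch_def smoothstep_0)

lemma switch_right: "t \<ge> -2 \<Longrightarrow> switch t = 1"
  by (simp add: switch_def smoothstep_1)

lemma switch_range: "0 \<le> switch t" "switch t \<le> 1"
  by (simp_all add: switch_def smoothstep_nonneg smoothstep_le_1)

text \<open>The stretch factor is chosen so that \<open>la (1 + stretch)\<^sup>2 = (la + 4) + 4h\<close>: this balances the relative decay rate of the
  two profiles, see \<open>defect_mid\<close>.\<close>

definition stretch :: "real \<Rightarrow> real \<Rightarrow> real" where
  "stretch h la = sqrt (1 + (4 + 4 * h) / la) - 1"

lemma stretch_eq:
  assumes "h > 0" "la > 0"
  shows "la * (stretch h la * (2 + stretch h la)) = 4 + 4 * h"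
proof -
  have "(1 + stretch h la)\<^sup>2 = 1 + (4 + 4 * h) / la"
    using assms by (simp add: stretch_def)
  then have "stretch h la * (2 + stretch h la) = (4 + 4 * h) / la"
    by (simp add: power2_eq_square algebra_simps)
  then show ?thesis using assms by simp
qed

lemma stretch_bounds:
  assumes "h > 0" "la > 0"
  shows "0 \<le> stretch h la" "la * stretch h la \<le> 2 + 2 * h"
proof -
  show 0: "0 \<le> stretch h la" using assms by (simp add: stretch_def)
  have "la * (stretch h la * 2) \<le> la * (stretch h la * (2 + stretch h la))"
    using 0 assms by (intro mult_left_mono) auto
  then show "la * stretch h la \<le> 2 + 2 * h" using stretch_eq[OF assms] by simp
qed

lemma partial_DERIV:
  assumes "f differentiable (at (t, x, z))"
  shows "((\<lambda>s. f (t, s, z)) has_real_derivative pd2 f (t, x, z)) (at x)"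
proof -
  have "((\<lambda>s::real. (t, s, z)) has_derivative (\<lambda>s. s *\<^sub>R (0, 1, 0))) (at x)"
    by (auto intro!: derivative_eq_intros)
  then have "((\<lambda>s. f (t, s, z)) has_derivative (\<lambda>s. dir_deriv (s *\<^sub>R (0, 1, 0)) f (t, x, z))) (at x)"
    using has_derivative_compose[of "\<lambda>s::real. (t, s, z)" "\<lambda>s. s *\<^sub>R (0, 1, 0)" x UNIV f
        "\<lambda>e. dir_deriv e f (t, x, z)"] has_derivative_dir_deriv[OF assms] by simp
  moreover have "(\<lambda>s. dir_deriv (s *\<^sub>R (0::real, 1::real, 0::real)) f (t, x, z)) = (\<lambda>s. pd2 f (t, x, z) * s)"
  proof (rule ext)
    fix s :: real
    show "dir_deriv (s *\<^sub>R (0::real, 1::real, 0::real)) f (t, x, z) = pd2 f (t, x, z) * s"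
      using linear_scale[OF dir_deriv_linear[OF assms], of s "(0, 1, 0)"]
      by (simp only: real_scaleR_def mult.commute)
  qed
  ultimately show ?thesis by (simp add: has_field_derivative_def)
qed

section \<open>The two-mode function and its defect\<close>

definition warp :: "real \<times> real \<times> real \<Rightarrow> real" where
  "warp v = switch (fst v) * phase (fst (snd v))"

definition theta :: "real \<Rightarrow> real \<Rightarrow> real \<times> real \<times> real \<Rightarrow> real" where
  "theta h la v = fst (snd v) + stretch h la * warp v"

text \<open>The function \<open>G\<close> of the overview, with the stretched phase in the first
  mode only.\<close>

definition mode :: "real \<Rightarrow> real \<Rightarrow> real \<times> real \<times> real \<Rightarrow> real" where
  "mode h la v = profile (fst v) * cos (theta h la v) + profile (- fst v) * cos (snd (snd v))"

lemma bl_fst_snd: "bounded_linear (\<lambda>v::real \<times> real \<times> real. fst (snd v))"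
  by (rule bounded_linear_compose[OF bounded_linear_fst bounded_linear_snd])

lemma bl_snd_snd: "bounded_linear (\<lambda>v::real \<times> real \<times> real. snd (snd v))"
  by (rule bounded_linear_compose[OF bounded_linear_snd bounded_linear_snd])

lemma lbd_warp: "lbd I slab k (\<lambda>i. warp)"
  unfolding warp_def[abs_def]
  by (intro lbd_mult lbd_comp[OF Ck_switch] lbd_fst lbd_phase bl_fst_snd)

lemma Ck_warp: "Ck k warp"
  using lbd_imp_Ck[OF lbd_warp[of "{()}"]] by simp

lemma Ck_theta: "Ck k (theta h la)"
  unfolding theta_def[abs_def] by (intro Ck_intros Ck_warp Ck_linear bl_fst_snd)

lemma Ck_sin: "Ck k (sin :: real \<Rightarrow> real)" and Ck_cos: "Ck k (cos :: real \<Rightarrow> real)"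
  using lbd_sin_cos[OF bounded_linear_ident, of "{()}" "{}" k] by (auto simp: Ck_iff_lbd)

lemma Ck_mode: "Ck k (mode h la)"
  unfolding mode_def[abs_def]
  by (intro Ck_intros Ck_comp[OF Ck_profile] Ck_comp[OF Ck_cos] Ck_theta Ck_linear bl_snd_snd
      bounded_linear_fst)

text \<open>The parameters \<open>la\<close> and ka = k \<cdot> k' over which all constants have to
  be uniform. The condition on ka says that the squared cosine of the angle is at most 1/3.\<close>

definition Idx :: "real \<Rightarrow> (real \<times> real) set" where
  "Idx b = {(la, ka). b \<le> la \<and> ka\<^sup>2 \<le> la * (la + 4) / 3}"

text \<open>\<open>theta\<close> is unbounded in the phase variable; the addition formulas separate
  its linear part from the perturbation, which is uniformly bounded on \<open>slab\<close>.\<close>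

lemma lbd_sin_cos_theta:
  assumes h: "h > 0" and b: "b \<ge> 1"
  shows "lbd (Idx b) slab k (\<lambda>i v. sin (theta h (fst i) v))"
    and "lbd (Idx b) slab k (\<lambda>i v. cos (theta h (fst i) v))"
proof -
  have "\<bar>stretch h (fst i)\<bar> \<le> 2 + 2 * h" if "i \<in> Idx b" for i
  proof -
    have la: "fst i \<ge> 1" using that b by (auto simp: Idx_def)
    have "1 * stretch h (fst i) \<le> fst i * stretch h (fst i)"
      using la stretch_bounds[of h "fst i"] h by (intro mult_right_mono) auto
    then show ?thesis using stretch_bounds[of h "fst i"] la h by simp
  qed
  then have e: "lbd (Idx b) slab k (\<lambda>i v. stretch h (fst i) * warp v)"
    by (intro lbd_mult lbd_const lbd_warp) blast
  show "lbd (Idx b) slab k (\<lambda>i v. sin (theta h (fst i) v))"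
    "lbd (Idx b) slab k (\<lambda>i v. cos (theta h (fst i) v))"
    unfolding theta_def sin_add cos_add
    by (intro lbd_add lbd_diff lbd_mult lbd_sin lbd_cos bl_fst_snd
      lbd_comp[OF Ck_sin e] lbd_comp[OF Ck_cos e])+
qed

lemma lbd_profile: "lbd I slab k (\<lambda>i v. profile (fst v))" "lbd I slab k (\<lambda>i v. profile (- fst v))"
  by (intro lbd_comp[OF Ck_profile] lbd_fst lbd_minus)+

lemma lbd_mode:
  assumes "h > 0" "b \<ge> 1"
  shows "lbd (Idx b) slab k (\<lambda>i. mode h (fst i))"
  unfolding mode_def[abs_def]
  by (intro lbd_add lbd_mult lbd_profile lbd_sin_cos_theta lbd_cos bl_snd_snd assms)

lemma pd2_mode: "pd2 (mode h la) = (\<lambda>v. - (profile (fst v) * sin (theta h la v) * (1 + stretch h la * pd2 warp v)))"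
proof (rule ext)
  fix v :: "real \<times> real \<times> real"
  obtain t x z where v: "v = (t, x, z)" by (metis surj_pair)
  have th: "((\<lambda>s. theta h la (t, s, z)) has_real_derivative (1 + stretch h la * pd2 warp v)) (at x)"
    unfolding theta_def v fst_conv snd_conv
    by (rule DERIV_add[OF DERIV_ident DERIV_cmult[OF partial_DERIV[OF Ck_differentiable[OF Ck_warp]]]])
  have "((\<lambda>s. mode h la (t, s, z)) has_real_derivative
      profile t * (- sin (theta h la v) * (1 + stretch h la * pd2 warp v)) + 0) (at x)"
    unfolding mode_def fst_conv snd_conv
    using DERIV_add[OF DERIV_cmult[OF DERIV_chain2[OF DERIV_cos th], of "profile t"] DERIV_const]
    by (simp add: v)
  then show "pd2 (mode h la) v = - (profile (fst v) * sin (theta h la v) * (1 + stretch h la * pd2 warp v))"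
    unfolding v by (subst partial2I[OF Ck_differentiable[OF Ck_mode]]) (auto simp: mult.assoc)
qed

lemma Ck_dir_deriv: "Ck (Suc k) f \<Longrightarrow> Ck k (dir_deriv e f)"
  by simp

lemma pd2_pd2_mode: "pd2 (pd2 (mode h la)) v = - profile (fst v) *
   (cos (theta h la v) * (1 + stretch h la * pd2 warp v)\<^sup>2 + stretch h la * sin (theta h la v) * pd2 (pd2 warp) v)"
proof -
  obtain t x z where v: "v = (t, x, z)" by (metis surj_pair)
  have th: "((\<lambda>s. theta h la (t, s, z)) has_real_derivative (1 + stretch h la * pd2 warp v)) (at x)"
    unfolding theta_def v fst_conv snd_conv
    by (rule DERIV_add[OF DERIV_ident DERIV_cmult[OF partial_DERIV[OF Ck_differentiable[OF Ck_warp]]]])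
  have w: "((\<lambda>s. pd2 warp (t, s, z)) has_real_derivative pd2 (pd2 warp) v) (at x)"
    unfolding v by (rule partial_DERIV[OF Ck_differentiable[OF Ck_dir_deriv[OF Ck_warp]]])
  define D where "D = 1 + stretch h la * pd2 warp v"
  define E where "E = stretch h la * pd2 (pd2 warp) v"
  have wD: "((\<lambda>s. 1 + stretch h la * pd2 warp (t, s, z)) has_real_derivative 0 + E) (at x)"
    unfolding E_def by (intro DERIV_add DERIV_const DERIV_cmult w)
  have "((\<lambda>s. pd2 (mode h la) (t, s, z)) has_real_derivative
      - (profile t * (cos (theta h la v) * D) * D + (0 + E) * (profile t * sin (theta h la v)))) (at x)"
    unfolding pd2_mode fst_conv
    using DERIV_minus[OF DERIV_mult[OF DERIV_cmult[OF DERIV_chain2[OF DERIV_sin th[folded D_def]], of "profile t"] wD]]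
    by (simp add: v D_def)
  then have "pd2 (pd2 (mode h la)) v =
      - (profile t * (cos (theta h la v) * D) * D + (0 + E) * (profile t * sin (theta h la v)))"
    unfolding v by (intro partial2I[OF Ck_differentiable[OF Ck_dir_deriv[OF Ck_mode]]])
  then show ?thesis
    unfolding D_def[symmetric] by (simp add: v E_def power2_eq_square algebra_simps)
qed

lemma pd3_mode: "pd3 (mode h la) = (\<lambda>v. - profile (- fst v) * sin (snd (snd v)))"
proof (rule ext)
  fix v :: "real \<times> real \<times> real"
  obtain t x z where v: "v = (t, x, z)" by (metis surj_pair)
  show "pd3 (mode h la) v = - profile (- fst v) * sin (snd (snd v))"
    unfolding v
    by (rule partial3I[OF Ck_differentiable[OF Ck_mode]])
      (unfold mode_def theta_def warp_def, auto intro!: derivative_eq_intros)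
qed

lemma pd_pd3_mode: "pd2 (pd3 (mode h la)) v = 0" "pd3 (pd3 (mode h la)) v = - profile (- fst v) * cos (snd (snd v))"
proof -
  obtain t x z where v: "v = (t, x, z)" by (metis surj_pair)
  show "pd2 (pd3 (mode h la)) v = 0"
    unfolding v
    by (rule partial2I[OF Ck_differentiable[OF Ck_dir_deriv[OF Ck_mode]]])
      (unfold pd3_mode, auto intro!: derivative_eq_intros)
  show "pd3 (pd3 (mode h la)) v = - profile (- fst v) * cos (snd (snd v))"
    unfolding v
    by (rule partial3I[OF Ck_differentiable[OF Ck_dir_deriv[OF Ck_mode]]])
      (unfold pd3_mode, auto intro!: derivative_eq_intros)
qed

lemma pd3_pd2_mode: "pd3 (pd2 (mode h la)) v = 0"
proof -
  obtain t x z where v: "v = (t, x, z)" by (metis surj_pair)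
  have "pd2 warp ((t, x, 0) + (0, 0, s)) = pd2 warp (t, x, 0)" for s
    by (rule dir_deriv_shift) (simp add: warp_def)
  then have w: "pd2 warp (t, x, s) = pd2 warp (t, x, 0)" for s by simp
  have "(\<lambda>s. pd2 (mode h la) (t, x, s)) = (\<lambda>s. pd2 (mode h la) (t, x, 0))"
  proof (rule ext)
    fix s
    show "pd2 (mode h la) (t, x, s) = pd2 (mode h la) (t, x, 0)"
      unfolding pd2_mode w[of s] theta_def warp_def by simp
  qed
  then have "((\<lambda>s. pd2 (mode h la) (t, x, s)) has_real_derivative 0) (at z)" by simp
  then show ?thesis
    unfolding v by (rule partial3I[OF Ck_differentiable[OF Ck_dir_deriv[OF Ck_mode]]])
qed

text \<open>The \<open>P G\<close> of the overview after cancellation of the terms of order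
  \<open>la\<close>. In this form \<open>la\<close> occurs only through
  \<open>h\<^sup>2 / la\<close>, \<open>stretch\<close> and \<open>la * stretch\<close>, all of them
  bounded; hence \<open>lbd_defect\<close>.\<close>

definition defect :: "real \<Rightarrow> real \<Rightarrow> real \<times> real \<times> real \<Rightarrow> real" where
  "defect h la v = h\<^sup>2 / la * pd1 (pd1 (mode h la)) v - 2 * h * pd1 (mode h la) v
     - profile (fst v) * (la * stretch h la * (pd2 warp v * (2 + stretch h la * pd2 warp v)) * cos (theta h la v)
         + la * stretch h la * pd2 (pd2 warp) v * sin (theta h la v))
     - 4 * (profile (- fst v) * cos (snd (snd v)))"

lemma defect_eq: "la * mode h la v + block_op h la ka (mode h la) v = defect h la v"
  unfolding block_op_def pd2_pd2_mode pd_pd3_mode pd3_pd2_mode defect_def mode_def[of h la v]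
  by (simp add: algebra_simps power2_eq_square)

definition rate :: "real \<Rightarrow> real \<Rightarrow> real" where
  "rate h la = h\<^sup>2 / la - 2 * h - 4"

lemma warp_line:
  assumes "t \<ge> -2" "(sin x)\<^sup>2 < 1 / 4"
  shows "pd2 warp (t, x, z) = 1" "pd2 (pd2 warp) (t, x, z) = 0"
proof -
  have 1: "pd2 warp (t, y, z) = 1" if "(sin y)\<^sup>2 < 1 / 4" for y
    by (rule partial2I[OF Ck_differentiable[OF Ck_warp]])
      (unfold warp_def, auto intro!: derivative_eq_intros phase_DERIV[OF that] simp: switch_right assms(1))
  then show "pd2 warp (t, x, z) = 1" using assms(2) .
  have op: "open {y::real. (sin y)\<^sup>2 < 1 / 4}"
    by (intro open_Collect_less continuous_intros)
  show "pd2 (pd2 warp) (t, x, z) = 0"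
    by (rule partial2I[OF Ck_differentiable[OF Ck_dir_deriv[OF Ck_warp]]])
      (rule has_field_derivative_transform_within_open[OF DERIV_const op], use assms(2) 1 in auto)
qed

text \<open>Here the coefficients are exp(-t) and exp t. The first mode is multiplied by h^2 / la +
  2 h - la ((1 + stretch)^2 - 1), the second by h^2 / la - 2 h - 4, and the choice of
  \<open>stretch\<close> makes both factors equal to \<open>rate\<close>.\<close>

lemma defect_mid:
  assumes h: "h > 0" and la: "la > 0" and t: "\<bar>t\<bar> < 1" and x: "(sin x)\<^sup>2 < 1 / 4"
  shows "defect h la (t, x, z) = rate h la * mode h la (t, x, z)"
proof -
  define C where "C = cos (x + stretch h la * phase x)"
  have th: "theta h la (s, x, z) = x + stretch h la * phase x" if "\<bar>s\<bar> < 1" for s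
    using that by (simp add: theta_def warp_def switch_right)
  have m: "mode h la (s, x, z) = exp (- s) * C + exp s * cos z" if "\<bar>s\<bar> < 1" for s
    using that th[OF that] by (simp add: mode_def profile_mid C_def)
  have op: "open {s::real. \<bar>s\<bar> < 1}"
    by (intro open_Collect_less continuous_intros)
  have d1: "pd1 (mode h la) (s, x, z) = - exp (- s) * C + exp s * cos z" if s: "\<bar>s\<bar> < 1" for s
  proof (rule partial1I[OF Ck_differentiable[OF Ck_mode]])
    have "((\<lambda>s. exp (- s) * C + exp s * cos z) has_real_derivative - exp (- s) * C + exp s * cos z) (at s)"
      by (auto intro!: derivative_eq_intros)
    then show "((\<lambda>s. mode h la (s, x, z)) has_real_derivative - exp (- s) * C + exp s * cos z) (at s)"
      by (rule has_field_derivative_transform_within_open[OF _ op]) (use s m in auto)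
  qed
  have d2: "pd1 (pd1 (mode h la)) (t, x, z) = exp (- t) * C + exp t * cos z"
  proof (rule partial1I[OF Ck_differentiable[OF Ck_dir_deriv[OF Ck_mode]]])
    have "((\<lambda>s. - exp (- s) * C + exp s * cos z) has_real_derivative exp (- t) * C + exp t * cos z) (at t)"
      by (auto intro!: derivative_eq_intros)
    then show "((\<lambda>s. pd1 (mode h la) (s, x, z)) has_real_derivative exp (- t) * C + exp t * cos z) (at t)"
      by (rule has_field_derivative_transform_within_open[OF _ op]) (use t d1 in auto)
  qed
  have w: "pd2 warp (t, x, z) = 1" "pd2 (pd2 warp) (t, x, z) = 0"
    using warp_line[of t x z] t x by auto
  have se: "la * stretch h la * (2 + stretch h la) = 4 + 4 * h"
    using stretch_eq[OF h la] by (simp add: mult.assoc)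
  have "defect h la (t, x, z) = h\<^sup>2 / la * (exp (- t) * C + exp t * cos z)
     - 2 * h * (- exp (- t) * C + exp t * cos z)
     - exp (- t) * (la * stretch h la * (2 + stretch h la) * C) - 4 * (exp t * cos z)"
    using t by (simp add: defect_def d1[OF t] d2 w th[OF t] profile_mid C_def)
  also have "\<dots> = rate h la * mode h la (t, x, z)"
    unfolding se m[OF t] rate_def by (simp add: algebra_simps)
  finally show ?thesis .
qed

lemma defect_left:
  assumes t: "t < -3"
  shows "defect h la (t, x, z) = 0"
proof -
  have m: "mode h la (s, x, z) = cos x" if "s < -3" for s
    using that by (simp add: mode_def profile_left profile_right theta_def warp_def switch_left)
  have d1: "pd1 (mode h la) (s, x, z) = 0" if s: "s < -3" for s
    by (rule partial1I[OF Ck_differentiable[OF Ck_mode]])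
      (rule has_field_derivative_transform_within_open[OF DERIV_const open_lessThan], use s m in auto)
  have d2: "pd1 (pd1 (mode h la)) (t, x, z) = 0"
    by (rule partial1I[OF Ck_differentiable[OF Ck_dir_deriv[OF Ck_mode]]])
      (rule has_field_derivative_transform_within_open[OF DERIV_const open_lessThan], use t d1 in auto)
  have w: "pd2 warp (t, y, z) = 0" for y
    by (rule partial2I[OF Ck_differentiable[OF Ck_warp]])
      (use t in \<open>auto simp: warp_def switch_left\<close>)
  have w2: "pd2 (pd2 warp) (t, x, z) = 0"
    by (rule partial2I[OF Ck_differentiable[OF Ck_dir_deriv[OF Ck_warp]]]) (auto simp: w)
  show ?thesis using t by (simp add: defect_def d1[OF t] d2 w w2 profile_right)
qed

lemma defect_right:
  assumes t: "t > 3"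
  shows "defect h la (t, x, z) = - 4 * mode h la (t, x, z)"
proof -
  have m: "mode h la (s, x, z) = cos z" if "s > 3" for s
    using that by (simp add: mode_def profile_left profile_right)
  have d1: "pd1 (mode h la) (s, x, z) = 0" if s: "s > 3" for s
    by (rule partial1I[OF Ck_differentiable[OF Ck_mode]])
      (rule has_field_derivative_transform_within_open[OF DERIV_const open_greaterThan], use s m in auto)
  have d2: "pd1 (pd1 (mode h la)) (t, x, z) = 0"
    by (rule partial1I[OF Ck_differentiable[OF Ck_dir_deriv[OF Ck_mode]]])
      (rule has_field_derivative_transform_within_open[OF DERIV_const open_greaterThan], use t d1 in auto)
  show ?thesis using t by (simp add: defect_def d1[OF t] d2 m profile_right profile_left)
qed

lemma lbd_defect:
  assumes h: "h > 0" and b: "b \<ge> 1"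
  shows "lbd (Idx b) slab k (\<lambda>i. defect h (fst i))"
proof -
  have la: "fst i \<ge> 1" if "i \<in> Idx b" for i using that b by (auto simp: Idx_def)
  have c1: "lbd (Idx b) slab k (\<lambda>i v. h\<^sup>2 / fst i)"
  proof (rule lbd_const, intro exI ballI)
    fix i assume "i \<in> Idx b"
    then show "\<bar>h\<^sup>2 / fst i\<bar> \<le> h\<^sup>2" using la[of i] mult_left_mono[of 1 "fst i" "h\<^sup>2"] by (simp add: divide_le_eq)
  qed
  have c2: "lbd (Idx b) slab k (\<lambda>i v. fst i * stretch h (fst i))"
  proof (rule lbd_const, intro exI ballI)
    fix i assume "i \<in> Idx b"
    then show "\<bar>fst i * stretch h (fst i)\<bar> \<le> 2 + 2 * h"
      using la[of i] stretch_bounds[OF h, of "fst i"] by simp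
  qed
  have c3: "lbd (Idx b) slab k (\<lambda>i v. stretch h (fst i))"
  proof (rule lbd_const, intro exI ballI)
    fix i assume "i \<in> Idx b"
    then have l: "fst i \<ge> 1" by (rule la)
    then have "1 * stretch h (fst i) \<le> fst i * stretch h (fst i)"
      using stretch_bounds[OF h, of "fst i"] by (intro mult_right_mono) auto
    then show "\<bar>stretch h (fst i)\<bar> \<le> 2 + 2 * h"
      using l stretch_bounds[OF h, of "fst i"] by simp
  qed
  show ?thesis
    unfolding defect_def[abs_def]
    by (intro lbd_diff lbd_mult lbd_add c1 c2 c3 lbd_const1 lbd_profile lbd_sin_cos_theta[OF h b]
        lbd_dir_deriv lbd_mode[OF h b] lbd_warp lbd_cos bl_snd_snd)
qed

lemma Idx_bounds:
  assumes "i \<in> Idx b" "b \<ge> 1"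
  shows "fst i \<ge> 1" "(snd i)\<^sup>2 \<le> fst i * (fst i + 4) / 3" "\<bar>snd i / fst i\<bar> \<le> 2"
proof -
  show la: "fst i \<ge> 1" and ka: "(snd i)\<^sup>2 \<le> fst i * (fst i + 4) / 3"
    using assms by (auto simp: Idx_def)
  have "fst i * (fst i + 4) / 3 \<le> (2 * fst i)\<^sup>2"
    using la mult_mono[of 1 "fst i" "fst i" "fst i"] by (simp add: power2_eq_square algebra_simps)
  then have "(snd i)\<^sup>2 \<le> (2 * fst i)\<^sup>2" using ka by linarith
  then have "\<bar>snd i\<bar> \<le> 2 * fst i" using la abs_le_square_iff[of "snd i" "2 * fst i"] by simp
  then show "\<bar>snd i / fst i\<bar> \<le> 2" using la by (simp add: divide_le_eq)
qed

text \<open>After division by \<open>la\<close> the coefficients of \<open>block_op\<close> and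
  \<open>block_form\<close> are bounded on \<open>Idx b\<close>. This is how one constant comes to
  serve all blocks.\<close>

lemma lbd_coeffs:
  assumes b: "b \<ge> 1"
  shows "lbd (Idx b) K k (\<lambda>i v. h\<^sup>2 / (fst i * fst i))" "lbd (Idx b) K k (\<lambda>i v. 2 * h / fst i)"
    "lbd (Idx b) K k (\<lambda>i v. snd i / fst i)" "lbd (Idx b) K k (\<lambda>i v. (fst i + 4) / fst i)"
    "lbd (Idx b) K k (\<lambda>i v. 1 / fst i)" "lbd (Idx b) K k (\<lambda>i v. rate h (fst i))"
proof -
  have one: "\<bar>1 / fst i\<bar> \<le> 1" if "i \<in> Idx b" for i :: "real \<times> real"
    using Idx_bounds[OF that b] by simp
  show 1: "lbd (Idx b) K k (\<lambda>i v. 1 / fst i)"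
    by (rule lbd_const) (use one in blast)
  show "lbd (Idx b) K k (\<lambda>i v. snd i / fst i)"
    by (rule lbd_const) (use Idx_bounds(3) b in blast)
  have eq: "h\<^sup>2 / (la * la) = h\<^sup>2 * (1 / la) * (1 / la)" "2 * h / la = 2 * h * (1 / la)"
    "rate h la = h\<^sup>2 * (1 / la) - (2 * h + 4)" for la :: real
    by (simp_all add: rate_def)
  show "lbd (Idx b) K k (\<lambda>i v. h\<^sup>2 / (fst i * fst i))" "lbd (Idx b) K k (\<lambda>i v. 2 * h / fst i)"
    "lbd (Idx b) K k (\<lambda>i v. rate h (fst i))"
    unfolding eq by (intro lbd_mult lbd_diff lbd_const1 1)+
  have "lbd (Idx b) K k (\<lambda>i v. (fst i + 4) / fst i) = lbd (Idx b) K k (\<lambda>i v. 1 + 4 * (1 / fst i))"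
  proof (rule lbd_cong)
    fix i assume "i \<in> Idx b"
    then show "(\<lambda>v. (fst i + 4) / fst i) = (\<lambda>v. 1 + 4 * (1 / fst i))"
      using Idx_bounds(1)[OF _ b, of i] by (simp add: field_simps)
  qed
  also have "\<dots>" by (intro lbd_add lbd_mult lbd_const1 1)
  finally show "lbd (Idx b) K k (\<lambda>i v. (fst i + 4) / fst i)" by simp
qed

lemma lbd_form:
  assumes b: "b \<ge> 1" and f: "lbd (Idx b) K (Suc k) f" and g: "lbd (Idx b) K (Suc k) g"
  shows "lbd (Idx b) K k (\<lambda>i v. block_form h (fst i) (snd i) (f i) (g i) v / fst i)"
proof -
  have "lbd (Idx b) K k (\<lambda>i v. block_form h (fst i) (snd i) (f i) (g i) v / fst i)
    = lbd (Idx b) K k (\<lambda>i v. h\<^sup>2 / (fst i * fst i) * (pd1 (f i) v * pd1 (g i) v) + (pd2 (f i) v * pd2 (g i) v)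
     + snd i / fst i * (pd2 (f i) v * pd3 (g i) v + pd3 (f i) v * pd2 (g i) v)
     + (fst i + 4) / fst i * (pd3 (f i) v * pd3 (g i) v))"
  proof (rule lbd_cong, rule ext)
    fix i v assume "i \<in> Idx b"
    then have "fst i \<noteq> 0" using Idx_bounds(1)[OF _ b, of i] by auto
    then show "block_form h (fst i) (snd i) (f i) (g i) v / fst i
      = h\<^sup>2 / (fst i * fst i) * (pd1 (f i) v * pd1 (g i) v) + (pd2 (f i) v * pd2 (g i) v)
     + snd i / fst i * (pd2 (f i) v * pd3 (g i) v + pd3 (f i) v * pd2 (g i) v)
     + (fst i + 4) / fst i * (pd3 (f i) v * pd3 (g i) v)"
      unfolding block_form_def by (simp add: field_simps)
  qed
  also have "\<dots>"
    by (intro lbd_add lbd_mult lbd_coeffs[OF b] lbd_dir_deriv f g)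
  finally show ?thesis by simp
qed

lemma lbd_op:
  assumes b: "b \<ge> 1" and f: "lbd (Idx b) K (Suc (Suc k)) f"
  shows "lbd (Idx b) K k (\<lambda>i v. block_op h (fst i) (snd i) (f i) v / fst i)"
proof -
  have "lbd (Idx b) K k (\<lambda>i v. block_op h (fst i) (snd i) (f i) v / fst i)
    = lbd (Idx b) K k (\<lambda>i v. h\<^sup>2 / (fst i * fst i) * pd1 (pd1 (f i)) v - 2 * h / fst i * pd1 (f i) v + pd2 (pd2 (f i)) v
     + snd i / fst i * (pd2 (pd3 (f i)) v + pd3 (pd2 (f i)) v)
     + (fst i + 4) / fst i * pd3 (pd3 (f i)) v)"
  proof (rule lbd_cong, rule ext)
    fix i v assume "i \<in> Idx b"
    then have "fst i \<noteq> 0" using Idx_bounds(1)[OF _ b, of i] by auto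
    then show "block_op h (fst i) (snd i) (f i) v / fst i
      = h\<^sup>2 / (fst i * fst i) * pd1 (pd1 (f i)) v - 2 * h / fst i * pd1 (f i) v + pd2 (pd2 (f i)) v
     + snd i / fst i * (pd2 (pd3 (f i)) v + pd3 (pd2 (f i)) v)
     + (fst i + 4) / fst i * pd3 (pd3 (f i)) v"
      unfolding block_op_def by (simp add: field_simps)
  qed
  also have "\<dots>"
    by (intro lbd_add lbd_diff lbd_mult lbd_coeffs[OF b] lbd_dir_deriv f lbd_Suc_imp[OF f])
  finally show ?thesis by simp
qed

text \<open>Marks the neighbourhood of the points where both phases are multiples of pi; only there
  can \<open>mode\<close> and its gradient vanish together.\<close>

definition gap :: "real \<times> real \<times> real \<Rightarrow> real" where
  "gap v = peak (fst (snd v)) * peak (snd (snd v))"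

text \<open>The terms added to the gradient keep \<open>denom\<close> away from zero without spoiling the cancellation: \<open>mode\<^sup>2\<close> is divisible
  by \<open>mode\<close>, and on the support of \<open>gap\<close> the residual vanishes or \<open>mode\<close> is bounded below.\<close>

definition denom :: "real \<Rightarrow> real \<Rightarrow> real \<Rightarrow> real \<times> real \<times> real \<Rightarrow> real" where
  "denom h la ka v = block_form h la ka (mode h la) (mode h la) v / la + (mode h la v)\<^sup>2 + gap v"

text \<open>Subtracting \<open>rate * mode\<close>, a harmless multiple of the mode, makes the rest
  vanish near the critical set by \<open>defect_mid\<close>, where division by the gradient would
  fail.\<close>

definition resid :: "real \<Rightarrow> real \<Rightarrow> real \<times> real \<times> real \<Rightarrow> real" where
  "resid h la v = window (fst v) * (defect h la v - rate h la * mode h la v)"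

text \<open>The function \<open>S\<close> of the overview, with the gradient replaced by
  \<open>denom\<close> and \<open>P G\<close> by \<open>resid\<close>.\<close>

definition corr :: "real \<Rightarrow> real \<Rightarrow> real \<Rightarrow> real \<times> real \<times> real \<Rightarrow> real" where
  "corr h la ka v = - (1 / 2) * (resid h la v * inverse (denom h la ka v))"

definition patch :: "real \<Rightarrow> real \<Rightarrow> real \<Rightarrow> real \<times> real \<times> real \<Rightarrow> real" where
  "patch h la ka v = mode h la v + (1 / la) * (corr h la ka v * (mode h la v * mode h la v))"

section \<open>Lower bound for the denominator of the correction\<close>

lemma warp_pd2_bound: "\<exists>B. \<forall>v. \<bar>pd2 warp v\<bar> \<le> B"
proof -
  have l: "lbd {()} UNIV 1 (\<lambda>_ v. phase (fst (snd (v :: real \<times> real \<times> real))))"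
    by (rule lbd_phase[OF bl_fst_snd])
  then have "lbd {()} UNIV 0 (\<lambda>_. pd2 (\<lambda>v. phase (fst (snd v))))"
    unfolding One_nat_def by (rule lbd_dir_deriv)
  from lbd_bounded[OF this] obtain B where
    B: "\<bar>pd2 (\<lambda>v. phase (fst (snd v))) v\<bar> \<le> B" for v by auto
  have "\<bar>pd2 warp v\<bar> \<le> B" for v
  proof -
    obtain t x z where v: "v = (t, x, z)" by (metis surj_pair)
    have "((\<lambda>s. phase s) has_real_derivative pd2 (\<lambda>v. phase (fst (snd v))) (t, x, z)) (at x)"
      using partial_DERIV[of "\<lambda>v. phase (fst (snd v))" t x z] lbd_differentiable[OF l[unfolded One_nat_def]] by simp
    then have "((\<lambda>s. warp (t, s, z)) has_real_derivative switch t * pd2 (\<lambda>v. phase (fst (snd v))) (t, x, z)) (at x)"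
      unfolding warp_def by (auto intro: DERIV_cmult)
    then have "pd2 warp v = switch t * pd2 (\<lambda>v. phase (fst (snd v))) v"
      unfolding v by (intro partial2I[OF Ck_differentiable[OF Ck_warp]])
    then show ?thesis
      using mult_mono[of "switch t" 1 "\<bar>pd2 (\<lambda>v. phase (fst (snd v))) v\<bar>" B] B[of v] switch_range[of t]
      by (simp add: abs_mult)
  qed
  then show ?thesis by blast
qed

lemma sin_cos_lipschitz:
  fixes a b :: real
  shows "\<bar>sin a - sin b\<bar> \<le> \<bar>a - b\<bar>" "\<bar>cos a - cos b\<bar> \<le> \<bar>a - b\<bar>"
proof -
  have s: "\<bar>sin ((a - b) / 2)\<bar> \<le> \<bar>a - b\<bar> / 2" "\<bar>sin ((b - a) / 2)\<bar> \<le> \<bar>a - b\<bar> / 2"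
    using abs_sin_x_le_abs_x[of "(a - b) / 2"] abs_sin_x_le_abs_x[of "(b - a) / 2"] by auto
  have "\<bar>sin a - sin b\<bar> = 2 * (\<bar>sin ((a - b) / 2)\<bar> * \<bar>cos ((a + b) / 2)\<bar>)"
    unfolding sin_diff_sin by (simp add: abs_mult)
  also have "\<dots> \<le> 2 * (\<bar>a - b\<bar> / 2 * 1)"
    by (intro mult_left_mono mult_mono s) auto
  finally show "\<bar>sin a - sin b\<bar> \<le> \<bar>a - b\<bar>" by simp
  have "\<bar>cos a - cos b\<bar> = 2 * (\<bar>sin ((b - a) / 2)\<bar> * \<bar>sin ((a + b) / 2)\<bar>)"
    unfolding cos_diff_cos by (simp add: abs_mult)
  also have "\<dots> \<le> 2 * (\<bar>a - b\<bar> / 2 * 1)"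
    by (intro mult_left_mono mult_mono s) auto
  finally show "\<bar>cos a - cos b\<bar> \<le> \<bar>a - b\<bar>" by simp
qed

text \<open>The numbers serve \<open>denom_ge\<close>: as \<open>phase\<close> is at most 2 in
  absolute value, the stretched phase moves by at most 1/50, and the factor
  \<open>1 + stretch h la * pd2 warp v\<close> in the gradient stays above 1/2.\<close>

definition small_stretch :: "real \<Rightarrow> real \<Rightarrow> bool" where
  "small_stretch h b \<longleftrightarrow> b \<ge> 1 \<and> (\<forall>la\<ge>b. stretch h la \<le> 1 / 100 \<and> (\<forall>v. stretch h la * \<bar>pd2 warp v\<bar> \<le> 1 / 2))"

lemma small_stretch_exists:
  assumes h: "h > 0"
  shows "\<exists>b. small_stretch h b"
proof -
  obtain B where B: "\<bar>pd2 warp v\<bar> \<le> B" for v using warp_pd2_bound by blast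
  have B0: "B \<ge> 0" using B[of 0] by linarith
  \<comment> \<open>Since \<open>la * stretch\<close> is at most 2 + 2 h, the product of
    \<open>stretch\<close> with 100 + 2 B is at most 1 beyond this value, which yields both
    conditions.\<close>
  define b where "b = (2 + 2 * h) * (100 + 2 * B) + 1"
  have b1: "b \<ge> 1" using h B0 by (simp add: b_def)
  have e: "stretch h la * (100 + 2 * B) \<le> 1" if la: "la \<ge> b" for la
  proof -
    have la0: "la > 0" using la b1 by simp
    have "la * (stretch h la * (100 + 2 * B)) = (la * stretch h la) * (100 + 2 * B)" by simp
    also have "\<dots> \<le> (2 + 2 * h) * (100 + 2 * B)"
      using stretch_bounds[OF h la0] B0 by (intro mult_right_mono) auto
    also have "\<dots> \<le> la * 1" using la by (simp add: b_def)
    finally show ?thesis using mult_left_le_imp_le la0 by blast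
  qed
  have "stretch h la \<le> 1 / 100 \<and> (\<forall>v. stretch h la * \<bar>pd2 warp v\<bar> \<le> 1 / 2)" if la: "la \<ge> b" for la
  proof -
    have s0: "stretch h la \<ge> 0" using stretch_bounds[OF h, of la] la b1 by simp
    then have "0 \<le> stretch h la * B" using B0 by simp
    then have 1: "stretch h la \<le> 1 / 100" "stretch h la * B \<le> 1 / 2"
      using e[OF la] s0 by (simp_all add: algebra_simps)
    moreover have "stretch h la * \<bar>pd2 warp v\<bar> \<le> 1 / 2" for v
      using mult_left_mono[OF B s0, of v] 1 by linarith
    ultimately show ?thesis by blast
  qed
  then show ?thesis using b1 unfolding small_stretch_def by blast
qed

lemma abs_ge_of_square:
  fixes s c :: real
  assumes "c\<^sup>2 \<le> s\<^sup>2" "c \<ge> 0"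
  shows "c \<le> \<bar>s\<bar>"
  using assms abs_le_square_iff[of c s] by simp

lemma theta_close:
  assumes h: "h > 0" and b: "small_stretch h b" and la: "la \<ge> b"
  shows "\<bar>sin (theta h la v) - sin (fst (snd v))\<bar> \<le> 1 / 50" "\<bar>cos (theta h la v) - cos (fst (snd v))\<bar> \<le> 1 / 50"
proof -
  have e: "0 \<le> stretch h la" "stretch h la \<le> 1 / 100"
    using b la stretch_bounds[OF h, of la] by (auto simp: small_stretch_def)
  have "\<bar>warp v\<bar> \<le> 1 * 2"
    unfolding warp_def abs_mult using switch_range[of "fst v"] phase_bound by (intro mult_mono) auto
  then have "\<bar>theta h la v - fst (snd v)\<bar> \<le> 1 / 100 * 2"
    using mult_mono[of "stretch h la" "1 / 100" "\<bar>warp v\<bar>" 2] e by (simp add: theta_def abs_mult)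
  then show "\<bar>sin (theta h la v) - sin (fst (snd v))\<bar> \<le> 1 / 50" "\<bar>cos (theta h la v) - cos (fst (snd v))\<bar> \<le> 1 / 50"
    using sin_cos_lipschitz[of "theta h la v" "fst (snd v)"] by linarith+
qed

text \<open>If a mode has coefficient at least 1/2 and a sine away from 0, the gradient is large (A,
  B; case A sets the constant). If both sines are small, \<open>gap\<close> is 1 (C). Otherwise one
  coefficient is below 1/2, the other at least 1 with cosine near 1 in absolute value, so
  \<open>mode\<close> itself is large (D, E).\<close>

lemma denom_ge:
  assumes h: "h > 0" and b: "small_stretch h b" and i: "(la, ka) \<in> Idx b"
  shows "denom h la ka v \<ge> 1 / 1000"
proof -
  obtain t x z where v: "v = (t, x, z)" by (metis surj_pair)
  have b1: "b \<ge> 1" and la: "la \<ge> b" using b i by (auto simp: small_stretch_def Idx_def)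
  note ib = Idx_bounds[OF i b1, unfolded fst_conv snd_conv]
  define p q D where "p = profile t" and "q = profile (- t)" and "D = 1 + stretch h la * pd2 warp v"
  have p0: "p \<ge> 0" "q \<ge> 0" by (simp_all add: p_def q_def profile_nonneg)
  have pq: "p \<ge> 1 \<or> q \<ge> 1"
    using profile_ge_1[of t] profile_ge_1[of "- t"] by (cases "t \<le> 0") (auto simp: p_def q_def)
  have "stretch h la * \<bar>pd2 warp v\<bar> \<le> 1 / 2" "0 \<le> stretch h la"
    using b la stretch_bounds[OF h, of la] by (auto simp: small_stretch_def simp del: split_paired_All)
  then have "\<bar>stretch h la * pd2 warp v\<bar> \<le> 1 / 2" by (simp add: abs_mult)
  then have D: "D \<ge> 1 / 2" by (auto simp: D_def)
  define th where "th = theta h la v"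
  have close: "\<bar>sin th - sin x\<bar> \<le> 1 / 50" "\<bar>cos th - cos x\<bar> \<le> 1 / 50"
    using theta_close[OF h b la, of v] by (simp_all add: v th_def)
  have m: "mode h la v = p * cos th + q * cos z" by (simp add: mode_def v p_def q_def th_def)
  have f: "block_form h la ka (mode h la) (mode h la) v / la \<ge> ((p * sin th * D)\<^sup>2 + (q * sin z)\<^sup>2) / 3"
    using block_form_ge[where la = la and ka = ka and h = h and f = "mode h la" and v = v] ib
    by (simp add: pd2_mode pd3_mode D_def p_def[symmetric] q_def[symmetric] v th_def)
  have g0: "gap v \<ge> 0" using peak_range by (simp add: gap_def)
  consider (A) "p \<ge> 1 / 2" "(sin x)\<^sup>2 \<ge> 1 / 8" | (B) "q \<ge> 1 / 2" "(sin z)\<^sup>2 \<ge> 1 / 8"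
    | (C) "(sin x)\<^sup>2 < 1 / 8" "(sin z)\<^sup>2 < 1 / 8"
    | (D) "p < 1 / 2" "q \<ge> 1" "(sin z)\<^sup>2 < 1 / 8" | (E) "q < 1 / 2" "p \<ge> 1" "(sin x)\<^sup>2 < 1 / 8"
    using pq by argo
  then show ?thesis
  proof cases
    case A
    have "35 / 100 \<le> \<bar>sin x\<bar>" by (rule abs_ge_of_square) (use A in \<open>auto simp: power2_eq_square\<close>)
    then have s: "\<bar>sin th\<bar> \<ge> 33 / 100" using close by linarith
    have "p * \<bar>sin th\<bar> * D \<ge> 1 / 2 * (33 / 100) * (1 / 2)"
      using A s D by (intro mult_mono) auto
    then have "(p * \<bar>sin th\<bar> * D)\<^sup>2 \<ge> (1 / 2 * (33 / 100) * (1 / 2))\<^sup>2"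
      by (intro power_mono) auto
    then have "(p * sin th * D)\<^sup>2 \<ge> 6 / 1000" by (simp add: power_mult_distrib power_divide)
    moreover have "(q * sin z)\<^sup>2 \<ge> 0" "(mode h la v)\<^sup>2 \<ge> 0" by auto
    ultimately show ?thesis using f g0 unfolding denom_def by argo
  next
    case B
    have "(1 / 2)\<^sup>2 * (1 / 8) \<le> q\<^sup>2 * (sin z)\<^sup>2"
      using B by (intro mult_mono power_mono) auto
    then have "(q * sin z)\<^sup>2 \<ge> 1 / 32" by (simp add: power_mult_distrib power2_eq_square mult_ac)
    moreover have "(p * sin th * D)\<^sup>2 \<ge> 0" "(mode h la v)\<^sup>2 \<ge> 0" by auto
    ultimately show ?thesis using f g0 unfolding denom_def by argo
  next
    case C
    then have "gap v = 1" by (simp add: gap_def v peak_1)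
    moreover have "(p * sin th * D)\<^sup>2 \<ge> 0" "(q * sin z)\<^sup>2 \<ge> 0" "(mode h la v)\<^sup>2 \<ge> 0" by auto
    ultimately show ?thesis using f unfolding denom_def by argo
  next
    case D
    have "93 / 100 \<le> \<bar>cos z\<bar>"
      by (rule abs_ge_of_square) (use D sin_cos_squared_add[of z] in \<open>auto simp: power2_eq_square\<close>)
    then have "1 * (93 / 100) \<le> q * \<bar>cos z\<bar>" using D by (intro mult_mono) auto
    moreover have "p * \<bar>cos th\<bar> \<le> 1 / 2 * 1" using D p0 by (intro mult_mono) auto
    ultimately have "2 / 5 \<le> \<bar>mode h la v\<bar>"
      unfolding m using abs_triangle_ineq2[of "q * cos z" "- (p * cos th)"] p0 by (auto simp: abs_mult add.commute)
    then have "(2 / 5)\<^sup>2 \<le> \<bar>mode h la v\<bar>\<^sup>2" by (intro power_mono) auto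
    then have "16 / 100 \<le> (mode h la v)\<^sup>2" by (simp add: power2_eq_square)
    moreover have "(p * sin th * D)\<^sup>2 \<ge> 0" "(q * sin z)\<^sup>2 \<ge> 0" by auto
    ultimately show ?thesis using f g0 unfolding denom_def by argo
  next
    case E
    have "93 / 100 \<le> \<bar>cos x\<bar>"
      by (rule abs_ge_of_square) (use E sin_cos_squared_add[of x] in \<open>auto simp: power2_eq_square\<close>)
    then have "91 / 100 \<le> \<bar>cos th\<bar>" using close by linarith
    then have "1 * (91 / 100) \<le> p * \<bar>cos th\<bar>" using E by (intro mult_mono) auto
    moreover have "q * \<bar>cos z\<bar> \<le> 1 / 2 * 1" using E p0 by (intro mult_mono) auto
    ultimately have "2 / 5 \<le> \<bar>mode h la v\<bar>"
      unfolding m using abs_triangle_ineq2[of "p * cos th" "- (q * cos z)"] p0 by (auto simp: abs_mult)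
    then have "(2 / 5)\<^sup>2 \<le> \<bar>mode h la v\<bar>\<^sup>2" by (intro power_mono) auto
    then have "16 / 100 \<le> (mode h la v)\<^sup>2" by (simp add: power2_eq_square)
    moreover have "(p * sin th * D)\<^sup>2 \<ge> 0" "(q * sin z)\<^sup>2 \<ge> 0" by auto
    ultimately show ?thesis using f g0 unfolding denom_def by argo
  qed
qed

text \<open>On the support of \<open>gap\<close> both cosines are large. For |t| < 1 the residual
  vanishes by \<open>defect_mid\<close>; for |t| \<ge> 1 one coefficient is at most 1/2 and the
  other at least 1, so |mode| \<ge> 3/10, while \<open>gap\<close> is at most 1.\<close>

lemma resid_gap:
  assumes h: "h > 0" and b: "small_stretch h b" and i: "(la, ka) \<in> Idx b"
  shows "\<bar>resid h la v * gap v\<bar> \<le> 4 * \<bar>resid h la v\<bar> * \<bar>mode h la v\<bar>"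
proof (cases "gap v = 0")
  case False
  obtain t x z where v: "v = (t, x, z)" by (metis surj_pair)
  have b1: "b \<ge> 1" and la: "la \<ge> b" using b i by (auto simp: small_stretch_def Idx_def)
  have sx: "(sin x)\<^sup>2 < 1 / 4" and sz: "(sin z)\<^sup>2 < 1 / 4"
    using False peak_nz by (auto simp: gap_def v)
  show ?thesis
  proof (cases "\<bar>t\<bar> < 1")
    case True
    then have "resid h la v = 0"
      using defect_mid[OF h _ True sx, of la z] la b1 by (simp add: resid_def v)
    then show ?thesis by simp
  next
    case t: False
    have g: "\<bar>gap v\<bar> \<le> 1"
      using peak_range[of x] peak_range[of z] by (simp add: gap_def v mult_le_one)
    have cx: "43 / 50 \<le> \<bar>cos x\<bar>" and cz: "43 / 50 \<le> \<bar>cos z\<bar>"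
      by (rule abs_ge_of_square; use sx sz sin_cos_squared_add[of x] sin_cos_squared_add[of z] in \<open>simp add: power2_eq_square\<close>)+
    define p q th where "p = profile t" and "q = profile (- t)" and "th = theta h la v"
    have p0: "p \<ge> 0" "q \<ge> 0" by (simp_all add: p_def q_def profile_nonneg)
    have close: "\<bar>cos th - cos x\<bar> \<le> 1 / 50"
      using theta_close[OF h b la, of v] by (simp_all add: v th_def)
    have m: "mode h la v = p * cos th + q * cos z" by (simp add: mode_def v p_def q_def th_def)
    have "3 / 10 \<le> \<bar>mode h la v\<bar>"
    proof (cases "t \<ge> 1")
      case True
      then have pq: "p \<le> 1 / 2" "q \<ge> 1" using profile_le_half profile_ge_1[of "- t"] by (auto simp: p_def q_def)
      have "1 * (43 / 50) \<le> q * \<bar>cos z\<bar>" using pq cz by (intro mult_mono) auto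
      moreover have "p * \<bar>cos th\<bar> \<le> 1 / 2 * 1" using pq p0 by (intro mult_mono) auto
      ultimately show ?thesis
        unfolding m using abs_triangle_ineq2[of "q * cos z" "- (p * cos th)"] p0 by (auto simp: abs_mult add.commute)
    next
      case False
      then have "t \<le> -1" using t by linarith
      then have pq: "q \<le> 1 / 2" "p \<ge> 1" using profile_le_half[of "- t"] profile_ge_1[of t] by (auto simp: p_def q_def)
      have "41 / 50 \<le> \<bar>cos th\<bar>" using cx close by linarith
      then have "1 * (41 / 50) \<le> p * \<bar>cos th\<bar>" using pq by (intro mult_mono) auto
      moreover have "q * \<bar>cos z\<bar> \<le> 1 / 2 * 1" using pq p0 by (intro mult_mono) auto
      ultimately show ?thesis
        unfolding m using abs_triangle_ineq2[of "p * cos th" "- (q * cos z)"] p0 by (auto simp: abs_mult)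
    qed
    then have "\<bar>gap v\<bar> \<le> 4 * \<bar>mode h la v\<bar>" using g by linarith
    then have "\<bar>resid h la v\<bar> * \<bar>gap v\<bar> \<le> \<bar>resid h la v\<bar> * (4 * \<bar>mode h la v\<bar>)"
      by (intro mult_left_mono) auto
    then show ?thesis by (simp add: abs_mult mult_ac)
  qed
qed simp

lemma lbd_resid:
  assumes h: "h > 0" and b: "b \<ge> 1"
  shows "lbd (Idx b) slab k (\<lambda>i. resid h (fst i))"
  unfolding resid_def[abs_def]
  by (intro lbd_mult lbd_diff lbd_comp[OF Ck_window] lbd_fst lbd_defect[OF h b] lbd_coeffs(6)[OF b] lbd_mode[OF h b])

lemma lbd_denom:
  assumes h: "h > 0" and b: "b \<ge> 1"
  shows "lbd (Idx b) slab k (\<lambda>i. denom h (fst i) (snd i))"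
  unfolding denom_def[abs_def] gap_def
  by (intro lbd_mult lbd_add lbd_power lbd_form[OF b] lbd_peak bl_fst_snd bl_snd_snd lbd_mode[OF h b])

lemma lbd_inverse_denom:
  assumes h: "h > 0" and b: "small_stretch h b"
  shows "lbd (Idx b) slab k (\<lambda>i v. inverse (denom h (fst i) (snd i) v))"
proof (rule lbd_inverse)
  show "lbd (Idx b) slab k (\<lambda>i. denom h (fst i) (snd i))"
    using b by (intro lbd_denom h) (simp add: small_stretch_def)
  show "1 / 1000 \<le> denom h (fst i) (snd i) v" if "i \<in> Idx b" for i v
    using denom_ge[OF h b, of "fst i" "snd i"] that by simp
qed simp

lemma lbd_corr:
  assumes h: "h > 0" and b: "small_stretch h b"
  shows "lbd (Idx b) slab k (\<lambda>i. corr h (fst i) (snd i))"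
  unfolding corr_def[abs_def] using b
  by (intro lbd_mult lbd_const1 lbd_resid lbd_inverse_denom h b) (simp add: small_stretch_def)

lemma lbd_patch:
  assumes h: "h > 0" and b: "small_stretch h b"
  shows "lbd (Idx b) slab k (\<lambda>i. patch h (fst i) (snd i))"
  unfolding patch_def[abs_def] using b
  by (intro lbd_mult lbd_add lbd_coeffs lbd_corr lbd_mode h b) (simp_all add: small_stretch_def)

section \<open>The differential inequality for the corrected function\<close>

lemma lbd_boundedE:
  assumes "lbd I K k f"
  obtains B where "B \<ge> 0" "\<And>i x. i \<in> I \<Longrightarrow> x \<in> K \<Longrightarrow> \<bar>f i x\<bar> \<le> B"
proof -
  obtain B where "\<forall>i\<in>I. \<forall>x\<in>K. \<bar>f i x\<bar> \<le> B" using lbd_bounded[OF assms] by blast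
  then have "\<bar>f i x\<bar> \<le> max 0 B" if "i \<in> I" "x \<in> K" for i x using that by fastforce
  then show thesis by (intro that[of "max 0 B"]) auto
qed

lemma Ck_families:
  assumes h: "h > 0" and b: "small_stretch h b" and i: "(la, ka) \<in> Idx b"
  shows "Ck k (corr h la ka)" "Ck k (patch h la ka)"
  using lbd_imp_Ck[OF lbd_corr[OF h b] i] lbd_imp_Ck[OF lbd_patch[OF h b] i] by simp_all

text \<open>The gradient term equals \<open>denom\<close> minus m^2 minus \<open>gap\<close>, so
  \<open>2 * S\<close> times it cancels \<open>resid\<close> up to multiples of m^2 and
  \<open>gap\<close>. Every term that remains carries a factor m, except those with
  \<open>gap\<close> and \<open>window\<close>, for which \<open>resid_gap\<close> and
  \<open>window_defect\<close> supply it.\<close>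

lemma block_op_patch:
  assumes h: "h > 0" and b: "small_stretch h b" and i: "(la, ka) \<in> Idx b"
  defines "m \<equiv> mode h la" and "S \<equiv> corr h la ka"
  shows "la * patch h la ka v + block_op h la ka (patch h la ka) v =
     resid h la v * inverse (denom h la ka v) * (m v * m v)
   + inverse (denom h la ka v) * (resid h la v * gap v)
   + (1 - window (fst v)) * (defect h la v - rate h la * m v) + rate h la * m v
   + S v * (m v * m v) + 2 * (S v * (block_op h la ka m v / la)) * m v
   + m v * m v * (block_op h la ka S v / la) + 4 * (block_form h la ka S m v / la) * m v"
proof -
  have b1: "b \<ge> 1" using b by (simp add: small_stretch_def)
  have la: "la \<ge> 1" using Idx_bounds[OF i b1] by simp
  have Cm: "Ck k m" for k unfolding m_def by (rule Ck_mode)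
  have CS: "Ck k S" for k unfolding S_def by (rule Ck_families[OF h b i])
  define q0 where "q0 = block_form h la ka m m v / la"
  have op_mm: "block_op h la ka (\<lambda>v. m v * m v) v = 2 * m v * block_op h la ka m v + 2 * (la * q0)"
    using la by (simp add: block_op_mult[OF Cm Cm] q0_def)
  have "block_op h la ka (\<lambda>v. S v * (m v * m v)) v
      = S v * (2 * m v * block_op h la ka m v + 2 * (la * q0)) + m v * m v * block_op h la ka S v
        + 2 * (2 * m v * block_form h la ka S m v)"
    by (simp only: block_op_mult[OF CS Ck_mult[OF Cm Cm]] op_mm block_form_square[OF CS Cm])
  moreover have "block_op h la ka (patch h la ka) v
      = block_op h la ka m v + 1 / la * block_op h la ka (\<lambda>v. S v * (m v * m v)) v"
    unfolding patch_def[abs_def] m_def[symmetric] S_def[symmetric]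
    by (simp only: block_op_add[OF Cm Ck_mult[OF Ck_const Ck_mult[OF CS Ck_mult[OF Cm Cm]]]]
        block_op_scale[OF Ck_mult[OF CS Ck_mult[OF Cm Cm]]])
  ultimately have 1: "la * patch h la ka v + block_op h la ka (patch h la ka) v
      = (la * m v + block_op h la ka m v) + S v * (m v * m v)
        + 2 * (S v * (block_op h la ka m v / la)) * m v + 2 * S v * q0
        + m v * m v * (block_op h la ka S v / la) + 4 * (block_form h la ka S m v / la) * m v"
    using la unfolding patch_def m_def[symmetric] S_def[symmetric] by (simp add: field_simps)
  have nz: "denom h la ka v \<noteq> 0" using denom_ge[OF h b i, of v] by auto
  have q0: "q0 = denom h la ka v - m v * m v - gap v"
    by (simp add: denom_def q0_def m_def power2_eq_square)
  have "2 * S v * q0 = - (resid h la v) + resid h la v * inverse (denom h la ka v) * (m v * m v)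
      + inverse (denom h la ka v) * (resid h la v * gap v)"
    unfolding q0 S_def corr_def using nz by (simp add: field_simps)
  moreover have "la * m v + block_op h la ka m v = resid h la v
      + (1 - window (fst v)) * (defect h la v - rate h la * m v) + rate h la * m v"
    unfolding m_def defect_eq resid_def by (simp add: algebra_simps)
  ultimately show ?thesis unfolding 1 by simp
qed

text \<open>The first factor is nonzero only for |t| > 3. There \<open>mode\<close> is a single pure
  cosine, and \<open>defect\<close> is 0 on the left and -4 times the mode on the right.\<close>

lemma window_defect:
  assumes "\<bar>rate h la\<bar> \<le> B"
  shows "\<bar>(1 - window (fst v)) * (defect h la v - rate h la * mode h la v)\<bar> \<le> (4 + B) * \<bar>mode h la v\<bar>"
proof -
  obtain t x z where v: "v = (t, x, z)" by (metis surj_pair)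
  have w: "\<bar>1 - window t\<bar> \<le> 1" using window_range[of t] by simp
  consider "\<bar>t\<bar> \<le> 3" | "t < -3" | "t > 3" by linarith
  then show ?thesis
  proof cases
    case 1
    then show ?thesis using assms by (simp add: v window_mid)
  next
    case 2
    have "\<bar>1 - window t\<bar> * (\<bar>rate h la\<bar> * \<bar>mode h la v\<bar>) \<le> 1 * ((4 + B) * \<bar>mode h la v\<bar>)"
      using w assms by (intro mult_mono) auto
    then show ?thesis using defect_left[OF 2] by (simp add: v abs_mult)
  next
    case 3
    have eq: "(1 - window t) * (defect h la (t, x, z) - rate h la * mode h la (t, x, z))
        = (1 - window t) * ((- 4 - rate h la) * mode h la (t, x, z))"
      using defect_right[OF 3] by (simp add: algebra_simps)
    have "\<bar>1 - window t\<bar> * (\<bar>- 4 - rate h la\<bar> * \<bar>mode h la v\<bar>) \<le> 1 * ((4 + B) * \<bar>mode h la v\<bar>)"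
      using w assms by (intro mult_mono) auto
    then show ?thesis unfolding v fst_conv eq by (simp only: v abs_mult mult_1)
  qed
qed

lemma abs_sum8:
  fixes x1 :: real
  assumes "\<bar>x1\<bar> \<le> y1" "\<bar>x2\<bar> \<le> y2" "\<bar>x3\<bar> \<le> y3" "\<bar>x4\<bar> \<le> y4"
    "\<bar>x5\<bar> \<le> y5" "\<bar>x6\<bar> \<le> y6" "\<bar>x7\<bar> \<le> y7" "\<bar>x8\<bar> \<le> y8"
  shows "\<bar>x1 + x2 + x3 + x4 + x5 + x6 + x7 + x8\<bar> \<le> y1 + y2 + y3 + y4 + y5 + y6 + y7 + y8"
  using assms unfolding abs_le_iff by linarith

lemma patch_estimate:
  assumes h: "h > 0" and b: "small_stretch h b"
  shows "\<exists>b' C. b' \<ge> b \<and> C \<ge> 0 \<and> (\<forall>la ka v. (la, ka) \<in> Idx b' \<longrightarrow> v \<in> slab \<longrightarrow>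
     \<bar>patch h la ka v\<bar> \<le> C \<and> \<bar>la * patch h la ka v + block_op h la ka (patch h la ka) v\<bar> \<le> C * \<bar>patch h la ka v\<bar>)"
proof -
  have b1: "b \<ge> 1" using b by (simp add: small_stretch_def)
  obtain BG where BG: "BG \<ge> 0" "\<And>i v. i \<in> Idx b \<Longrightarrow> v \<in> slab \<Longrightarrow> \<bar>mode h (fst i) v\<bar> \<le> BG"
    using lbd_boundedE[OF lbd_mode[OF h b1, of 0]] by metis
  obtain BS where BS: "BS \<ge> 0" "\<And>i v. i \<in> Idx b \<Longrightarrow> v \<in> slab \<Longrightarrow> \<bar>corr h (fst i) (snd i) v\<bar> \<le> BS"
    using lbd_boundedE[OF lbd_corr[OF h b, of 0]] by metis
  obtain BR where BR: "BR \<ge> 0" "\<And>i v. i \<in> Idx b \<Longrightarrow> v \<in> slab \<Longrightarrow> \<bar>resid h (fst i) v\<bar> \<le> BR"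
    using lbd_boundedE[OF lbd_resid[OF h b1, of 0]] by metis
  obtain BQ where BQ: "BQ \<ge> 0" "\<And>i v. i \<in> Idx b \<Longrightarrow> v \<in> slab \<Longrightarrow> \<bar>inverse (denom h (fst i) (snd i) v)\<bar> \<le> BQ"
    using lbd_boundedE[OF lbd_inverse_denom[OF h b, of 0]] by metis
  obtain Ba where Ba: "Ba \<ge> 0" "\<And>i v. i \<in> Idx b \<Longrightarrow> v \<in> slab \<Longrightarrow>
      \<bar>block_op h (fst i) (snd i) (mode h (fst i)) v / fst i\<bar> \<le> Ba"
    using lbd_boundedE[OF lbd_op[OF b1 lbd_mode[OF h b1], where h = h and k = 0]] by metis
  obtain Bb where Bb: "Bb \<ge> 0" "\<And>i v. i \<in> Idx b \<Longrightarrow> v \<in> slab \<Longrightarrow>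
      \<bar>block_op h (fst i) (snd i) (corr h (fst i) (snd i)) v / fst i\<bar> \<le> Bb"
    using lbd_boundedE[OF lbd_op[OF b1 lbd_corr[OF h b], where h = h and k = 0]] by metis
  obtain Bc where Bc: "Bc \<ge> 0" "\<And>i v. i \<in> Idx b \<Longrightarrow> v \<in> slab \<Longrightarrow>
      \<bar>block_form h (fst i) (snd i) (corr h (fst i) (snd i)) (mode h (fst i)) v / fst i\<bar> \<le> Bc"
    using lbd_boundedE[OF lbd_form[OF b1 lbd_corr[OF h b] lbd_mode[OF h b1], where h = h and k = 0]] by metis
  obtain Br where Br: "Br \<ge> 0" "\<And>i v. i \<in> Idx b \<Longrightarrow> v \<in> slab \<Longrightarrow> \<bar>rate h (fst i)\<bar> \<le> Br"
    using lbd_boundedE[OF lbd_coeffs(6)[OF b1, where K = slab and k = 0 and h = h]] by metis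
  define C1 where "C1 = BR * BQ * BG + BQ * (4 * BR) + (4 + Br) + Br + BS * BG + 2 * (BS * Ba) + BG * Bb + 4 * Bc"
  have C1: "C1 \<ge> 0" unfolding C1_def
    using BG(1) BS(1) BR(1) BQ(1) Ba(1) Bb(1) Bc(1) Br(1) by (intro add_nonneg_nonneg mult_nonneg_nonneg) auto
  \<comment> \<open>Beyond this value \<open>S * m / la\<close> is at most 1/2 in absolute value, so
    \<open>patch\<close> and \<open>mode\<close> agree up to a factor of 2 and have the same
    zeros.\<close>
  define b' where "b' = b + 2 * BS * BG"
  define C where "C = 2 * C1 + 2 * BG"
  have b': "b' \<ge> b" using BS(1) BG(1) by (simp add: b'_def)
  have "\<bar>patch h la ka v\<bar> \<le> C \<and> \<bar>la * patch h la ka v + block_op h la ka (patch h la ka) v\<bar> \<le> C * \<bar>patch h la ka v\<bar>"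
    if i': "(la, ka) \<in> Idx b'" and v: "v \<in> slab" for la ka v
  proof -
    have i: "(la, ka) \<in> Idx b" and lab': "la \<ge> b'" using i' b' by (auto simp: Idx_def)
    define m S R Qi where "m = mode h la v" and "S = corr h la ka v" and "R = resid h la v"
      and "Qi = inverse (denom h la ka v)"
    have la: "la \<ge> 1" using Idx_bounds[OF i b1] by simp
    note B = BG(2)[OF i v, unfolded fst_conv, folded m_def] BS(2)[OF i v, unfolded fst_conv snd_conv, folded S_def]
      BR(2)[OF i v, unfolded fst_conv, folded R_def] BQ(2)[OF i v, unfolded fst_conv snd_conv, folded Qi_def]
      Ba(2)[OF i v, unfolded fst_conv snd_conv] Bb(2)[OF i v, unfolded fst_conv snd_conv]
      Bc(2)[OF i v, unfolded fst_conv snd_conv] Br(2)[OF i v, unfolded fst_conv]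
    define a bb c where "a = block_op h la ka (mode h la) v / la" and "bb = block_op h la ka (corr h la ka) v / la"
      and "c = block_form h la ka (corr h la ka) (mode h la) v / la"
    have B': "\<bar>a\<bar> \<le> Ba" "\<bar>bb\<bar> \<le> Bb" "\<bar>c\<bar> \<le> Bc" using B unfolding a_def bb_def c_def by auto
    have E: "la * patch h la ka v + block_op h la ka (patch h la ka) v =
       R * Qi * (m * m) + Qi * (R * gap v) + (1 - window (fst v)) * (defect h la v - rate h la * m) + rate h la * m
     + S * (m * m) + 2 * (S * a) * m + m * m * bb + 4 * c * m"
      unfolding block_op_patch[OF h b i] a_def bb_def c_def m_def S_def R_def Qi_def ..
    have T1: "\<bar>R * Qi * (m * m)\<bar> \<le> (BR * BQ * BG) * \<bar>m\<bar>"
      using mult_mono[OF mult_mono[OF mult_mono[OF B(3) B(4)] B(1)] order_refl, of "\<bar>m\<bar>"] BR(1) BQ(1) BG(1)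
      by (simp add: abs_mult mult_ac)
    have "\<bar>R * gap v\<bar> \<le> 4 * \<bar>R\<bar> * \<bar>m\<bar>"
      using resid_gap[OF h b i, of v] unfolding R_def m_def .
    also have "\<dots> \<le> 4 * BR * \<bar>m\<bar>" using B(3) by (intro mult_right_mono mult_left_mono) auto
    finally have T2: "\<bar>Qi * (R * gap v)\<bar> \<le> (BQ * (4 * BR)) * \<bar>m\<bar>"
      using mult_mono[OF B(4), of "\<bar>R * gap v\<bar>" "4 * BR * \<bar>m\<bar>"] BQ(1) by (simp add: abs_mult mult_ac)
    have T3: "\<bar>(1 - window (fst v)) * (defect h la v - rate h la * m)\<bar> \<le> (4 + Br) * \<bar>m\<bar>"
      unfolding m_def by (rule window_defect[OF B(8)])
    have T4: "\<bar>rate h la * m\<bar> \<le> Br * \<bar>m\<bar>"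
      unfolding abs_mult by (rule mult_right_mono[OF B(8)]) simp
    have T5: "\<bar>S * (m * m)\<bar> \<le> (BS * BG) * \<bar>m\<bar>"
      using mult_mono[OF mult_mono[OF B(2) B(1)] order_refl, of "\<bar>m\<bar>"] BS(1) BG(1)
      by (simp add: abs_mult mult_ac)
    have T6: "\<bar>2 * (S * a) * m\<bar> \<le> (2 * (BS * Ba)) * \<bar>m\<bar>"
      using mult_mono[OF mult_mono[OF B(2) B'(1)] order_refl, of "\<bar>m\<bar>"] BS(1) Ba(1)
      by (simp add: abs_mult mult_ac)
    have T7: "\<bar>m * m * bb\<bar> \<le> (BG * Bb) * \<bar>m\<bar>"
      using mult_mono[OF mult_mono[OF B(1) B'(2)] order_refl, of "\<bar>m\<bar>"] BG(1) Bb(1)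
      by (simp add: abs_mult mult_ac)
    have T8: "\<bar>4 * c * m\<bar> \<le> (4 * Bc) * \<bar>m\<bar>"
      using mult_right_mono[OF B'(3), of "\<bar>m\<bar>"] by (simp add: abs_mult mult_ac)
    have C1m: "C1 * \<bar>m\<bar> = (BR * BQ * BG) * \<bar>m\<bar> + (BQ * (4 * BR)) * \<bar>m\<bar> + (4 + Br) * \<bar>m\<bar> + Br * \<bar>m\<bar>
        + (BS * BG) * \<bar>m\<bar> + (2 * (BS * Ba)) * \<bar>m\<bar> + (BG * Bb) * \<bar>m\<bar> + (4 * Bc) * \<bar>m\<bar>"
      unfolding C1_def distrib_right ..
    have EC: "\<bar>la * patch h la ka v + block_op h la ka (patch h la ka) v\<bar> \<le> C1 * \<bar>m\<bar>"
      using abs_sum8[OF T1 T2 T3 T4 T5 T6 T7 T8] by (simp only: E C1m)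
    have sm: "\<bar>S * m / la\<bar> \<le> 1 / 2"
    proof -
      have "\<bar>S * m\<bar> \<le> BS * BG" unfolding abs_mult by (rule mult_mono[OF B(2) B(1) BS(1)]) simp
      also have "\<dots> \<le> la / 2" using lab' b1 by (simp add: b'_def)
      finally show ?thesis using la by (simp add: abs_divide divide_le_eq)
    qed
    have P: "patch h la ka v = m * (1 + S * m / la)"
      by (simp add: patch_def m_def S_def algebra_simps)
    have sm': "1 / 2 \<le> \<bar>1 + S * m / la\<bar>" "\<bar>1 + S * m / la\<bar> \<le> 2" using sm by linarith+
    have "\<bar>m\<bar> * (1 / 2) \<le> \<bar>m\<bar> * \<bar>1 + S * m / la\<bar>"
      using sm' by (intro mult_left_mono) auto
    then have lower: "\<bar>m\<bar> \<le> 2 * \<bar>patch h la ka v\<bar>" by (simp add: P abs_mult)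
    have "\<bar>m\<bar> * \<bar>1 + S * m / la\<bar> \<le> BG * 2"
      using sm' B(1) BG(1) by (intro mult_mono) auto
    then have upper: "\<bar>patch h la ka v\<bar> \<le> C" using C1 by (simp add: P abs_mult C_def)
    have "C1 * \<bar>m\<bar> \<le> C1 * (2 * \<bar>patch h la ka v\<bar>)" using lower C1 by (intro mult_left_mono)
    also have "\<dots> \<le> C * \<bar>patch h la ka v\<bar>"
      using BG(1) by (simp add: C_def algebra_simps)
    finally show ?thesis using EC upper by simp
  qed
  moreover have "C \<ge> 0" using C1 BG(1) by (simp add: C_def)
  ultimately show ?thesis using b' by blast
qed

section \<open>Adjusting the decay rate at the end of a block\<close>

definition tilt :: "real \<Rightarrow> real" where
  "tilt t = smoothstep (2 * t - 9) * (t - 5)"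

text \<open>The next block decays at the rate sqrt(la + 4). This is the required increase of the
  rate measured in block time, and it stays bounded in \<open>la\<close>. As \<open>tilt\<close> is
  0 up to 9/2 and t - 5 from 5 on, the amplitude returns to 1 exactly at the end of the
  block.\<close>

definition slope :: "real \<Rightarrow> real \<Rightarrow> real" where
  "slope h la = sqrt la * (sqrt (la + 4) - sqrt la) / h"

definition amplitude :: "real \<Rightarrow> real \<Rightarrow> real \<times> real \<times> real \<Rightarrow> real" where
  "amplitude h la v = exp (- (slope h la * tilt (fst v)))"

definition block :: "real \<Rightarrow> real \<Rightarrow> real \<Rightarrow> real \<times> real \<times> real \<Rightarrow> real" where
  "block h la ka v = amplitude h la v * patch h la ka v"

lemma slope_bounds:
  assumes "h > 0" "la \<ge> 1"
  shows "0 \<le> slope h la" "slope h la \<le> 4 / h"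
proof -
  have s: "sqrt la \<le> sqrt (la + 4)" "sqrt la \<ge> 1" using assms by auto
  show "0 \<le> slope h la" using s assms by (simp add: slope_def)
  have "sqrt la * sqrt (la + 4) \<le> la + 4"
    using s assms mult_right_mono[of "sqrt la" "sqrt (la + 4)" "sqrt (la + 4)"] by simp
  then have "sqrt la * (sqrt (la + 4) - sqrt la) \<le> 4"
    using assms by (simp add: right_diff_distrib)
  then show "slope h la \<le> 4 / h" unfolding slope_def using assms by (intro divide_right_mono) auto
qed

lemma Ck_tilt: "Ck k tilt"
  unfolding tilt_def[abs_def] by (intro Ck_intros Ck_smoothstep_comp Ck_ident)

lemma lbd_amplitude:
  assumes h: "h > 0" and b: "b \<ge> 1"
  shows "lbd (Idx b) slab k (\<lambda>i. amplitude h (fst i))" "lbd (Idx b) slab k (\<lambda>i v. inverse (amplitude h (fst i) v))"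
proof -
  have s: "lbd (Idx b) slab k (\<lambda>i v. slope h (fst i) * tilt (fst v))"
  proof (intro lbd_mult lbd_comp[OF Ck_tilt] lbd_fst lbd_const exI ballI)
    fix i assume "i \<in> Idx b"
    then show "\<bar>slope h (fst i)\<bar> \<le> 4 / h"
      using slope_bounds[OF h, of "fst i"] Idx_bounds(1)[OF _ b] by simp
  qed
  show "lbd (Idx b) slab k (\<lambda>i. amplitude h (fst i))"
    unfolding amplitude_def[abs_def] by (intro lbd_comp[OF Ck_exp] lbd_minus s)
  show "lbd (Idx b) slab k (\<lambda>i v. inverse (amplitude h (fst i) v))"
    unfolding amplitude_def exp_minus inverse_inverse_eq by (intro lbd_comp[OF Ck_exp] s)
qed

lemma Ck_amplitude: "Ck k (amplitude h la)"
  unfolding amplitude_def[abs_def]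
  by (intro Ck_comp[OF Ck_exp] Ck_comp[OF Ck_tilt] Ck_intros Ck_linear bounded_linear_fst)

lemma pd_amplitude: "pd2 (amplitude h la) = (\<lambda>v. 0)" "pd3 (amplitude h la) = (\<lambda>v. 0)"
proof -
  show "pd2 (amplitude h la) = (\<lambda>v. 0)"
  proof (rule ext)
    fix v :: "real \<times> real \<times> real"
    obtain t x z where v: "v = (t, x, z)" by (metis surj_pair)
    show "pd2 (amplitude h la) v = 0"
      unfolding v by (rule partial2I[OF Ck_differentiable[OF Ck_amplitude]]) (simp add: amplitude_def)
  qed
  show "pd3 (amplitude h la) = (\<lambda>v. 0)"
  proof (rule ext)
    fix v :: "real \<times> real \<times> real"
    obtain t x z where v: "v = (t, x, z)" by (metis surj_pair)
    show "pd3 (amplitude h la) v = 0"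
      unfolding v by (rule partial3I[OF Ck_differentiable[OF Ck_amplitude]]) (simp add: amplitude_def)
  qed
qed

lemma block_op_amplitude: "block_op h la ka (amplitude h la) v
    = h\<^sup>2 / la * pd1 (pd1 (amplitude h la)) v - 2 * h * pd1 (amplitude h la) v"
  by (simp add: block_op_def pd_amplitude)

lemma amplitude_left: "t \<le> 9 / 2 \<Longrightarrow> amplitude h la (t, x, z) = 1"
  by (simp add: amplitude_def tilt_def smoothstep_0)

lemma patch_left: "t \<le> -4 \<Longrightarrow> patch h la ka (t, x, z) = cos x"
  by (simp add: patch_def corr_def resid_def window_far mode_def profile_left profile_right
      theta_def warp_def switch_left)

lemma patch_right: "t \<ge> 4 \<Longrightarrow> patch h la ka (t, x, z) = cos z"
  by (simp add: patch_def corr_def resid_def window_far mode_def profile_left profile_right)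

text \<open>\<open>amplitude\<close> is constant for t < 9/2 and \<open>patch\<close> no longer
  depends on t for t > 4. Hence no cross term arises in \<open>block_op\<close> of their
  product.\<close>

lemma amplitude_patch:
  assumes "h > 0" "small_stretch h b" "(la, ka) \<in> Idx b"
  shows "pd1 (amplitude h la) v * pd1 (patch h la ka) v = 0"
proof -
  obtain t x z where v: "v = (t, x, z)" by (metis surj_pair)
  show ?thesis
  proof (cases "t < 9 / 2")
    case True
    have "pd1 (amplitude h la) v = 0"
      unfolding v
    proof (rule partial1I[OF Ck_differentiable[OF Ck_amplitude]])
      show "((\<lambda>s. amplitude h la (s, x, z)) has_real_derivative 0) (at t)"
        by (rule has_field_derivative_transform_within_open[OF DERIV_const[of 1] open_lessThan[of "9 / 2"]])
          (use True in \<open>auto simp: amplitude_left\<close>)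
    qed
    then show ?thesis by simp
  next
    case False
    then have t: "t > 4" by simp
    have "pd1 (patch h la ka) v = 0"
      unfolding v
    proof (rule partial1I[OF Ck_differentiable[OF Ck_families(2)[OF assms]]])
      show "((\<lambda>s. patch h la ka (s, x, z)) has_real_derivative 0) (at t)"
        by (rule has_field_derivative_transform_within_open[OF DERIV_const[of "cos z"] open_greaterThan[of 4]])
          (use t in \<open>auto simp: patch_right\<close>)
    qed
    then show ?thesis by simp
  qed
qed

lemma sin_cos_shift: "sin (x + 2 * pi * of_int n) = sin x" "cos (x + 2 * pi * of_int n) = cos x"
  by (simp_all add: sin_add cos_add cos_int_2pin sin_int_2pin)

text \<open>\<open>theta\<close> is shifted by a multiple of 2 pi, and the derivatives inside
  \<open>defect\<close> and \<open>denom\<close> inherit the periodicity by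
  \<open>dir_deriv_shift\<close>. This lets the pieces descend to the torus, where integral
  frequencies change by multiples of 2 pi.\<close>

lemma block_periodic: "block h la ka (v + (0, 2 * pi * of_int n, 2 * pi * of_int k)) = block h la ka v"
proof -
  define a :: "real \<times> real \<times> real" where "a = (0, 2 * pi * of_int n, 2 * pi * of_int k)"
  have ph: "phase (x + 2 * pi * of_int n) = phase x" "peak (x + 2 * pi * of_int n) = peak x" for x n
    by (simp_all add: phase_def peak_def sin_cos_shift)
  have w: "warp (v + a) = warp v" for v by (simp add: warp_def a_def ph)
  have th: "theta h la (v + a) = theta h la v + 2 * pi * of_int n" for v
    by (simp add: theta_def w) (simp add: a_def)
  have m: "mode h la (v + a) = mode h la v" for v
    by (simp add: mode_def th sin_cos_shift) (simp add: a_def sin_cos_shift)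
  have ms: "dir_deriv e (mode h la) (v + a) = dir_deriv e (mode h la) v" for e v
    by (rule dir_deriv_shift) (rule m)
  have mss: "dir_deriv d (dir_deriv e (mode h la)) (v + a) = dir_deriv d (dir_deriv e (mode h la)) v" for d e v
    by (rule dir_deriv_shift) (rule ms)
  have ws: "dir_deriv e warp (v + a) = dir_deriv e warp v" for e v
    by (rule dir_deriv_shift) (rule w)
  have wss: "dir_deriv d (dir_deriv e warp) (v + a) = dir_deriv d (dir_deriv e warp) v" for d e v
    by (rule dir_deriv_shift) (rule ws)
  have f: "fst (v + a) = fst v" "cos (snd (snd (v + a))) = cos (snd (snd v))"
    "peak (fst (snd (v + a))) = peak (fst (snd v))" "peak (snd (snd (v + a))) = peak (snd (snd v))" for v
    by (simp_all add: a_def ph sin_cos_shift)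
  have "block h la ka (v + a) = block h la ka v"
    unfolding block_def amplitude_def patch_def corr_def resid_def denom_def gap_def defect_def block_form_def
      th sin_cos_shift m ms mss ws wss f ..
  then show ?thesis by (simp add: a_def)
qed

text \<open>The product rule adds only the term P times \<open>block_op\<close> of the amplitude.
  The amplitude and its inverse are uniformly bounded on \<open>slab\<close>, so this term is again
  a bounded multiple of the block.\<close>

theorem block_exists:
  assumes h: "h > 0"
  shows "\<exists>b C. b \<ge> 1 \<and> C \<ge> 0 \<and> (\<forall>la ka. (la, ka) \<in> Idx b \<longrightarrow> (\<forall>k. Ck k (block h la ka)) \<and>
    (\<forall>v \<in> slab. \<bar>block h la ka v\<bar> \<le> C \<and>
       \<bar>la * block h la ka v + block_op h la ka (block h la ka) v\<bar> \<le> C * \<bar>block h la ka v\<bar>))"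
proof -
  obtain b0 where b0: "small_stretch h b0" using small_stretch_exists[OF h] by blast
  then have b01: "b0 \<ge> 1" by (simp add: small_stretch_def)
  obtain b C where b: "b \<ge> b0" and C: "C \<ge> 0" and est: "\<And>la ka v. (la, ka) \<in> Idx b \<Longrightarrow> v \<in> slab \<Longrightarrow>
     \<bar>patch h la ka v\<bar> \<le> C \<and> \<bar>la * patch h la ka v + block_op h la ka (patch h la ka) v\<bar> \<le> C * \<bar>patch h la ka v\<bar>"
    using patch_estimate[OF h b0] by metis
  have b1: "b \<ge> 1" using b b01 by simp
  obtain B1 where B1: "B1 \<ge> 0" "\<And>i v. i \<in> Idx b \<Longrightarrow> v \<in> slab \<Longrightarrow> \<bar>amplitude h (fst i) v\<bar> \<le> B1"
    using lbd_boundedE[OF lbd_amplitude(1)[OF h b1, of 0]] by metis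
  obtain B2 where B2: "B2 \<ge> 0" "\<And>i v. i \<in> Idx b \<Longrightarrow> v \<in> slab \<Longrightarrow> \<bar>inverse (amplitude h (fst i) v)\<bar> \<le> B2"
    using lbd_boundedE[OF lbd_amplitude(2)[OF h b1, of 0]] by metis
  have L3: "lbd (Idx b) slab 0 (\<lambda>i v. h\<^sup>2 * (1 / fst i) * pd1 (pd1 (amplitude h (fst i))) v - 2 * h * pd1 (amplitude h (fst i)) v)"
    by (intro lbd_diff lbd_mult lbd_const1 lbd_coeffs[OF b1] lbd_dir_deriv lbd_amplitude[OF h b1])
  obtain B3 where B3: "B3 \<ge> 0" "\<And>i v. i \<in> Idx b \<Longrightarrow> v \<in> slab \<Longrightarrow>
      \<bar>h\<^sup>2 * (1 / fst i) * pd1 (pd1 (amplitude h (fst i))) v - 2 * h * pd1 (amplitude h (fst i)) v\<bar> \<le> B3"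
    using lbd_boundedE[OF L3] by metis
  define C' where "C' = B1 * C + C + B3 * B2"
  have C': "C' \<ge> 0" using C B1 B2 B3 by (simp add: C'_def)
  have "(\<forall>k. Ck k (block h la ka)) \<and> (\<forall>v \<in> slab. \<bar>block h la ka v\<bar> \<le> C' \<and>
       \<bar>la * block h la ka v + block_op h la ka (block h la ka) v\<bar> \<le> C' * \<bar>block h la ka v\<bar>)"
    if i: "(la, ka) \<in> Idx b" for la ka
  proof (intro conjI allI ballI)
    have i0: "(la, ka) \<in> Idx b0" using i b by (auto simp: Idx_def)
    have Cp: "Ck k (patch h la ka)" for k by (rule Ck_families[OF h b0 i0])
    show "Ck k (block h la ka)" for k
      unfolding block_def[abs_def] by (intro Ck_mult Ck_amplitude Cp)
    fix v assume v: "v \<in> slab"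
    define g P where "g = amplitude h la v" and "P = patch h la ka v"
    have g: "\<bar>g\<bar> \<le> B1" "\<bar>inverse g\<bar> \<le> B2" "g > 0"
      using B1(2)[OF i v] B2(2)[OF i v] by (auto simp: g_def amplitude_def)
    have P: "\<bar>P\<bar> \<le> C" "\<bar>la * P + block_op h la ka (patch h la ka) v\<bar> \<le> C * \<bar>P\<bar>"
      using est[OF i v] by (auto simp: P_def)
    have bl: "block h la ka v = g * P" by (simp add: block_def g_def P_def)
    have "\<bar>g\<bar> * \<bar>P\<bar> \<le> B1 * C" using g P B1 by (intro mult_mono) auto
    moreover have "0 \<le> C + B3 * B2" using C B3(1) B2(1) by simp
    ultimately show "\<bar>block h la ka v\<bar> \<le> C'" unfolding bl C'_def abs_mult by linarith
    have "block_form h la ka (amplitude h la) (patch h la ka) v = 0"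
      using amplitude_patch[OF h b0 i0, of v] by (simp add: block_form_def pd_amplitude)
    then have op: "la * block h la ka v + block_op h la ka (block h la ka) v
        = g * (la * P + block_op h la ka (patch h la ka) v) + P * block_op h la ka (amplitude h la) v"
      unfolding block_def[abs_def] block_op_mult[OF Ck_amplitude Cp]
      by (simp add: g_def P_def algebra_simps)
    have "\<bar>block_op h la ka (amplitude h la) v\<bar> \<le> B3 * 1"
      using B3(2)[OF i v] by (simp add: block_op_amplitude)
    also have "\<dots> \<le> B3 * (B2 * g)"
    proof (intro mult_left_mono B3)
      have "inverse g * g \<le> B2 * g" using g by (intro mult_right_mono) auto
      then show "1 \<le> B2 * g" using g by simp
    qed
    finally have og: "\<bar>block_op h la ka (amplitude h la) v\<bar> \<le> B3 * B2 * g" by simp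
    have "\<bar>g * (la * P + block_op h la ka (patch h la ka) v) + P * block_op h la ka (amplitude h la) v\<bar>
        \<le> \<bar>g\<bar> * \<bar>la * P + block_op h la ka (patch h la ka) v\<bar> + \<bar>P\<bar> * \<bar>block_op h la ka (amplitude h la) v\<bar>"
      unfolding abs_mult[symmetric] by (rule abs_triangle_ineq)
    also have "\<dots> \<le> \<bar>g\<bar> * (C * \<bar>P\<bar>) + \<bar>P\<bar> * (B3 * B2 * g)"
      by (intro add_mono mult_left_mono P og) auto
    also have "\<dots> = (C + B3 * B2) * \<bar>block h la ka v\<bar>"
      using g by (simp add: bl abs_mult algebra_simps)
    also have "\<dots> \<le> C' * \<bar>block h la ka v\<bar>"
      using B1(1) C by (intro mult_right_mono) (auto simp: C'_def)
    finally show "\<bar>la * block h la ka v + block_op h la ka (block h la ka) v\<bar> \<le> C' * \<bar>block h la ka v\<bar>"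
      unfolding op .
  qed
  then show ?thesis using b1 C' by blast
qed

lemma block_left: "t \<le> -4 \<Longrightarrow> block h la ka (t, x, z) = cos x"
  by (simp add: block_def amplitude_left patch_left)

lemma block_right: "t \<ge> 5 \<Longrightarrow> block h la ka (t, x, z) = exp (- (slope h la * (t - 5))) * cos z"
  by (simp add: block_def amplitude_def tilt_def smoothstep_1 patch_right)

section \<open>Gluing\<close>

text \<open>Averaging over the signed cyclic permutations of \<open>(a, b, c)\<close> gives the mean value \<open>1/3\<close> of the squared cosine.\<close>

lemma transversal_vector:
  fixes x y z a b c :: int
  shows "\<exists>a' b' c'. a'\<^sup>2 + b'\<^sup>2 + c'\<^sup>2 = a\<^sup>2 + b\<^sup>2 + c\<^sup>2 \<and>
    3 * (x * a' + y * b' + z * c')\<^sup>2 \<le> (x\<^sup>2 + y\<^sup>2 + z\<^sup>2) * (a\<^sup>2 + b\<^sup>2 + c\<^sup>2)"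
proof (rule ccontr)
  assume no: "\<not> ?thesis"
  define q where "q = (\<lambda>a' b' c'. (x * a' + y * b' + z * c')\<^sup>2)"
  define P where "P = (x\<^sup>2 + y\<^sup>2 + z\<^sup>2) * (a\<^sup>2 + b\<^sup>2 + c\<^sup>2)"
  have gt: "P < 3 * q a' b' c'" if "a'\<^sup>2 + b'\<^sup>2 + c'\<^sup>2 = a\<^sup>2 + b\<^sup>2 + c\<^sup>2" for a' b' c'
    using no that unfolding P_def q_def by (meson not_le)
  have four: "q a' b' c' + q (- a') b' c' + q a' (- b') c' + q (- a') (- b') c'
      = 4 * (x\<^sup>2 * a'\<^sup>2 + y\<^sup>2 * b'\<^sup>2 + z\<^sup>2 * c'\<^sup>2)" for a' b' c'
    unfolding q_def by (simp add: power2_eq_square algebra_simps)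
  have "P = (x\<^sup>2 * a\<^sup>2 + y\<^sup>2 * b\<^sup>2 + z\<^sup>2 * c\<^sup>2) + (x\<^sup>2 * b\<^sup>2 + y\<^sup>2 * c\<^sup>2 + z\<^sup>2 * a\<^sup>2)
      + (x\<^sup>2 * c\<^sup>2 + y\<^sup>2 * a\<^sup>2 + z\<^sup>2 * b\<^sup>2)"
    unfolding P_def by (simp add: algebra_simps)
  then have "q a b c + q (- a) b c + q a (- b) c + q (- a) (- b) c
      + (q b c a + q (- b) c a + q b (- c) a + q (- b) (- c) a)
      + (q c a b + q (- c) a b + q c (- a) b + q (- c) (- a) b) = 4 * P"
    unfolding four by (simp add: algebra_simps)
  moreover have "P < 3 * q a b c" "P < 3 * q (- a) b c" "P < 3 * q a (- b) c" "P < 3 * q (- a) (- b) c"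
    "P < 3 * q b c a" "P < 3 * q (- b) c a" "P < 3 * q b (- c) a" "P < 3 * q (- b) (- c) a"
    "P < 3 * q c a b" "P < 3 * q (- c) a b" "P < 3 * q c (- a) b" "P < 3 * q (- c) (- a) b"
    by (simp_all add: gt)
  ultimately show False by linarith
qed

text \<open>A dependent choice: any representation of the next number as three squares is turned
  into one transversal to the vector already chosen.\<close>

lemma frequency_sequence:
  fixes n0 :: nat
  shows "\<exists>a b c :: nat \<Rightarrow> int. \<forall>j. (a j)\<^sup>2 + (b j)\<^sup>2 + (c j)\<^sup>2 = int (4 * (j + n0) + 1) \<and>
    3 * (a j * a (Suc j) + b j * b (Suc j) + c j * c (Suc j))\<^sup>2 \<le> int (4 * (j + n0) + 1) * int (4 * (Suc j + n0) + 1)"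
proof -
  define N where "N = (\<lambda>(a::int, b::int, c::int). a\<^sup>2 + b\<^sup>2 + c\<^sup>2)"
  define D where "D = (\<lambda>(a::int, b::int, c::int) (a'::int, b'::int, c'::int). a * a' + b * b' + c * c')"
  define l where "l = (\<lambda>j. int (4 * (j + n0) + 1))"
  have ex: "\<exists>a b c :: int. a\<^sup>2 + b\<^sup>2 + c\<^sup>2 = l j" for j
    using three_squares_mod4[of "4 * (j + n0) + 1"] unfolding l_def by (metis mod_mult_self4 mod_less one_less_numeral_iff semiring_norm(76))
  have "\<exists>k. \<forall>j. N (k j) = l j \<and> 3 * (D (k j) (k (Suc j)))\<^sup>2 \<le> l j * l (Suc j)"
  proof (rule dependent_nat_choice)
    show "\<exists>x. N x = l 0" using ex[of 0] by (auto simp: N_def)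
    fix v j assume v: "N v = l j"
    obtain a b c where abc: "v = (a, b, c)" by (metis surj_pair)
    obtain a' b' c' where "a'\<^sup>2 + b'\<^sup>2 + c'\<^sup>2 = l (Suc j)" using ex by blast
    then obtain a'' b'' c'' where "a''\<^sup>2 + b''\<^sup>2 + c''\<^sup>2 = l (Suc j)"
      "3 * (a * a'' + b * b'' + c * c'')\<^sup>2 \<le> (a\<^sup>2 + b\<^sup>2 + c\<^sup>2) * l (Suc j)"
      using transversal_vector[of a' b' c' a b c] by metis
    then have "N (a'', b'', c'') = l (Suc j) \<and> 3 * (D v (a'', b'', c''))\<^sup>2 \<le> l j * l (Suc j)"
      using v by (simp add: N_def D_def abc)
    then show "\<exists>v'. N v' = l (Suc j) \<and> 3 * (D v v')\<^sup>2 \<le> l j * l (Suc j)" by blast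
  qed
  then obtain k where k: "\<And>j. N (k j) = l j" "\<And>j. 3 * (D (k j) (k (Suc j)))\<^sup>2 \<le> l j * l (Suc j)" by blast
  show ?thesis
    using k by (intro exI[of _ "\<lambda>j. fst (k j)"] exI[of _ "\<lambda>j. fst (snd (k j))"] exI[of _ "\<lambda>j. snd (snd (k j))"])
      (simp add: N_def D_def l_def case_prod_unfold)
qed

lemma lattice_vectors:
  fixes n0 :: nat
  assumes "CARD('d::finite) \<ge> 3"
  shows "\<exists>k :: nat \<Rightarrow> real ^ 'd. (\<forall>j i. k j $ i \<in> \<int>) \<and> (\<forall>j. k j \<bullet> k j = 4 * (real j + real n0) + 1) \<and>
    (\<forall>j. (k j \<bullet> k (Suc j))\<^sup>2 \<le> (k j \<bullet> k j) * (k (Suc j) \<bullet> k (Suc j)) / 3)"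
proof -
  obtain S :: "'d set" where "card S = 3" using obtain_subset_with_card_n[OF assms] by metis
  then obtain p q r :: 'd where pqr: "p \<noteq> q" "q \<noteq> r" "p \<noteq> r" unfolding card_3_iff by blast
  obtain a b c :: "nat \<Rightarrow> int" where abc: "\<And>j. (a j)\<^sup>2 + (b j)\<^sup>2 + (c j)\<^sup>2 = int (4 * (j + n0) + 1)"
    "\<And>j. 3 * (a j * a (Suc j) + b j * b (Suc j) + c j * c (Suc j))\<^sup>2 \<le> int (4 * (j + n0) + 1) * int (4 * (Suc j + n0) + 1)"
    using frequency_sequence by metis
  define k :: "nat \<Rightarrow> real ^ 'd" where
    "k = (\<lambda>j. of_int (a j) *\<^sub>R axis p 1 + of_int (b j) *\<^sub>R axis q 1 + of_int (c j) *\<^sub>R axis r 1)"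
  have dot: "k j \<bullet> k l = of_int (a j * a l + b j * b l + c j * c l)" for j l
    using pqr by (simp add: k_def inner_add_left inner_add_right inner_axis_axis)
  have n: "k j \<bullet> k j = real_of_int (int (4 * (j + n0) + 1))" for j
    unfolding dot abc(1)[symmetric] by (simp add: power2_eq_square)
  have "k j $ i \<in> \<int>" for j i
    by (simp add: k_def axis_def)
  moreover have "(k j \<bullet> k (Suc j))\<^sup>2 \<le> (k j \<bullet> k j) * (k (Suc j) \<bullet> k (Suc j)) / 3" for j
  proof -
    have "real_of_int (3 * (a j * a (Suc j) + b j * b (Suc j) + c j * c (Suc j))\<^sup>2)
        \<le> real_of_int (int (4 * (j + n0) + 1) * int (4 * (Suc j + n0) + 1))"
      using abc(2)[of j] by (simp only: of_int_le_iff)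
    then show ?thesis unfolding n by (simp add: dot of_int_mult of_int_power)
  qed
  ultimately show ?thesis using n by (intro exI[of _ k]) auto
qed

section \<open>The Laplacian under reflection, affine substitution and conjugation\<close>

lemma laplacian_local:
  assumes "open U" "x \<in> U" "\<And>y. y \<in> U \<Longrightarrow> f y = g y"
  shows "laplacian f x = laplacian g x"
proof -
  have "dir_deriv e (dir_deriv e f) x = dir_deriv e (dir_deriv e g) x" for e
    by (rule dir_deriv_local[OF assms(1,2)]) (rule dir_deriv_local[OF assms(1) _ assms(3)])
  then show ?thesis by (simp add: laplacian_def)
qed

lemma dir_deriv_minus_direction:
  assumes "f differentiable (at x)"
  shows "dir_deriv (- e) f x = - dir_deriv e f x"
  using linear_neg[OF dir_deriv_linear[OF assms]] .

lemma dir_deriv_uminus: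
  assumes "f differentiable (at x)"
  shows "dir_deriv e (\<lambda>y. - f y) x = - dir_deriv e f x"
  by (rule dir_deriv_eqI) (intro derivative_intros has_derivative_dir_deriv[OF assms])

lemma dir_deriv_affine_fun:
  fixes A :: "'a::euclidean_space \<Rightarrow> 'b::euclidean_space"
  assumes "bounded_linear A" "Ck (Suc k) f"
  shows "dir_deriv e (\<lambda>y. f (A y + c)) = (\<lambda>x. dir_deriv (A e) f (A x + c))"
  by (rule ext) (rule dir_deriv_affine_comp[OF assms(1) Ck_differentiable[OF assms(2)]])

lemma dir_deriv2_affine:
  fixes A :: "'a::euclidean_space \<Rightarrow> 'b::euclidean_space"
  assumes "bounded_linear A" "Ck (Suc (Suc 0)) f"
  shows "dir_deriv e (dir_deriv e (\<lambda>y. f (A y + c))) x = dir_deriv (A e) (dir_deriv (A e) f) (A x + c)"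
proof -
  have "Ck (Suc 0) (dir_deriv (A e) f)" using assms(2) by (rule Ck_dir_deriv)
  then show ?thesis
    unfolding dir_deriv_affine_fun[OF assms] by (simp only: dir_deriv_affine_fun[OF assms(1)])
qed

definition flip :: "real \<times> (real ^ 'd::finite) \<Rightarrow> real \<times> (real ^ 'd)" where
  "flip x = (- fst x, snd x)"

lemma bounded_linear_flip: "bounded_linear flip"
  unfolding flip_def[abs_def]
  by (intro bounded_linear_Pair bounded_linear_minus bounded_linear_fst bounded_linear_snd)

lemma Ck_flip: "Ck k f \<Longrightarrow> Ck k (\<lambda>x. f (flip x))"
  using Ck_affine[OF _ bounded_linear_flip, of k f 0] by simp

lemma laplacian_flip:
  assumes "Ck (Suc (Suc 0)) f"
  shows "laplacian (\<lambda>x. f (flip x)) x = laplacian f (flip x)"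
proof -
  have 1: "dir_deriv e (dir_deriv e (\<lambda>x. f (flip x))) x = dir_deriv (flip e) (dir_deriv (flip e) f) (flip x)" for e
    using dir_deriv2_affine[OF bounded_linear_flip assms, of e 0 x] by simp
  have "dir_deriv (- e) (dir_deriv (- e) f) y = dir_deriv e (dir_deriv e f) y" for e y
  proof -
    have m: "dir_deriv (- e) f = (\<lambda>x. - dir_deriv e f x)"
      by (rule ext) (rule dir_deriv_minus_direction[OF Ck_differentiable[OF assms]])
    have C: "dir_deriv e f differentiable (at y)"
      using assms by (intro Ck_differentiable[of 0] Ck_dir_deriv)
    show ?thesis
      unfolding m dir_deriv_uminus[OF C] dir_deriv_minus_direction[OF C] by simp
  qed
  from this[of "(1, 0)"] show ?thesis
    unfolding laplacian_def 1 by (simp add: flip_def)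
qed

lemma dir_deriv_triple:
  assumes "f differentiable (at v)"
  shows "dir_deriv (a, b, c) f v = a * pd1 f v + b * pd2 f v + c * pd3 f v"
proof -
  have "(a, b, c) = a *\<^sub>R (1::real, 0::real, 0::real) + (b *\<^sub>R (0, 1, 0) + c *\<^sub>R (0, 0, 1))" by simp
  then show ?thesis
    using linear_add[OF dir_deriv_linear[OF assms]] linear_scale[OF dir_deriv_linear[OF assms]]
    by (simp only: real_scaleR_def add.assoc)
qed

lemma dir_deriv2_triple:
  assumes "Ck (Suc (Suc 0)) f"
  shows "dir_deriv (a, b, c) (dir_deriv (a, b, c) f) v = a * (a * pd1 (pd1 f) v + b * pd1 (pd2 f) v + c * pd1 (pd3 f) v)
    + b * (a * pd2 (pd1 f) v + b * pd2 (pd2 f) v + c * pd2 (pd3 f) v)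
    + c * (a * pd3 (pd1 f) v + b * pd3 (pd2 f) v + c * pd3 (pd3 f) v)"
proof -
  have C: "Ck (Suc 0) (dir_deriv e f)" for e using assms by (rule Ck_dir_deriv)
  have C2: "Ck (Suc 0) (\<lambda>v. r * dir_deriv e f v)" for r e by (intro Ck_mult Ck_const C)
  have f: "dir_deriv (a, b, c) f = (\<lambda>v. a * pd1 f v + b * pd2 f v + c * pd3 f v)"
    by (rule ext) (rule dir_deriv_triple[OF Ck_differentiable[OF assms]])
  have s: "dir_deriv d (\<lambda>v. r * dir_deriv e f v) v = r * dir_deriv d (dir_deriv e f) v" for d r e
    using dir_deriv_mult[of "\<lambda>v. r" v "dir_deriv e f" d] Ck_differentiable[OF C] by simp
  have "dir_deriv d (\<lambda>v. a * pd1 f v + b * pd2 f v + c * pd3 f v) v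
      = a * dir_deriv d (pd1 f) v + b * dir_deriv d (pd2 f) v + c * dir_deriv d (pd3 f) v" for d
    by (simp only: dir_deriv_add_fun[OF Ck_add[OF C2 C2] C2] dir_deriv_add_fun[OF C2 C2] s)
  then show ?thesis
    unfolding f by (subst dir_deriv_triple[OF Ck_differentiable[OF Ck_add[OF Ck_add[OF C2 C2] C2]]]) simp
qed

lemma laplacian_exp_mult:
  fixes g :: "real \<times> (real ^ 'd::finite) \<Rightarrow> real"
  assumes g: "Ck (Suc (Suc 0)) g"
  shows "laplacian (\<lambda>x. exp (- (\<alpha> + \<nu> * (fst x - \<beta>))) * g x) x
    = exp (- (\<alpha> + \<nu> * (fst x - \<beta>))) * (\<nu>\<^sup>2 * g x - 2 * \<nu> * dir_deriv (1, 0) g x + laplacian g x)"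
proof -
  define E where "E = (\<lambda>x :: real \<times> (real ^ 'd). exp (- (\<alpha> + \<nu> * (fst x - \<beta>))))"
  have CE: "Ck k E" for k
    unfolding E_def by (intro Ck_comp[OF Ck_exp] Ck_intros Ck_linear bounded_linear_fst)
  have dE: "dir_deriv e E = (\<lambda>x. - \<nu> * fst e * E x)" for e
  proof (rule ext, rule dir_deriv_eqI)
    fix x
    show "(E has_derivative (\<lambda>e. - \<nu> * fst e * E x)) (at x)"
      unfolding E_def by (auto intro!: derivative_eq_intros simp: algebra_simps)
  qed
  have ddE: "dir_deriv e (dir_deriv e E) x = (\<nu> * fst e)\<^sup>2 * E x" for e x
  proof -
    have "dir_deriv e (\<lambda>x. - \<nu> * fst e * E x) x = - \<nu> * fst e * dir_deriv e E x"
      using dir_deriv_mult[of "\<lambda>x. - \<nu> * fst e" x E e] Ck_differentiable[OF CE] by simp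
    then show ?thesis by (simp add: dE power2_eq_square)
  qed
  have "laplacian (\<lambda>x. E x * g x) x = E x * (\<nu>\<^sup>2 * g x - 2 * \<nu> * dir_deriv (1, 0) g x + laplacian g x)"
    unfolding laplacian_def dir_deriv2_mult[OF CE g] ddE
    unfolding dE by (simp add: sum_distrib_left algebra_simps)
  then show ?thesis by (simp add: E_def)
qed

text \<open>Conjugation by the exponential produces \<open>\<nu>\<^sup>2 = la\<close> and a first
  order term. With L = \<nu> / h the axial coefficients become h^2 / la and 2 h, and the sums over
  coordinates become the inner products of k and k'. In the application \<beta> is the left end of a
  block and \<gamma> its centre.\<close>

lemma laplacian_triple:
  fixes k k' :: "real ^ 'd::finite" and \<Phi> :: "real \<times> real \<times> real \<Rightarrow> real" and \<alpha> \<beta> \<gamma> :: real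
  assumes \<Phi>: "Ck (Suc (Suc 0)) \<Phi>" and L: "L > 0" and nu: "\<nu> > 0"
    and k: "k \<bullet> k = la" "k \<bullet> k' = ka" "k' \<bullet> k' = la + 4" and hL: "h * L = \<nu>" "\<nu>\<^sup>2 = la"
  defines "f \<equiv> (\<lambda>x. exp (- (\<alpha> + \<nu> * (fst x - \<beta>))) * \<Phi> ((fst x - \<gamma>) / L, k \<bullet> snd x, k' \<bullet> snd x))"
  shows "laplacian f x = exp (- (\<alpha> + \<nu> * (fst x - \<beta>))) *
      (la * \<Phi> ((fst x - \<gamma>) / L, k \<bullet> snd x, k' \<bullet> snd x) + block_op h la ka \<Phi> ((fst x - \<gamma>) / L, k \<bullet> snd x, k' \<bullet> snd x))"
proof -
  define A where "A = (\<lambda>x :: real \<times> (real ^ 'd). (fst x / L, k \<bullet> snd x, k' \<bullet> snd x))"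
  define c where "c = (- \<gamma> / L, 0 :: real, 0 :: real)"
  have A: "bounded_linear A"
    unfolding A_def by (intro bounded_linear_Pair bounded_linear_divide[THEN bounded_linear_compose]
        bounded_linear_fst bounded_linear_inner_right[THEN bounded_linear_compose] bounded_linear_snd)
  define g where "g = (\<lambda>x. \<Phi> (A x + c))"
  have Ac: "A x + c = ((fst x - \<gamma>) / L, k \<bullet> snd x, k' \<bullet> snd x)" for x
    by (simp add: A_def c_def diff_divide_distrib)
  have g: "g = (\<lambda>x. \<Phi> ((fst x - \<gamma>) / L, k \<bullet> snd x, k' \<bullet> snd x))" by (simp add: g_def Ac)
  have Cg: "Ck (Suc (Suc 0)) g" unfolding g_def by (rule Ck_affine[OF \<Phi> A])
  define v where "v = A x + c"
  have A1: "A (1, 0) = (1 / L, 0, 0)" by (simp add: A_def)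
  have Ai: "A (0, axis i 1) = (0, k $ i, k' $ i)" for i by (simp add: A_def inner_axis)
  have d1: "dir_deriv (1, 0) g x = 1 / L * pd1 \<Phi> v"
    unfolding g_def dir_deriv_affine_comp[OF A Ck_differentiable[OF \<Phi>]] v_def[symmetric] A1
      dir_deriv_triple[OF Ck_differentiable[OF \<Phi>], of "1 / L" 0 0] by simp
  have d11: "dir_deriv (1, 0) (dir_deriv (1, 0) g) x = 1 / L * (1 / L * pd1 (pd1 \<Phi>) v)"
    unfolding g_def dir_deriv2_affine[OF A \<Phi>] v_def[symmetric] A1
      dir_deriv2_triple[OF \<Phi>, of "1 / L" 0 0] by simp
  have dii: "dir_deriv (0, axis i 1) (dir_deriv (0, axis i 1) g) x
      = (k $ i * k $ i) * pd2 (pd2 \<Phi>) v + (k $ i * k' $ i) * (pd2 (pd3 \<Phi>) v + pd3 (pd2 \<Phi>) v)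
        + (k' $ i * k' $ i) * pd3 (pd3 \<Phi>) v" for i
    unfolding g_def dir_deriv2_affine[OF A \<Phi>] v_def[symmetric] Ai
      dir_deriv2_triple[OF \<Phi>, of 0 "k $ i" "k' $ i"] by (simp add: algebra_simps)
  have "laplacian g x = 1 / L * (1 / L * pd1 (pd1 \<Phi>) v) + la * pd2 (pd2 \<Phi>) v
      + ka * (pd2 (pd3 \<Phi>) v + pd3 (pd2 \<Phi>) v) + (la + 4) * pd3 (pd3 \<Phi>) v"
    unfolding laplacian_def d11 dii k(3)[symmetric]
    unfolding k(1,2)[symmetric] inner_vec_def
    by (simp add: sum.distrib sum_distrib_right)
  moreover have "1 / L * (1 / L * y) = h\<^sup>2 / la * y" for y
    using L nu unfolding hL(2)[symmetric] hL(1)[symmetric] by (auto simp: power2_eq_square)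
  moreover have "2 * \<nu> * (1 / L * y) = 2 * h * y" for y
    using L unfolding hL(1)[symmetric] by simp
  ultimately have "\<nu>\<^sup>2 * g x - 2 * \<nu> * dir_deriv (1, 0) g x + laplacian g x = la * \<Phi> v + block_op h la ka \<Phi> v"
    unfolding d1 block_op_def hL(2) by (simp add: g_def v_def)
  then show ?thesis
    using laplacian_exp_mult[OF Cg, of \<alpha> \<nu> \<beta> x] unfolding f_def g v_def Ac by simp
qed

text \<open>Independent of w for w \<le> 1/2, so that the even extension is smooth; for w \<ge> 1 it
  is the decaying pure mode with which the first block begins.\<close>

definition start :: "real \<Rightarrow> real ^ 'd::finite \<Rightarrow> real \<times> (real ^ 'd) \<Rightarrow> real" where
  "start \<nu> k x = exp (- (\<nu> * (smoothstep (2 * fst x - 1) * (fst x - 1)))) * cos (k \<bullet> snd x)"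

lemma bl_inner_snd: "bounded_linear (\<lambda>x :: real \<times> (real ^ 'd::finite). k \<bullet> snd x)"
  by (intro bounded_linear_inner_right[THEN bounded_linear_compose] bounded_linear_snd)

lemma Ck_start: "Ck m (start \<nu> k)"
  unfolding start_def[abs_def]
  by (intro Ck_intros Ck_comp[OF Ck_exp] Ck_smoothstep_comp Ck_comp[OF Ck_cos] Ck_linear bounded_linear_fst bl_inner_snd)

lemma dir_deriv_zero:
  assumes "f differentiable (at x)"
  shows "dir_deriv 0 f x = 0"
  using linear_0[OF dir_deriv_linear[OF assms]] .

text \<open>The function is a factor depending on w times an eigenfunction in y. The first factor
  has no zeros, so its second derivative divided by it is bounded on [0, 1].\<close>

lemma start_estimate:
  "\<exists>C \<ge> 0. \<forall>x. 0 \<le> fst x \<longrightarrow> fst x \<le> 1 \<longrightarrow> \<bar>laplacian (start \<nu> k) x\<bar> \<le> C * \<bar>start \<nu> k x\<bar>"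
proof -
  define \<phi> where "\<phi> = (\<lambda>w. exp (- (\<nu> * (smoothstep (2 * w - 1) * (w - 1)))))"
  have C\<phi>: "Ck m \<phi>" for m
    unfolding \<phi>_def by (intro Ck_intros Ck_comp[OF Ck_exp] Ck_smoothstep_comp Ck_ident)
  define E where "E = (\<lambda>x :: real \<times> (real ^ 'a). \<phi> (fst x))"
  define c where "c = (\<lambda>x :: real \<times> (real ^ 'a). cos (k \<bullet> snd x))"
  have CE: "Ck m E" for m unfolding E_def using Ck_affine[OF C\<phi> bounded_linear_fst, of m 0] by simp
  have Cc: "Ck m c" for m unfolding c_def by (intro Ck_comp[OF Ck_cos] Ck_linear bl_inner_snd)
  have dE: "dir_deriv e E x = dir_deriv (fst e) \<phi> (fst x)" for e x
    using dir_deriv_affine_comp[OF bounded_linear_fst Ck_differentiable[OF C\<phi>], of e 0 x] by (simp add: E_def)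
  have ddE: "dir_deriv e (dir_deriv e E) x = dir_deriv (fst e) (dir_deriv (fst e) \<phi>) (fst x)" for e x
    using dir_deriv2_affine[OF bounded_linear_fst C\<phi>, of e 0 x] by (simp add: E_def)
  have dc: "dir_deriv e c = (\<lambda>x. - (k \<bullet> snd e) * sin (k \<bullet> snd x))" for e
  proof (rule ext, rule dir_deriv_eqI)
    fix x
    show "(c has_derivative (\<lambda>e. - (k \<bullet> snd e) * sin (k \<bullet> snd x))) (at x)"
      unfolding c_def by (auto intro!: derivative_eq_intros)
  qed
  have ddc: "dir_deriv e (dir_deriv e c) x = - (k \<bullet> snd e)\<^sup>2 * c x" for e x
  proof -
    have "((\<lambda>x. - (k \<bullet> snd e) * sin (k \<bullet> snd x)) has_derivative (\<lambda>d. - (k \<bullet> snd e) * ((k \<bullet> snd d) * cos (k \<bullet> snd x)))) (at x)"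
      by (auto intro!: derivative_eq_intros)
    from dir_deriv_eqI[OF this, of e] show ?thesis unfolding dc by (simp add: c_def power2_eq_square)
  qed
  have s: "start \<nu> k = (\<lambda>x. E x * c x)" by (simp add: start_def[abs_def] E_def \<phi>_def c_def)
  have z: "dir_deriv 0 \<phi> w = 0" "dir_deriv 0 (dir_deriv 0 \<phi>) w = 0" for w
    using dir_deriv_zero[OF Ck_differentiable[OF C\<phi>]] dir_deriv_zero[OF Ck_differentiable[OF Ck_dir_deriv[OF C\<phi>]]] by auto
  have lap: "laplacian (start \<nu> k) x = (dir_deriv 1 (dir_deriv 1 \<phi>) (fst x) - (k \<bullet> k) * E x) * c x" for x
  proof -
    have "(\<Sum>j\<in>UNIV. dir_deriv (0, axis j 1) (dir_deriv (0, axis j 1) (\<lambda>x. E x * c x)) x) = (\<Sum>j\<in>UNIV. - (k $ j * k $ j * (E x * c x)))"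
      by (intro sum.cong refl)
        (simp add: dir_deriv2_mult[OF CE Cc] ddE dE z ddc inner_axis power2_eq_square)
    also have "\<dots> = - ((k \<bullet> k) * E x * c x)"
      by (simp add: inner_vec_def sum_negf sum_distrib_right mult.assoc)
    finally have "laplacian (start \<nu> k) x = dir_deriv 1 (dir_deriv 1 \<phi>) (fst x) * c x - (k \<bullet> k) * E x * c x"
      unfolding laplacian_def s by (simp add: dir_deriv2_mult[OF CE Cc] ddE ddc) (simp add: dc)
    then show ?thesis by (simp add: algebra_simps)
  qed
  have pos: "\<phi> w > 0" for w by (simp add: \<phi>_def)
  have "continuous_on UNIV (dir_deriv 1 (dir_deriv 1 \<phi>))"
    by (intro Ck_continuous[of 0] Ck_dir_deriv C\<phi>)
  then have "continuous_on {0..1} (\<lambda>w. dir_deriv 1 (dir_deriv 1 \<phi>) w / \<phi> w)"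
    using Ck_continuous[OF C\<phi>] pos
    by (intro continuous_on_divide) (auto intro: continuous_on_subset simp: less_imp_neq[symmetric])
  then have "compact ((\<lambda>w. dir_deriv 1 (dir_deriv 1 \<phi>) w / \<phi> w) ` {0..1})"
    by (rule compact_continuous_image) simp
  then have "bounded ((\<lambda>w. dir_deriv 1 (dir_deriv 1 \<phi>) w / \<phi> w) ` {0..1})"
    by (rule compact_imp_bounded)
  then obtain B where B: "\<And>w. w \<in> {0..1} \<Longrightarrow> \<bar>dir_deriv 1 (dir_deriv 1 \<phi>) w / \<phi> w\<bar> \<le> B"
    unfolding bounded_real by blast
  have "0 \<le> \<bar>dir_deriv 1 (dir_deriv 1 \<phi>) 0 / \<phi> 0\<bar>" by (rule abs_ge_zero)
  also have "\<dots> \<le> B" by (rule B) simp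
  finally have B0: "B \<ge> 0" .
  have "\<bar>laplacian (start \<nu> k) x\<bar> \<le> (B + k \<bullet> k) * \<bar>start \<nu> k x\<bar>" if x: "0 \<le> fst x" "fst x \<le> 1" for x
  proof -
    have Ex: "E x > 0" using pos by (simp add: E_def)
    have "\<bar>dir_deriv 1 (dir_deriv 1 \<phi>) (fst x)\<bar> \<le> B * E x"
      using B[of "fst x"] x pos[of "fst x"] by (simp add: E_def divide_le_eq)
    moreover have "\<bar>(k \<bullet> k) * E x\<bar> = (k \<bullet> k) * E x" using Ex by (simp add: abs_mult)
    ultimately have "\<bar>dir_deriv 1 (dir_deriv 1 \<phi>) (fst x) - (k \<bullet> k) * E x\<bar> \<le> (B + k \<bullet> k) * E x"
      using abs_triangle_ineq4[of "dir_deriv 1 (dir_deriv 1 \<phi>) (fst x)" "(k \<bullet> k) * E x"]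
      by (simp add: distrib_right)
    then have "\<bar>dir_deriv 1 (dir_deriv 1 \<phi>) (fst x) - (k \<bullet> k) * E x\<bar> * \<bar>c x\<bar> \<le> (B + k \<bullet> k) * E x * \<bar>c x\<bar>"
      by (rule mult_right_mono) simp
    then show ?thesis unfolding lap using Ex by (simp add: s abs_mult)
  qed
  then show ?thesis using B0 by (intro exI[of _ "B + k \<bullet> k"]) auto
qed

lemma torus_rel_inner:
  fixes k :: "real ^ 'd::finite"
  assumes "torus_rel u v" "\<And>i. k $ i \<in> \<int>"
  shows "\<exists>n::int. k \<bullet> u = k \<bullet> v + 2 * pi * of_int n"
proof -
  obtain m :: "'d \<Rightarrow> int" where m: "\<And>i. u $ i - v $ i = 2 * pi * of_int (m i)"
    using assms(1) unfolding torus_rel_def by metis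
  have "\<forall>i. \<exists>c::int. k $ i = of_int c" using assms(2) by (auto elim: Ints_cases)
  then obtain c :: "'d \<Rightarrow> int" where c: "\<And>i. k $ i = of_int (c i)" by metis
  have "k \<bullet> u - k \<bullet> v = (\<Sum>i\<in>UNIV. k $ i * (u $ i - v $ i))"
    by (simp add: inner_vec_def sum_subtractf right_diff_distrib)
  also have "\<dots> = 2 * pi * of_int (\<Sum>i\<in>UNIV. c i * m i)"
    unfolding m c by (simp add: sum_distrib_left mult_ac)
  finally have "k \<bullet> u = k \<bullet> v + 2 * pi * of_int (\<Sum>i\<in>UNIV. c i * m i)" by simp
  then show ?thesis by blast
qed

section \<open>The glued function on the half-line and its even extension\<close>

locale construction =
  fixes h b C :: real and n0 :: nat and k :: "nat \<Rightarrow> real ^ 'd::finite"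
  assumes h: "h > 0" and b: "b \<ge> 1" and C: "C \<ge> 0" and n0: "b \<le> 4 * real n0 + 1"
    and Ck_block: "\<And>la ka m. (la, ka) \<in> Idx b \<Longrightarrow> Ck m (block h la ka)"
    and block_bound: "\<And>la ka v. (la, ka) \<in> Idx b \<Longrightarrow> v \<in> slab \<Longrightarrow> \<bar>block h la ka v\<bar> \<le> C"
    and block_estimate: "\<And>la ka v. (la, ka) \<in> Idx b \<Longrightarrow> v \<in> slab \<Longrightarrow>
        \<bar>la * block h la ka v + block_op h la ka (block h la ka) v\<bar> \<le> C * \<bar>block h la ka v\<bar>"
    and integral: "\<And>j i. k j $ i \<in> \<int>"
    and norm_k: "\<And>j. k j \<bullet> k j = 4 * (real j + real n0) + 1"
    and angle_k: "\<And>j. (k j \<bullet> k (Suc j))\<^sup>2 \<le> (k j \<bullet> k j) * (k (Suc j) \<bullet> k (Suc j)) / 3"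
begin

definition la :: "nat \<Rightarrow> real" where "la j = 4 * (real j + real n0) + 1"

definition nu :: "nat \<Rightarrow> real" where "nu j = sqrt (la j)"

definition len :: "nat \<Rightarrow> real" where "len j = nu j / h"

text \<open>The factor 10 is the length of the interval [-5, 5] in \<open>slab\<close>; the first
  block begins at 1, where \<open>start\<close> ends.\<close>

definition knot :: "nat \<Rightarrow> real" where "knot j = 1 + (\<Sum>i<j. 10 * len i)"

text \<open>The exponent accumulated up to the left end of block j.\<close>

definition height :: "nat \<Rightarrow> real" where "height j = (\<Sum>i<j. 10 * nu i * len i)"

definition tau :: "nat \<Rightarrow> real \<Rightarrow> real" where "tau j w = (w - (knot j + 5 * len j)) / len j"

definition piece :: "nat \<Rightarrow> real \<times> (real ^ 'd) \<Rightarrow> real" where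
  "piece j x = exp (- (height j + nu j * (fst x - knot j))) *
     block h (la j) (k j \<bullet> k (Suc j)) (tau j (fst x), k j \<bullet> snd x, k (Suc j) \<bullet> snd x)"

text \<open>Half-open zones \<open>(knot j, knot (j + 1)]\<close>: each piece continues to the right into the pure-mode part of the next one,
  but not to the left.\<close>

definition idx :: "real \<Rightarrow> nat" where "idx w = (LEAST j. w \<le> knot (Suc j))"

definition right :: "real \<times> (real ^ 'd) \<Rightarrow> real" where
  "right x = (if fst x \<le> 1 then start (nu 0) (k 0) x else piece (idx (fst x)) x)"

definition sol :: "real \<times> (real ^ 'd) \<Rightarrow> real" where
  "sol x = right (\<bar>fst x\<bar>, snd x)"

lemma la_ge: "la j \<ge> 1" "la j \<ge> b" using n0 by (auto simp: la_def)

lemma la_Suc: "la (Suc j) = la j + 4" by (simp add: la_def)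

lemma nu_ge: "nu j \<ge> 1" using la_ge[of j] by (simp add: nu_def)

lemma nu_sq: "(nu j)\<^sup>2 = la j" using la_ge[of j] by (simp add: nu_def)

lemma nu_mono: "i \<le> j \<Longrightarrow> nu i \<le> nu j" by (simp add: nu_def la_def)

lemma len_pos: "len j > 0" using nu_ge[of j] h by (simp add: len_def)

lemma h_len: "h * len j = nu j" using h by (simp add: len_def)

lemma knot_Suc: "knot (Suc j) = knot j + 10 * len j" by (simp add: knot_def)

lemma height_Suc: "height (Suc j) = height j + 10 * nu j * len j" by (simp add: height_def)

lemma knot_mono: "i \<le> j \<Longrightarrow> knot i \<le> knot j"
  unfolding knot_def using len_pos by (intro add_left_mono sum_mono2) (auto intro: less_imp_le)

lemma knot_unbounded: "\<exists>j. w \<le> knot (Suc j)"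
proof -
  have "1 / h \<le> len i" for i using nu_ge[of i] h by (simp add: len_def divide_right_mono)
  then have "(\<Sum>i<j. 1 / h) \<le> (\<Sum>i<j. 10 * len i)" for j
    by (intro sum_mono) (smt (verit) len_pos)
  then have lower: "real j * (1 / h) \<le> knot j" for j by (simp add: knot_def add_increasing)
  obtain j where "w * h < real j" using reals_Archimedean2 by blast
  then have "w < real j * (1 / h)" using h by (simp add: less_divide_eq)
  also have "\<dots> \<le> knot j" by (rule lower)
  also have "\<dots> \<le> knot (Suc j)" by (rule knot_mono) simp
  finally show ?thesis by (blast intro: less_imp_le)
qed

lemma idx_bounds:
  assumes "w > 1"
  shows "knot (idx w) < w" "w \<le> knot (Suc (idx w))"
proof -
  show "w \<le> knot (Suc (idx w))"
    unfolding idx_def using knot_unbounded[of w] by (rule LeastI_ex)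
  show "knot (idx w) < w"
  proof (cases "idx w")
    case 0
    then show ?thesis using assms by (simp add: knot_def)
  next
    case (Suc i)
    then have "\<not> w \<le> knot (Suc i)" using not_less_Least[of i "\<lambda>j. w \<le> knot (Suc j)"] by (simp add: idx_def)
    then show ?thesis using Suc by simp
  qed
qed

lemma knot_ge_1: "knot j \<ge> 1"
  using knot_mono[of 0 j] by (simp add: knot_def)

lemma idx_eq:
  assumes "knot j < w" "w \<le> knot (Suc j)"
  shows "idx w = j"
  unfolding idx_def
proof (rule Least_equality)
  show "j \<le> i" if "w \<le> knot (Suc i)" for i
  proof (rule ccontr)
    assume "\<not> j \<le> i"
    then have "knot (Suc i) \<le> knot j" by (intro knot_mono) simp
    then show False using that assms by simp
  qed
qed fact

lemma piece_left:
  assumes "fst x \<le> knot j + len j"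
  shows "piece j x = exp (- (height j + nu j * (fst x - knot j))) * cos (k j \<bullet> snd x)"
proof -
  have "tau j (fst x) \<le> - 4" using assms len_pos[of j] by (simp add: tau_def divide_le_eq)
  then show ?thesis by (simp add: piece_def block_left)
qed

lemma slope_len: "slope h (la j) = (nu (Suc j) - nu j) * len j"
  using h by (simp add: slope_def nu_def la_Suc len_def)

text \<open>Beyond its block the amplitude raises the decay rate from \<open>nu j\<close> to
  \<open>nu (Suc j)\<close>, by \<open>slope_len\<close>. The result is literally the left part of
  the next piece, see \<open>piece_left\<close>.\<close>

lemma piece_right:
  assumes "knot (Suc j) \<le> fst x"
  shows "piece j x = exp (- (height (Suc j) + nu (Suc j) * (fst x - knot (Suc j)))) * cos (k (Suc j) \<bullet> snd x)"
proof -
  have l: "len j \<noteq> 0" using len_pos[of j] by simp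
  have t5: "tau j (fst x) - 5 = (fst x - knot (Suc j)) / len j"
    using l by (simp add: tau_def knot_Suc field_simps)
  have "0 \<le> (fst x - knot (Suc j)) / len j" using assms len_pos[of j] by simp
  then have "tau j (fst x) \<ge> 5" unfolding t5[symmetric] by simp
  then have "piece j x = exp (- (height j + nu j * (fst x - knot j))) *
      (exp (- (slope h (la j) * (tau j (fst x) - 5))) * cos (k (Suc j) \<bullet> snd x))"
    by (simp add: piece_def block_right)
  also have "slope h (la j) * (tau j (fst x) - 5) = (nu (Suc j) - nu j) * (fst x - knot (Suc j))"
    unfolding t5 slope_len using l by simp
  also have "exp (- (height j + nu j * (fst x - knot j))) * (exp (- ((nu (Suc j) - nu j) * (fst x - knot (Suc j)))) * cos (k (Suc j) \<bullet> snd x))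
      = exp (- (height j + nu j * (fst x - knot j)) + - ((nu (Suc j) - nu j) * (fst x - knot (Suc j)))) * cos (k (Suc j) \<bullet> snd x)"
    by (simp only: exp_add mult.assoc)
  also have "- (height j + nu j * (fst x - knot j)) + - ((nu (Suc j) - nu j) * (fst x - knot (Suc j)))
      = - (height (Suc j) + nu (Suc j) * (fst x - knot (Suc j)))"
    by (simp add: height_Suc knot_Suc algebra_simps)
  finally show ?thesis .
qed

lemma right_start:
  assumes "fst x < 1 + len 0"
  shows "right x = start (nu 0) (k 0) x"
proof (cases "fst x \<le> 1")
  case False
  then have i: "idx (fst x) = 0"
    using assms len_pos[of 0] by (intro idx_eq) (auto simp: knot_def)
  have "piece 0 x = start (nu 0) (k 0) x"
    using assms False by (subst piece_left) (auto simp: knot_def height_def start_def smoothstep_1)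
  then show ?thesis using False i by (simp add: right_def)
qed (simp add: right_def)

text \<open>Just beyond \<open>knot (Suc j)\<close> the two neighbouring pieces are the same pure
  mode. The overlap puts the knots, too, inside open sets on which \<open>right\<close> is a single
  smooth function.\<close>

lemma right_piece:
  assumes "knot j < fst x" "fst x < knot (Suc j) + len (Suc j)"
  shows "right x = piece j x"
proof -
  have x1: "fst x > 1" using knot_ge_1[of j] assms by simp
  show ?thesis
  proof (cases "fst x \<le> knot (Suc j)")
    case True
    then show ?thesis using idx_eq[OF assms(1)] x1 by (simp add: right_def)
  next
    case False
    have "fst x \<le> knot (Suc (Suc j))" using assms len_pos[of "Suc j"] by (simp add: knot_Suc)
    then have "idx (fst x) = Suc j" using False by (intro idx_eq) auto
    moreover have "piece (Suc j) x = piece j x"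
      using assms False by (simp add: piece_left piece_right)
    ultimately show ?thesis using x1 by (simp add: right_def)
  qed
qed

lemma Idx_la: "(la j, k j \<bullet> k (Suc j)) \<in> Idx b"
  using la_ge[of j] angle_k[of j] norm_k[of j] norm_k[of "Suc j"] unfolding Idx_def la_def
  by (simp add: algebra_simps)

lemma Ck_piece: "Ck m (piece j)"
proof -
  define A where "A = (\<lambda>x :: real \<times> (real ^ 'd). (fst x / len j, k j \<bullet> snd x, k (Suc j) \<bullet> snd x))"
  define s where "s = knot j + 5 * len j"
  have A: "bounded_linear A"
    unfolding A_def by (intro bounded_linear_Pair bounded_linear_divide[THEN bounded_linear_compose]
        bounded_linear_fst bl_inner_snd)
  have "piece j = (\<lambda>x. exp (- (height j + nu j * (fst x - knot j))) *
      block h (la j) (k j \<bullet> k (Suc j)) (A x + (- (s / len j), 0, 0)))"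
    unfolding piece_def[abs_def] tau_def s_def[symmetric] by (simp add: A_def diff_divide_distrib)
  then show ?thesis
    by (simp only:) (intro Ck_intros Ck_comp[OF Ck_exp] Ck_affine[OF Ck_block[OF Idx_la] A] Ck_linear bounded_linear_fst)
qed

lemma laplacian_piece:
  "laplacian (piece j) x = exp (- (height j + nu j * (fst x - knot j))) *
     (la j * block h (la j) (k j \<bullet> k (Suc j)) (tau j (fst x), k j \<bullet> snd x, k (Suc j) \<bullet> snd x)
      + block_op h (la j) (k j \<bullet> k (Suc j)) (block h (la j) (k j \<bullet> k (Suc j))) (tau j (fst x), k j \<bullet> snd x, k (Suc j) \<bullet> snd x))"
proof -
  have nu0: "nu j > 0" using nu_ge[of j] by simp
  have n: "k j \<bullet> k j = la j" "k (Suc j) \<bullet> k (Suc j) = la j + 4"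
    unfolding norm_k by (simp_all add: la_def)
  show ?thesis
    unfolding piece_def[abs_def] tau_def
    by (rule laplacian_triple[OF Ck_block[OF Idx_la] len_pos nu0 n(1) refl n(2) h_len nu_sq])
qed

lemma tau_slab:
  assumes "knot j \<le> fst x" "fst x \<le> knot (Suc j)"
  shows "(tau j (fst x), y) \<in> slab"
proof -
  have "- 5 \<le> tau j (fst x)" "tau j (fst x) \<le> 5"
    using assms len_pos[of j] unfolding tau_def knot_Suc by (simp_all add: le_divide_eq divide_le_eq)
  then show ?thesis by (simp add: slab_def)
qed

lemma piece_estimate:
  assumes "knot j \<le> fst x" "fst x \<le> knot (Suc j)"
  shows "\<bar>laplacian (piece j) x\<bar> \<le> C * \<bar>piece j x\<bar>" "\<bar>piece j x\<bar> \<le> C * exp (- height j)"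
proof -
  define E v where "E = exp (- (height j + nu j * (fst x - knot j)))"
    and "v = (tau j (fst x), k j \<bullet> snd x, k (Suc j) \<bullet> snd x)"
  have v: "v \<in> slab" unfolding v_def by (rule tau_slab[OF assms])
  have E: "E > 0" by (simp add: E_def)
  have "E * \<bar>la j * block h (la j) (k j \<bullet> k (Suc j)) v + block_op h (la j) (k j \<bullet> k (Suc j)) (block h (la j) (k j \<bullet> k (Suc j))) v\<bar>
      \<le> E * (C * \<bar>block h (la j) (k j \<bullet> k (Suc j)) v\<bar>)"
    using E by (intro mult_left_mono block_estimate[OF Idx_la v]) auto
  then show "\<bar>laplacian (piece j) x\<bar> \<le> C * \<bar>piece j x\<bar>"
    unfolding laplacian_piece unfolding piece_def E_def[symmetric] v_def[symmetric]
    using E by (simp add: abs_mult mult_ac)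
  have "nu j * (fst x - knot j) \<ge> 0" using assms nu_ge[of j] by simp
  then have "E \<le> exp (- height j)" by (simp add: E_def)
  then have "E * \<bar>block h (la j) (k j \<bullet> k (Suc j)) v\<bar> \<le> exp (- height j) * C"
    using E block_bound[OF Idx_la v] by (intro mult_mono) auto
  then show "\<bar>piece j x\<bar> \<le> C * exp (- height j)"
    unfolding piece_def E_def[symmetric] v_def[symmetric] using E by (simp add: abs_mult mult_ac)
qed

lemma open_strip: "open {x :: real \<times> (real ^ 'd). a < fst x \<and> fst x < c}"
  by (intro open_Collect_conj open_Collect_less continuous_intros)

lemma open_below: "open {x :: real \<times> (real ^ 'd). fst x < c}" and open_above: "open {x :: real \<times> (real ^ 'd). c < fst x}"
  by (intro open_Collect_less continuous_intros)+

lemma Ck_right: "Ck m right"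
proof (rule Ck_local)
  fix x
  show "\<exists>U g. open U \<and> x \<in> U \<and> Ck m g \<and> (\<forall>y\<in>U. right y = g y)"
  proof (cases "fst x < 1 + len 0")
    case True
    then show ?thesis
      by (intro exI[of _ "{x. fst x < 1 + len 0}"] exI[of _ "start (nu 0) (k 0)"])
        (auto simp: open_below Ck_start right_start)
  next
    case False
    define j where "j = idx (fst x)"
    have "fst x > 1" using False len_pos[of 0] by simp
    then have j: "knot j < fst x" "fst x < knot (Suc j) + len (Suc j)"
      using idx_bounds[of "fst x"] len_pos[of "Suc j"] by (auto simp: j_def)
    then show ?thesis
      by (intro exI[of _ "{x. knot j < fst x \<and> fst x < knot (Suc j) + len (Suc j)}"] exI[of _ "piece j"])
        (auto simp: open_strip Ck_piece right_piece)
  qed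
qed

lemma right_estimate: "\<exists>B\<ge>0. \<forall>x. 0 \<le> fst x \<longrightarrow> \<bar>laplacian right x\<bar> \<le> B * \<bar>right x\<bar>"
proof -
  obtain B where B: "B \<ge> 0" "\<And>x. 0 \<le> fst x \<Longrightarrow> fst x \<le> 1 \<Longrightarrow>
      \<bar>laplacian (start (nu 0) (k 0)) x\<bar> \<le> B * \<bar>start (nu 0) (k 0) x\<bar>"
    using start_estimate[of "nu 0" "k 0"] by blast
  have "\<bar>laplacian right x\<bar> \<le> max B C * \<bar>right x\<bar>" if x: "0 \<le> fst x" for x
  proof (cases "fst x \<le> 1")
    case True
    then have x1: "fst x < 1 + len 0" using len_pos[of 0] by simp
    have "laplacian right x = laplacian (start (nu 0) (k 0)) x"
      by (rule laplacian_local[OF open_below[of "1 + len 0"]]) (use x1 in \<open>auto simp: right_start\<close>)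
    then have "\<bar>laplacian right x\<bar> \<le> B * \<bar>right x\<bar>" using B(2)[OF x True] right_start[OF x1] by simp
    also have "\<dots> \<le> max B C * \<bar>right x\<bar>" by (intro mult_right_mono) auto
    finally show ?thesis .
  next
    case False
    define j where "j = idx (fst x)"
    have j: "knot j < fst x" "fst x \<le> knot (Suc j)" using idx_bounds[of "fst x"] False by (auto simp: j_def)
    then have j': "fst x < knot (Suc j) + len (Suc j)" using len_pos[of "Suc j"] by simp
    have "laplacian right x = laplacian (piece j) x"
      by (rule laplacian_local[OF open_strip[of "knot j" "knot (Suc j) + len (Suc j)"]])
        (use j j' in \<open>auto simp: right_piece\<close>)
    then have "\<bar>laplacian right x\<bar> \<le> C * \<bar>right x\<bar>"
      using piece_estimate(1)[of j x] j right_piece[OF j(1) j'] by simp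
    also have "\<dots> \<le> max B C * \<bar>right x\<bar>" by (intro mult_right_mono) auto
    finally show ?thesis .
  qed
  then show ?thesis using B(1) by (intro exI[of _ "max B C"]) auto
qed

lemma sol_right: "fst x > 0 \<Longrightarrow> sol x = right x"
  by (simp add: sol_def)

lemma sol_left: "fst x < 0 \<Longrightarrow> sol x = right (flip x)"
  by (simp add: sol_def flip_def)

text \<open>\<open>start\<close> does not depend on w in this strip, so the reflection leaves no
  kink at 0.\<close>

lemma sol_mid: "\<bar>fst x\<bar> < 1 / 2 \<Longrightarrow> sol x = right x"
  using len_pos[of 0] by (simp add: sol_def right_start start_def smoothstep_0)

lemma Ck_sol: "Ck m sol"
proof (rule Ck_local)
  fix x :: "real \<times> (real ^ 'd)"
  consider "fst x > 0" | "fst x < 0" | "fst x = 0" by linarith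
  then show "\<exists>U g. open U \<and> x \<in> U \<and> Ck m g \<and> (\<forall>y\<in>U. sol y = g y)"
  proof cases
    case 1
    then show ?thesis
      by (intro exI[of _ "{x. 0 < fst x}"] exI[of _ right]) (auto simp: open_above Ck_right sol_right)
  next
    case 2
    then show ?thesis
      by (intro exI[of _ "{x. fst x < 0}"] exI[of _ "\<lambda>x. right (flip x)"])
        (auto simp: open_below Ck_flip[OF Ck_right] sol_left)
  next
    case 3
    then show ?thesis
      by (intro exI[of _ "{x. - (1/2) < fst x \<and> fst x < 1/2}"] exI[of _ right] conjI ballI
          open_strip Ck_right sol_mid) (use 3 in auto)
  qed
qed

lemma sol_estimate: "\<exists>B. \<forall>x. \<bar>laplacian sol x\<bar> \<le> B * \<bar>sol x\<bar>"
proof -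
  obtain B where B: "B \<ge> 0" "\<And>x. 0 \<le> fst x \<Longrightarrow> \<bar>laplacian right x\<bar> \<le> B * \<bar>right x\<bar>"
    using right_estimate by blast
  have "\<bar>laplacian sol x\<bar> \<le> B * \<bar>sol x\<bar>" for x
  proof -
    consider "fst x > 0" | "fst x < 0" | "fst x = 0" by linarith
    then show ?thesis
    proof cases
      case 1
      have "laplacian sol x = laplacian right x"
        by (rule laplacian_local[OF open_above[of 0]]) (use 1 in \<open>auto simp: sol_right\<close>)
      then show ?thesis using B(2)[of x] 1 by (simp add: sol_right)
    next
      case 2
      have "laplacian sol x = laplacian (\<lambda>x. right (flip x)) x"
        by (rule laplacian_local[OF open_below[of 0]]) (use 2 in \<open>auto simp: sol_left\<close>)
      also have "\<dots> = laplacian right (flip x)" by (rule laplacian_flip[OF Ck_right])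
      finally show ?thesis using B(2)[of "flip x"] 2 by (simp add: sol_left flip_def)
    next
      case 3
      have "laplacian sol x = laplacian right x"
        by (rule laplacian_local[OF open_strip[of "- (1/2)" "1/2"]]) (use 3 in \<open>auto intro!: sol_mid\<close>)
      then show ?thesis using B(2)[of x] 3 by (simp add: sol_mid)
    qed
  qed
  then show ?thesis by blast
qed

lemma sol_periodic:
  assumes "torus_rel u v"
  shows "sol (w, u) = sol (w, v)"
proof -
  have start: "start \<nu> (k j) (w, u) = start \<nu> (k j) (w, v)" for \<nu> j w
    using torus_rel_inner[OF assms integral[of j]] by (auto simp: start_def sin_cos_shift)
  have "piece j (w, u) = piece j (w, v)" for j w
  proof -
    obtain n m where nm: "k j \<bullet> u = k j \<bullet> v + 2 * pi * of_int n" "k (Suc j) \<bullet> u = k (Suc j) \<bullet> v + 2 * pi * of_int m"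
      using torus_rel_inner[OF assms integral] by metis
    show ?thesis
      using block_periodic[of h "la j" "k j \<bullet> k (Suc j)" "(tau j w, k j \<bullet> v, k (Suc j) \<bullet> v)" n m]
      by (simp add: piece_def nm)
  qed
  then show ?thesis using start by (simp add: sol_def right_def)
qed

section \<open>Growth of the exponent against the length\<close>

lemma height_ge: "20 / h * ((real j)\<^sup>2 - real j) \<le> height j"
proof -
  have "(\<Sum>i<j. 4 * real i) = 2 * ((real j)\<^sup>2 - real j)"
    by (induction j) (simp_all add: power2_eq_square algebra_simps)
  then have "20 / h * ((real j)\<^sup>2 - real j) = (\<Sum>i<j. 10 / h * (4 * real i))"
    unfolding sum_distrib_left[symmetric] by simp
  also have "\<dots> \<le> height j"
    unfolding height_def
  proof (intro sum_mono)
    fix i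
    have "10 * nu i * len i = 10 / h * la i" unfolding nu_sq[symmetric] len_def by (simp add: power2_eq_square)
    moreover have "4 * real i \<le> la i" by (simp add: la_def)
    ultimately show "10 / h * (4 * real i) \<le> 10 * nu i * len i"
      using h by (simp add: divide_right_mono mult_left_mono)
  qed
  finally show ?thesis .
qed

text \<open>All lengths are replaced by the last one, the largest; this loses only a constant
  factor, which the choice of h absorbs.\<close>

lemma knot_le: "knot (Suc j) \<le> 1 + 20 / h * ((real j + real n0 + 1) * sqrt (real j + real n0 + 1))"
proof -
  define m where "m = real j + real n0 + 1"
  have nu: "nu j \<le> 2 * sqrt m"
  proof -
    have "nu j \<le> sqrt (4 * m)" unfolding nu_def la_def m_def by (intro real_sqrt_le_mono) simp
    then show ?thesis by (simp add: real_sqrt_mult)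
  qed
  have "(\<Sum>i<Suc j. 10 * len i) \<le> (\<Sum>i<Suc j. 10 * len j)"
    unfolding len_def using h nu_mono by (intro sum_mono mult_left_mono divide_right_mono) auto
  also have "\<dots> = 10 / h * (real (Suc j) * nu j)" by (simp add: len_def)
  also have "\<dots> \<le> 10 / h * (m * (2 * sqrt m))"
    using h nu nu_ge[of j] by (intro mult_left_mono mult_mono) (auto simp: m_def)
  finally show ?thesis by (simp add: knot_def m_def mult_ac)
qed

text \<open>The product \<open>z ^ 3 * (m * sqrt m)\<close> is the cube of z sqrt m, so its power
  4/3 is exactly z^4 m^2. This is why 20 / h is written as a cube. The summand 1 is handled by X
  \<le> 2 max(1, Y).\<close>

lemma powr_four_thirds_le:
  assumes "X \<ge> 0" "X \<le> 1 + z ^ 3 * (m * sqrt m)" "z \<ge> 0" "m \<ge> 0"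
  shows "X powr (4 / 3) \<le> 4 * (1 + z ^ 4 * m\<^sup>2)"
proof -
  define Y where "Y = (z * sqrt m) ^ 3"
  have Y: "Y = z ^ 3 * (m * sqrt m)" using assms(4) by (simp add: Y_def power_mult_distrib power3_eq_cube)
  have Y0: "Y \<ge> 0" using assms by (simp add: Y_def)
  have Y43: "Y powr (4 / 3) = z ^ 4 * m\<^sup>2"
  proof (cases "z * sqrt m = 0")
    case True
    then show ?thesis by (auto simp: Y_def)
  next
    case False
    then have p: "z * sqrt m > 0" using assms by (metis mult_nonneg_nonneg order_le_less real_sqrt_ge_zero)
    have "Y powr (4 / 3) = ((z * sqrt m) powr 3) powr (4 / 3)" unfolding Y_def using p by (simp add: powr_numeral)
    also have "\<dots> = (z * sqrt m) powr 4" by (simp add: powr_powr)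
    also have "\<dots> = (z * sqrt m) ^ 4" using p by (simp add: powr_numeral)
    also have "\<dots> = z ^ 4 * ((sqrt m)\<^sup>2)\<^sup>2" by (simp add: power_mult_distrib)
    finally show ?thesis using assms(4) by simp
  qed
  have two: "(2 :: real) powr (4 / 3) \<le> 4"
  proof -
    have "(2 :: real) powr (4 / 3) \<le> 2 powr 2" by (rule powr_mono) auto
    then show ?thesis by simp
  qed
  have "X \<le> 2 * max 1 Y" using assms(2) Y by (auto simp: max_def)
  then have "X powr (4 / 3) \<le> (2 * max 1 Y) powr (4 / 3)" using assms(1) by (intro powr_mono2) auto
  also have "\<dots> = 2 powr (4 / 3) * max 1 Y powr (4 / 3)" by (rule powr_mult)
  also have "\<dots> \<le> 4 * (1 + Y powr (4 / 3))"
    using two by (intro mult_mono) (auto simp: max_def)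
  finally show ?thesis by (simp add: Y43)
qed

lemma right_decay:
  assumes N: "N > 0" and hz: "20 / h = z ^ 3" and z: "z = 1 / (16 * N)"
  shows "\<exists>B. \<forall>x. 0 \<le> fst x \<longrightarrow> \<bar>right x\<bar> \<le> B * exp (- N * fst x powr (4 / 3))"
proof -
  have z0: "z > 0" using N z by simp
  define K where "K = 4 * N + 8 * N * z ^ 4 * (real n0 + 1)\<^sup>2 + z ^ 3"
  have key: "N * X powr (4 / 3) \<le> height j + K" if X: "0 \<le> X" "X \<le> knot (Suc j)" for X j
  proof -
    define m where "m = real j + real n0 + 1"
    have "X \<le> 1 + z ^ 3 * (m * sqrt m)" using X(2) knot_le[of j] unfolding m_def hz by simp
    then have "X powr (4 / 3) \<le> 4 * (1 + z ^ 4 * m\<^sup>2)"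
      using X(1) z0 by (intro powr_four_thirds_le) (auto simp: m_def)
    then have "N * X powr (4 / 3) \<le> N * (4 * (1 + z ^ 4 * m\<^sup>2))" using N by (intro mult_left_mono) auto
    also have "\<dots> \<le> N * (4 * (1 + z ^ 4 * (2 * (real j)\<^sup>2 + 2 * (real n0 + 1)\<^sup>2)))"
    proof -
      have "0 \<le> (real j - (real n0 + 1))\<^sup>2" by simp
      then have "m\<^sup>2 \<le> 2 * (real j)\<^sup>2 + 2 * (real n0 + 1)\<^sup>2"
        unfolding m_def by (simp add: power2_eq_square algebra_simps)
      then show ?thesis using N z0 by (intro mult_left_mono add_left_mono) auto
    qed
    also have "\<dots> = 8 * (N * z) * z ^ 3 * (real j)\<^sup>2 + (4 * N + 8 * N * z ^ 4 * (real n0 + 1)\<^sup>2)"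
      by (simp add: algebra_simps power_numeral_reduce)
    \<comment> \<open>The choice z = 1 / (16 N) leaves half of the leading term of
      \<open>height\<close>; the other half absorbs the linear loss -j.\<close>
    also have "8 * (N * z) = 1 / 2" using N z by simp
    also have "1 / 2 * z ^ 3 * (real j)\<^sup>2 \<le> z ^ 3 * ((real j)\<^sup>2 - real j) + z ^ 3"
    proof -
      have "0 \<le> (real j - 1)\<^sup>2" by simp
      then have "(real j)\<^sup>2 / 2 \<le> (real j)\<^sup>2 - real j + 1" by (simp add: power2_eq_square algebra_simps)
      then have "z ^ 3 * ((real j)\<^sup>2 / 2) \<le> z ^ 3 * ((real j)\<^sup>2 - real j + 1)" using z0 by (intro mult_left_mono) auto
      then show ?thesis by (simp add: algebra_simps)
    qed
    also have "z ^ 3 * ((real j)\<^sup>2 - real j) \<le> height j" using height_ge[of j] unfolding hz .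
    finally show ?thesis by (simp add: K_def)
  qed
  define B where "B = max (exp (nu 0) * exp N) (C * exp K)"
  have "\<bar>right x\<bar> \<le> B * exp (- N * fst x powr (4 / 3))" if x: "0 \<le> fst x" for x
  proof (cases "fst x \<le> 1")
    case True
    have "smoothstep (2 * fst x - 1) * (1 - fst x) \<le> 1 * 1"
      using True x smoothstep_le_1 by (intro mult_mono) auto
    then have "nu 0 * (smoothstep (2 * fst x - 1) * (1 - fst x)) \<le> nu 0 * 1"
      using nu_ge[of 0] by (intro mult_left_mono) auto
    then have "- (nu 0 * (smoothstep (2 * fst x - 1) * (fst x - 1))) \<le> nu 0" by (simp add: algebra_simps)
    then have "exp (- (nu 0 * (smoothstep (2 * fst x - 1) * (fst x - 1)))) * \<bar>cos (k 0 \<bullet> snd x)\<bar> \<le> exp (nu 0) * 1"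
      by (intro mult_mono) auto
    then have "\<bar>right x\<bar> \<le> exp (nu 0)" using True by (simp add: right_def start_def abs_mult)
    also have "\<dots> \<le> exp (nu 0) * exp N * exp (- N * fst x powr (4 / 3))"
    proof -
      have "fst x powr (4 / 3) \<le> 1 powr (4 / 3)" using True x by (intro powr_mono2) auto
      then have "0 \<le> N + - N * fst x powr (4 / 3)" using N by simp
      then have "exp (nu 0) \<le> exp (nu 0) * exp (N + - N * fst x powr (4 / 3))" by simp
      then show ?thesis by (simp only: exp_add mult.assoc)
    qed
    also have "\<dots> \<le> B * exp (- N * fst x powr (4 / 3))" by (intro mult_right_mono) (auto simp: B_def)
    finally show ?thesis .
  next
    case False
    define j where "j = idx (fst x)"
    have j: "knot j < fst x" "fst x \<le> knot (Suc j)" using idx_bounds[of "fst x"] False by (auto simp: j_def)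
    have "\<bar>right x\<bar> \<le> C * exp (- height j)"
      using False piece_estimate(2)[of j x] j by (simp add: right_def j_def)
    also have "\<dots> \<le> C * exp (K + - N * fst x powr (4 / 3))"
      using key[OF x j(2)] C by (intro mult_left_mono) auto
    also have "\<dots> = C * exp K * exp (- N * fst x powr (4 / 3))" by (simp only: exp_add mult.assoc)
    also have "\<dots> \<le> B * exp (- N * fst x powr (4 / 3))" by (intro mult_right_mono) (auto simp: B_def)
    finally show ?thesis .
  qed
  then show ?thesis by blast
qed

lemma sol_decay:
  assumes "N > 0" "20 / h = z ^ 3" "z = 1 / (16 * N)"
  shows "\<exists>B. \<forall>x. \<bar>sol x\<bar> \<le> B * exp (- N * \<bar>fst x\<bar> powr (4 / 3))"
  using right_decay[OF assms] unfolding sol_def by (metis abs_ge_zero fst_conv)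

lemma sol_nonzero: "sol (0, 0) = 1"
  by (simp add: sol_def right_def start_def smoothstep_0)

end

lemma torus_rel_rep: "torus_rel (rep_torus (torus_of v)) v"
  by (metis Quotient_torus Quotient_rep_abs equivp_torus_rel equivp_reflp)

theorem theorem0p1:
  fixes N :: real
  assumes "CARD('d::finite) \<ge> 3" and "N > 0"
  shows "\<exists>(F :: real \<times> 'd torus \<Rightarrow> real) (C :: real).
    cyl_smooth F \<and> (\<exists>x. F x \<noteq> 0) \<and>
    (\<forall>w y. \<bar>cyl_laplacian F (w, y)\<bar> \<le> C * \<bar>F (w, y)\<bar> \<and>
           \<bar>F (w, y)\<bar> \<le> C * exp (- N * \<bar>w\<bar> powr (4 / 3)))"
proof -
  \<comment> \<open>\<open>z\<close> is the value demanded by \<open>right_decay\<close>, and 20 / h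
    = z^3 then determines h. A large N means a large h and thus short blocks.\<close>
  define z h where "z = 1 / (16 * N)" and "h = 20 / z ^ 3"
  have h: "h > 0" and hz: "20 / h = z ^ 3" using assms(2) by (simp_all add: h_def z_def)
  obtain b C0 where b: "b \<ge> 1" and C0: "C0 \<ge> 0" and block: "\<And>la ka. (la, ka) \<in> Idx b \<Longrightarrow> (\<forall>m. Ck m (block h la ka)) \<and>
    (\<forall>v \<in> slab. \<bar>block h la ka v\<bar> \<le> C0 \<and>
       \<bar>la * block h la ka v + block_op h la ka (block h la ka) v\<bar> \<le> C0 * \<bar>block h la ka v\<bar>)"
    using block_exists[OF h] by metis
  \<comment> \<open>Starting the frequencies at \<open>n0\<close> puts every \<open>la\<close> above
    the threshold \<open>b\<close> of the block estimates.\<close>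
  obtain n0 :: nat where "b < real n0" using reals_Archimedean2 by blast
  then have n0: "b \<le> 4 * real n0 + 1" by simp
  obtain k :: "nat \<Rightarrow> real ^ 'd" where k: "\<And>j i. k j $ i \<in> \<int>" "\<And>j. k j \<bullet> k j = 4 * (real j + real n0) + 1"
    "\<And>j. (k j \<bullet> k (Suc j))\<^sup>2 \<le> (k j \<bullet> k j) * (k (Suc j) \<bullet> k (Suc j)) / 3"
    using lattice_vectors[OF assms(1), of n0] by metis
  interpret construction h b C0 n0 k
    by unfold_locales (use h b C0 n0 block k in auto)
  obtain B1 where B1: "\<And>x. \<bar>laplacian sol x\<bar> \<le> B1 * \<bar>sol x\<bar>" using sol_estimate by blast
  obtain B2 where B2: "\<And>x. \<bar>sol x\<bar> \<le> B2 * exp (- N * \<bar>fst x\<bar> powr (4 / 3))"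
    using sol_decay[OF assms(2) hz z_def] by blast
  \<comment> \<open>By periodicity of \<open>sol\<close> the chosen representative does not matter,
    and \<open>cyl_lift F\<close> is \<open>sol\<close> itself.\<close>
  define F :: "real \<times> 'd torus \<Rightarrow> real" where "F = (\<lambda>(w, y). sol (w, rep_torus y))"
  have lift: "cyl_lift F = sol"
    using sol_periodic[OF torus_rel_rep] by (auto simp: cyl_lift_def F_def)
  have "cyl_smooth F" unfolding cyl_smooth_def lift using Ck_sol by blast
  moreover have "F (0, torus_of 0) \<noteq> 0"
    using sol_nonzero sol_periodic[OF torus_rel_rep, of 0 0] by (simp add: F_def)
  moreover have "\<bar>cyl_laplacian F (w, y)\<bar> \<le> max B1 B2 * \<bar>F (w, y)\<bar>" for w y
  proof -
    have "\<bar>cyl_laplacian F (w, y)\<bar> \<le> B1 * \<bar>F (w, y)\<bar>"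
      using B1[of "(w, rep_torus y)"] unfolding cyl_laplacian_def lift by (simp add: F_def)
    also have "\<dots> \<le> max B1 B2 * \<bar>F (w, y)\<bar>" by (intro mult_right_mono) auto
    finally show ?thesis .
  qed
  moreover have "\<bar>F (w, y)\<bar> \<le> max B1 B2 * exp (- N * \<bar>w\<bar> powr (4 / 3))" for w y
  proof -
    have "\<bar>F (w, y)\<bar> \<le> B2 * exp (- N * \<bar>w\<bar> powr (4 / 3))"
      using B2[of "(w, rep_torus y)"] by (simp add: F_def)
    also have "\<dots> \<le> max B1 B2 * exp (- N * \<bar>w\<bar> powr (4 / 3))" by (intro mult_right_mono) auto
    finally show ?thesis .
  qed
  ultimately show ?thesis by blast
qed

end
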